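(* Let $\omega$ be a non-quasianalytic concave weight function, and let $\sigma$ be a weight function satisfying $\sigma(t)=o(t)$ as $t\to\infty$. Suppose that there exists $r\in(0,1)$ such that $$\exists C>0\ \forall t>0:\quad \int_1^\infty \frac{\omega(tu)}{u^{1+r}}\,du\le C\sigma(t)+C .$$ Then for every non-empty closed set $A\subseteq\mathbb{R}^n$ we have $$j^\infty_A\big(\mathcal{E}^{(\omega)}(\mathbb{R}^n)\big)\supseteq \mathcal{E}^{(\sigma)}(A),$$ that is, every $\sigma$-Whitney ultrajet of Beurling type $F=(F^\alpha)_{\alpha}$ on $A$ is of the form $F=j_A^\infty(f)$ for some $f\in\mathcal{E}^{(\omega)}(\mathbb{R}^n)$.
   Context: Weight functions. A weight function is a continuous increasing (not necessarily strictly) function $\omega:[0,\infty)\to[0,\infty)$ with $\omega(0)=0$ such that $\omega(2t)=O(\omega(t))$ as $t\to\infty$, $\log t=o(\omega(t))$ as $t\to\infty$, and $\varphi_\omega(t):=\omega(e^t)$ is convex on $\mathbb{R}$. It is non-quasianalytic if $\int_1^\infty \omega(t)t^{-2}\,dt<\infty$. The Young conjugate is $\varphi_\omega^*(t):=\sup_{s\ge0}(st-\varphi_\omega(s))$, $t\ge0$. Functions. All functions are real-valued and $\mathbb{N}=\{0,1,2,\dots\}$. For $U\subseteq\mathbb{R}^n$ open and $\rho>0$ put $$\|f\|^\omega_{U,\rho}:=\sup_{x\in U,\ \alpha\in\mathbb{N}^n}|\partial^\alpha f(x)|\exp\big(-\tfrac1\rho\varphi_\omega^*(\rho|\alpha|)\big).$$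 The Beurling class $\mathcal{E}^{(\omega)}(\mathbb{R}^n)$ is the space of all $f\in C^\infty(\mathbb{R}^n)$ such that $\|f\|^\omega_{U,1/k}<\infty$ for all relatively compact open $U\subseteq\mathbb{R}^n$ and all integers $k\ge1$. Jets. Let $A\subseteq\mathbb{R}^n$ be closed and non-empty. For $F=(F^\alpha)_{\alpha\in\mathbb{N}^n}$ with continuous $F^\alpha:A\to\mathbb{R}$ set $$(R^p_xF)^\alpha(y):=F^\alpha(y)-\sum_{|\beta|\le p-|\alpha|}\frac{(y-x)^\beta}{\beta!}F^{\alpha+\beta}(x),\qquad |\alpha|\le p.$$ $\mathcal{E}(A)$ is the set of Whitney jets, i.e. those $F$ such that for all compact $K\subseteq A$, all $p\in\mathbb{N}$ and all $|\alpha|\le p$ one has $(R^p_xF)^\alpha(y)=o(|y-x|^{p-|\alpha|})$ as $|y-x|\to0$, $x,y\in K$. For a weight function $\sigma$, the space $\mathcal{E}^{(\sigma)}(A)$ of $\sigma$-Whitney ultrajets of Beurling type consists of all $F\in\mathcal{E}(A)$ such that for all compact $K\subseteq A$ and all integers $m\ge1$ $$\sup_{x\in K}\sup_{\alpha\in\mathbb{N}^n}|F^\alpha(x)|\exp\big(-m\varphi_\sigma^*(\tfrac{|\alpha|}{m})\big)<\infty$$ and $$\sup_{x\ne y\in K}\ \sup_{p\in\mathbb{N}}\ \sup_{|\alpha|\le p}|(R^p_xF)^\alpha(y)|\frac{(p+1-|\alpha|)!}{|x-y|^{p+1-|\alpha|}}\exp\big(-m\varphi_\sigma^*(\tfrac{p+1}{m})\big)<\infty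 .$$ The jet mapping is $j^\infty_A(f):=(\partial^\alpha f|_A)_{\alpha\in\mathbb{N}^n}$ for $f\in C^\infty(\mathbb{R}^n)$. *)

theory Defs
  imports "HOL-Analysis.Analysis" "HOL-Library.Landau_Symbols"
begin

text \<open>Functions on \<open>[0,\<infinity>)\<close> are total functions \<open>real \<Rightarrow> real\<close> whose values at negative
  arguments are never used.\<close>

definition weight_function :: "(real \<Rightarrow> real) \<Rightarrow> bool" where
  "weight_function \<omega> \<longleftrightarrow>
     continuous_on {0..} \<omega> \<and> mono_on {0..} \<omega> \<and> (\<forall>t\<ge>0. 0 \<le> \<omega> t) \<and> \<omega> 0 = 0 \<and>
     (\<lambda>t. \<omega> (2 * t)) \<in> O[at_top](\<omega>) \<and>
     ln \<in> o[at_top](\<omega>) \<and>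
     convex_on UNIV (\<lambda>t. \<omega> (exp t))"

definition non_quasianalytic :: "(real \<Rightarrow> real) \<Rightarrow> bool" where
  "non_quasianalytic \<omega> \<longleftrightarrow> (\<integral>\<^sup>+t\<in>{1..}. ennreal (\<omega> t / t\<^sup>2) \<partial>lborel) < \<infinity>"

definition young_conj :: "(real \<Rightarrow> real) \<Rightarrow> real \<Rightarrow> real" where
  "young_conj \<omega> t = (SUP s\<in>{0..}. s * t - \<omega> (exp s))"

text \<open>The supremum above is taken in \<open>real\<close>; it is a genuine one:\<close>

lemma bdd_above_young_conj:
  assumes "weight_function \<omega>"
  shows "bdd_above ((\<lambda>s. s * t - \<omega> (exp s)) ` {0..})"
proof -
  have "ln \<in> o[at_top](\<omega>)" and nn: "\<And>u. u \<ge> 0 \<Longrightarrow> 0 \<le> \<omega> u"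
    using assms by (auto simp: weight_function_def)
  then have "eventually (\<lambda>u. norm (ln u) \<le> 1 / (\<bar>t\<bar> + 1) * norm (\<omega> u)) at_top"
    by (intro landau_o.smallD) auto
  then obtain N where N: "\<And>u. u \<ge> N \<Longrightarrow> norm (ln u) \<le> 1 / (\<bar>t\<bar> + 1) * norm (\<omega> u)"
    by (auto simp: eventually_at_top_linorder)
  have "s * t - \<omega> (exp s) \<le> \<bar>N\<bar> * \<bar>t\<bar>" if s: "s \<ge> 0" for s
  proof (cases "s \<ge> \<bar>N\<bar>")
    case True
    have "N \<le> exp s" using True exp_ge_add_one_self[of s] by linarith
    from N[OF this] have "s \<le> \<omega> (exp s) / (\<bar>t\<bar> + 1)" using s nn[of "exp s"] by simp
    then have "s * (\<bar>t\<bar> + 1) \<le> \<omega> (exp s)"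
      using pos_le_divide_eq[of "\<bar>t\<bar> + 1" s "\<omega> (exp s)"] by linarith
    moreover have "s * t \<le> s * (\<bar>t\<bar> + 1)" using s by (intro mult_left_mono) auto
    moreover have "0 \<le> \<bar>N\<bar> * \<bar>t\<bar>" by simp
    ultimately show ?thesis by linarith
  next
    case False
    have "s * t \<le> s * \<bar>t\<bar>" using s by (intro mult_left_mono) auto
    also have "\<dots> \<le> \<bar>N\<bar> * \<bar>t\<bar>" using False by (intro mult_right_mono) auto
    finally show ?thesis using nn[of "exp s"] by simp
  qed
  then show ?thesis by (intro bdd_aboveI2) auto
qed

type_synonym 'n mindex = "'n \<Rightarrow> nat"

definition msize :: "'n::finite mindex \<Rightarrow> nat" where
  "msize \<alpha> = (\<Sum>i\<in>UNIV. \<alpha> i)"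

definition mfact :: "'n::finite mindex \<Rightarrow> real" where
  "mfact \<alpha> = (\<Prod>i\<in>UNIV. fact (\<alpha> i))"

definition mpow :: "real ^ 'n::finite \<Rightarrow> 'n mindex \<Rightarrow> real" where
  "mpow z \<alpha> = (\<Prod>i\<in>UNIV. (z $ i) ^ \<alpha> i)"

definition madd :: "'n mindex \<Rightarrow> 'n mindex \<Rightarrow> 'n mindex" where
  "madd \<alpha> \<beta> = (\<lambda>i. \<alpha> i + \<beta> i)"

lemma finite_msize_le: "finite {\<beta> :: 'n::finite mindex. msize \<beta> \<le> k}"
proof (rule finite_subset)
  show "{\<beta> :: 'n mindex. msize \<beta> \<le> k} \<subseteq> (UNIV \<rightarrow>\<^sub>E {..k})"
  proof
    fix \<beta> :: "'n mindex"
    assume "\<beta> \<in> {\<beta>. msize \<beta> \<le> k}"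
    then have "\<beta> i \<le> k" for i
      using member_le_sum[of i UNIV \<beta>] by (simp add: msize_def)
    then show "\<beta> \<in> UNIV \<rightarrow>\<^sub>E {..k}" by (simp add: PiE_UNIV_domain)
  qed
  show "finite ((UNIV :: 'n set) \<rightarrow>\<^sub>E {..k})" by (intro finite_PiE) auto
qed

definition has_partial :: "'n::finite \<Rightarrow> (real ^ 'n \<Rightarrow> real) \<Rightarrow> real ^ 'n \<Rightarrow> bool" where
  "has_partial i f x \<longleftrightarrow> (\<lambda>t. f (x + t *\<^sub>R axis i 1)) field_differentiable (at 0)"

definition partial :: "'n::finite \<Rightarrow> (real ^ 'n \<Rightarrow> real) \<Rightarrow> real ^ 'n \<Rightarrow> real" where
  "partial i f x = deriv (\<lambda>t. f (x + t *\<^sub>R axis i 1)) 0"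

primrec C_k :: "nat \<Rightarrow> (real ^ 'n::finite \<Rightarrow> real) \<Rightarrow> bool" where
  "C_k 0 f \<longleftrightarrow> continuous_on UNIV f"
| "C_k (Suc k) f \<longleftrightarrow> continuous_on UNIV f \<and> (\<forall>i. (\<forall>x. has_partial i f x) \<and> C_k k (partial i f))"

definition C_infinity :: "(real ^ 'n::finite \<Rightarrow> real) \<Rightarrow> bool" where
  "C_infinity f \<longleftrightarrow> (\<forall>k. C_k k f)"

text \<open>A finite index type carries no canonical order, so an arbitrary enumeration
  \<open>[i\<^sub>1, \<dots>, i\<^sub>n]\<close> of the coordinates is fixed and \<open>\<partial>\<^sup>\<alpha>\<close> is the iterated partial derivative in that
  order.  It is only applied to smooth functions, for which the order is immaterial.\<close>

definition coords :: "'n::finite list" where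
  "coords = (SOME xs. distinct xs \<and> set xs = UNIV)"

lemma coords: "distinct (coords :: 'n::finite list)" "set (coords :: 'n list) = UNIV"
proof -
  have "\<exists>xs :: 'n list. distinct xs \<and> set xs = UNIV"
    using finite_distinct_list[of "UNIV :: 'n set"] by auto
  from someI_ex[OF this] show "distinct (coords :: 'n list)" "set (coords :: 'n list) = UNIV"
    unfolding coords_def by auto
qed

definition mderiv :: "'n::finite mindex \<Rightarrow> (real ^ 'n \<Rightarrow> real) \<Rightarrow> real ^ 'n \<Rightarrow> real" where
  "mderiv \<alpha> f = foldr (\<lambda>i. partial i ^^ \<alpha> i) coords f"

definition ultra_norm ::
    "(real \<Rightarrow> real) \<Rightarrow> (real ^ 'n::finite) set \<Rightarrow> real \<Rightarrow> (real ^ 'n \<Rightarrow> real) \<Rightarrow> ennreal" where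
  "ultra_norm \<omega> U \<rho> f =
     (SUP x\<in>U. SUP \<alpha>.
        ennreal (\<bar>mderiv \<alpha> f x\<bar> * exp (- (1 / \<rho>) * young_conj \<omega> (\<rho> * real (msize \<alpha>)))))"

definition beurling_class :: "(real \<Rightarrow> real) \<Rightarrow> (real ^ 'n::finite \<Rightarrow> real) set" where
  "beurling_class \<omega> =
     {f. C_infinity f \<and>
         (\<forall>U k. open U \<and> compact (closure U) \<and> (k::nat) \<ge> 1 \<longrightarrow> ultra_norm \<omega> U (1 / real k) f < \<infinity>)}"

text \<open>A component of a jet on \<open>A\<close> is a function on \<open>A\<close>, represented by its unique
  extension to the whole space that lies in \<open>extensional A\<close>.\<close>

type_synonym 'n jet = "'n mindex \<Rightarrow> real ^ 'n \<Rightarrow> real"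

definition remainder ::
    "nat \<Rightarrow> real ^ 'n::finite \<Rightarrow> 'n jet \<Rightarrow> 'n mindex \<Rightarrow> real ^ 'n \<Rightarrow> real" where
  "remainder p x F \<alpha> y =
     F \<alpha> y - (\<Sum>\<beta> | msize \<beta> \<le> p - msize \<alpha>. mpow (y - x) \<beta> / mfact \<beta> * F (madd \<alpha> \<beta>) x)"

definition whitney_jets :: "(real ^ 'n::finite) set \<Rightarrow> 'n jet set" where
  "whitney_jets A =
     {F. (\<forall>\<alpha>. F \<alpha> \<in> extensional A \<and> continuous_on A (F \<alpha>)) \<and>
         (\<forall>K p \<alpha>. compact K \<and> K \<subseteq> A \<and> msize \<alpha> \<le> p \<longrightarrow>
            (\<forall>\<epsilon>>0. \<exists>\<delta>>0. \<forall>x\<in>K. \<forall>y\<in>K. norm (y - x) < \<delta> \<longrightarrow>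
               \<bar>remainder p x F \<alpha> y\<bar> \<le> \<epsilon> * norm (y - x) ^ (p - msize \<alpha>)))}"

definition beurling_ultrajets :: "(real \<Rightarrow> real) \<Rightarrow> (real ^ 'n::finite) set \<Rightarrow> 'n jet set" where
  "beurling_ultrajets \<sigma> A =
     {F \<in> whitney_jets A. \<forall>K m. compact K \<and> K \<subseteq> A \<and> (m::nat) \<ge> 1 \<longrightarrow>
        (SUP x\<in>K. SUP \<alpha>.
           ennreal (\<bar>F \<alpha> x\<bar> * exp (- real m * young_conj \<sigma> (real (msize \<alpha>) / real m)))) < \<infinity> \<and>
        (SUP (x, y)\<in>{(x, y). x \<in> K \<and> y \<in> K \<and> x \<noteq> y}. SUP p. SUP \<alpha>\<in>{\<alpha>. msize \<alpha> \<le> p}.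
           ennreal (\<bar>remainder p x F \<alpha> y\<bar> *
                    (fact (p + 1 - msize \<alpha>) / norm (x - y) ^ (p + 1 - msize \<alpha>)) *
                    exp (- real m * young_conj \<sigma> (real (p + 1) / real m)))) < \<infinity>}"

definition jet_map :: "(real ^ 'n::finite) set \<Rightarrow> (real ^ 'n \<Rightarrow> real) \<Rightarrow> 'n jet" where
  "jet_map A f = (\<lambda>\<alpha>. restrict (mderiv \<alpha> f) A)"

end

theory Submission
  imports Defs
begin

text \<open>The weight \<open>\<kappa>(t) = \<integral>\<^sub>1\<^sup>\<infinity> \<omega>(t u) u\<^sup>-\<^sup>1\<^sup>-\<^sup>r du\<close> satisfies \<open>\<omega> \<le> 4 \<kappa>\<close> and \<open>\<kappa> \<le> C \<sigma> + C\<close>. Hence a jet of class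
  \<open>\<sigma>\<close> is a jet of class \<open>\<kappa>\<close>, a function of class \<open>\<kappa>\<close> is a function of class \<open>\<omega>\<close>, and it suffices to
  extend jets of class \<open>\<kappa>\<close> to functions of the same class. The advantage of \<open>\<kappa>\<close> is the inequality
  \<open>\<kappa>(l s) \<le> l\<^sup>r \<kappa>(s)\<close> for \<open>l \<ge> 1\<close>, in which \<open>r < 1\<close>; moreover \<open>\<kappa> \<circ> exp\<close> is convex. These two properties,
  monotonicity and \<open>ln t = o(\<kappa>(t))\<close> form the locale \<open>growth_weight\<close>.

  Derivatives of order \<open>k\<close> are measured by \<open>W m k = sup {s\<^sup>k exp(- m \<kappa>(s)) | s \<ge> 1}\<close>, which is
  \<open>exp(m \<phi>\<^sup>*(k / m))\<close> for the Young conjugate of \<open>\<kappa>\<close>; the Beurling class asks for such bounds for all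
  \<open>m > 0\<close>. The extension is built from pieces living at the scales \<open>d\<^sub>J = d\<^sub>0 / 2\<^sup>J\<close>, and its convergence
  is a competition between a gain and a cost, both of which are powers of \<open>exp(\<kappa>(t))\<close> for one frequency
  \<open>t\<close> that belongs to the scale \<open>d\<close>:

  \<^item> The gain. Let \<open>t\<close> maximise \<open>\<kappa>(s) - c s\<close> with \<open>c = L d / m\<close>. By convexity of \<open>\<kappa> \<circ> exp\<close> also
  \<open>\<kappa>(s) \<ge> \<kappa>(t) + c t ln(s / t)\<close> (\<open>touch_ln\<close>), so the supremum in \<open>W m k\<close> for \<open>k\<close> close to \<open>m c t\<close> is
  essentially attained at \<open>s = t\<close>. If all degrees are cut at \<open>k = m c t\<close>, then two Taylor polynomials of
  the jet at points of \<open>A\<close> with distance \<open>O(d)\<close> differ near these points, in all derivatives, by a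
  factor \<open>exp(- m \<kappa>(t) / 4)\<close> (\<open>taylor_term\<close>, \<open>taylor_move_base\<close>, \<open>taylor_change_degree\<close>).

  \<^item> The cost. A smooth step function of length \<open>d\<close> is obtained by averaging over boxes of widths
  \<open>2 / \<mu>\<^sub>i\<close>. Taking for \<open>\<mu>\<^sub>i\<close> first \<open>N\<close> copies of a frequency \<open>\<tau>\<close> and then a Gevrey sequence of order strictly
  between \<open>1\<close> and \<open>1 / r\<close>, one has a member of the Beurling class whose derivatives are bounded by
  \<open>2\<^sup>N W M k\<close>, where \<open>N\<close> is at most \<open>6 M \<kappa>(t)\<close> as soon as \<open>m\<close> is a large multiple of \<open>M\<close>
  (\<open>prod_node_large\<close>, \<open>cutoff_parameters\<close>).

  With \<open>m = B M\<close> for a large constant \<open>B\<close> the gain wins. Let \<open>\<phi>\<^sub>J\<^sub>,\<^sub>k\<close> be the partition of unity made of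
  translates by \<open>d\<^sub>J k\<close>, where \<open>k\<close> is an integer vector, of one bump, and let \<open>T\<^sub>J\<^sub>,\<^sub>k\<close> be the Taylor
  polynomial at a point of \<open>A\<close> closest to \<open>d\<^sub>J k\<close>. The extension is
  \<open>\<Sum>\<^sub>J \<Sum>\<^sub>k\<^sub>,\<^sub>l \<phi>\<^sub>J\<^sub>+\<^sub>1\<^sub>,\<^sub>k \<phi>\<^sub>J\<^sub>,\<^sub>l (T\<^sub>J\<^sub>+\<^sub>1\<^sub>,\<^sub>k - T\<^sub>J\<^sub>,\<^sub>l)\<close>, plus a first term, with \<open>k\<close> restricted to cells close to \<open>A\<close>.
  It converges geometrically together with all derivatives, and near a point of \<open>A\<close> the partial sums
  telescope to \<open>\<Sum>\<^sub>k \<phi>\<^sub>J\<^sub>,\<^sub>k T\<^sub>J\<^sub>,\<^sub>k\<close>, whose derivatives tend to the given jet.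

  To reach all \<open>m\<close> at once, \<open>m = B v\<^sub>J\<close> grows with the scale, so slowly that the constants with which
  the jet obeys its bounds on \<open>A \<inter> cball 0 v\<^sub>J\<close> stay below \<open>exp(\<kappa>(t))\<close> (\<open>slow_sequence\<close>, \<open>levels\<close>).
  The same sequence takes care of unbounded sets \<open>A\<close>.\<close>

section \<open>Iterated partial derivatives indexed by words\<close>

text \<open>Derivatives are indexed by words in the coordinates, which make the order of differentiation
  explicit and turn Leibniz' rule into an induction on the word.\<close>

definition wderiv :: "'n list \<Rightarrow> (real ^ 'n::finite \<Rightarrow> real) \<Rightarrow> real ^ 'n \<Rightarrow> real" where
  "wderiv w f = foldr partial w f"

lemma wderiv_Nil [simp]: "wderiv [] f = f"
  and wderiv_Cons: "wderiv (i # w) f = partial i (wderiv w f)"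
  by (simp_all add: wderiv_def)

definition smooth :: "(real ^ 'n::finite \<Rightarrow> real) \<Rightarrow> bool" where
  "smooth f \<longleftrightarrow> (\<forall>w. continuous_on UNIV (wderiv w f) \<and> (\<forall>i x. has_partial i (wderiv w f) x))"

lemma wderiv_append: "wderiv (u @ w) f = wderiv u (wderiv w f)"
  by (simp add: wderiv_def)

lemma smooth_wderiv: "smooth f \<Longrightarrow> smooth (wderiv w f)"
  unfolding smooth_def wderiv_append[symmetric] by blast

lemma smooth_imp_C_infinity:
  assumes "smooth f"
  shows "C_infinity f"
proof -
  have "C_k k f" for k
    using assms
  proof (induction k arbitrary: f)
    case 0
    then show ?case unfolding smooth_def by (metis C_k.simps(1) wderiv_Nil)
  next
    case (Suc k)
    have "smooth (partial i f)" for i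
      using smooth_wderiv[OF Suc.prems, of "[i]"] by (simp add: wderiv_Cons)
    moreover have "continuous_on UNIV f \<and> (\<forall>i x. has_partial i f x)"
      using Suc.prems unfolding smooth_def by (metis wderiv_Nil)
    ultimately show ?case using Suc.IH by simp
  qed
  then show ?thesis by (simp add: C_infinity_def)
qed

definition mword :: "'n::finite mindex \<Rightarrow> 'n list" where
  "mword \<alpha> = concat (map (\<lambda>i. replicate (\<alpha> i) i) coords)"

lemma mderiv_eq_wderiv: "mderiv \<alpha> f = wderiv (mword \<alpha>) f"
proof -
  have "foldr (\<lambda>i. partial i ^^ \<alpha> i) is f = foldr partial (concat (map (\<lambda>i. replicate (\<alpha> i) i) is)) f" for "is"
    by (induction "is") auto
  then show ?thesis by (simp add: mderiv_def wderiv_def mword_def)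
qed

lemma count_list_mword: "count_list (mword \<alpha>) i = \<alpha> i"
proof -
  have rep: "count_list (replicate k j) i = (if i = j then k else 0)" for k j
    by (induction k) auto
  have "distinct is \<Longrightarrow> count_list (concat (map (\<lambda>i. replicate (\<alpha> i) i) is)) i = (if i \<in> set is then \<alpha> i else 0)" for "is"
    by (induction "is") (auto simp: rep)
  from this[OF coords(1)] show ?thesis by (simp add: mword_def coords(2))
qed

lemma length_eq_msize: "length w = msize (count_list w)"
  using sum_count_set[of w UNIV] by (simp add: msize_def)

lemma length_mword: "length (mword \<alpha>) = msize \<alpha>"
proof -
  have "count_list (mword \<alpha>) = \<alpha>" by (rule ext) (rule count_list_mword)
  then show ?thesis using length_eq_msize[of "mword \<alpha>"] by simp
qed

text \<open>The functions below come with explicit candidates \<open>G w\<close> for all their derivatives, which only have to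
  be checked one partial derivative at a time.\<close>

lemma smooth_family:
  fixes G :: "'n::finite list \<Rightarrow> real ^ 'n \<Rightarrow> real"
  assumes "\<And>w. continuous_on UNIV (G w)"
    and "\<And>w i x. ((\<lambda>t. G w (x + t *\<^sub>R axis i 1)) has_field_derivative G (i # w) x) (at 0)"
  shows "smooth (G [])" and "wderiv w (G []) = G w"
proof -
  have eq: "wderiv w (G []) = G w" for w
  proof (induction w)
    case (Cons i w)
    show ?case
      by (rule ext) (simp only: wderiv_Cons Cons partial_def DERIV_imp_deriv[OF assms(2)])
  qed simp
  show "wderiv w (G []) = G w" by (rule eq)
  show "smooth (G [])"
    unfolding smooth_def eq has_partial_def field_differentiable_def
    by (intro allI conjI exI) (rule assms(1), rule assms(2))
qed

lemma smooth_has_deriv: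
  assumes "smooth f"
  shows "((\<lambda>t. wderiv w f (x + t *\<^sub>R axis i 1)) has_field_derivative wderiv (i # w) f x) (at 0)"
  using assms unfolding smooth_def has_partial_def wderiv_Cons partial_def
  by (simp add: field_differentiable_derivI)

lemma smooth_has_deriv_at:
  assumes "smooth f"
  shows "((\<lambda>t. wderiv w f (x + t *\<^sub>R axis i 1)) has_field_derivative
            wderiv (i # w) f (x + s *\<^sub>R axis i 1)) (at s)"
proof -
  let ?F = "\<lambda>t. wderiv w f (x + t *\<^sub>R axis i 1)"
  have "(\<lambda>t. wderiv w f ((x + s *\<^sub>R axis i 1) + t *\<^sub>R axis i 1)) = (\<lambda>t. ?F (t + s))"
    by (simp add: scaleR_add_left add.commute add.left_commute)
  then have "((\<lambda>t. ?F (t + s)) has_field_derivative wderiv (i # w) f (x + s *\<^sub>R axis i 1)) (at 0)"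
    using smooth_has_deriv[OF assms, of w "x + s *\<^sub>R axis i 1" i] by metis
  then show ?thesis using DERIV_shift[of ?F _ 0 s] by simp
qed

lemma smooth_cont: "smooth f \<Longrightarrow> continuous_on UNIV (wderiv w f)"
  by (simp add: smooth_def)

lemma smooth_diff:
  assumes f: "smooth f" and g: "smooth g"
  shows "smooth (\<lambda>x. f x - g x)" "wderiv w (\<lambda>x. f x - g x) = (\<lambda>x. wderiv w f x - wderiv w g x)"
  using smooth_family[of "\<lambda>w x. wderiv w f x - wderiv w g x",
      OF continuous_on_diff[OF smooth_cont[OF f] smooth_cont[OF g]]
        DERIV_diff[OF smooth_has_deriv[OF f] smooth_has_deriv[OF g]]]
  by simp_all

lemma smooth_sum:
  assumes f: "\<And>k. k \<in> E \<Longrightarrow> smooth (f k)"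
  shows "smooth (\<lambda>x. \<Sum>k\<in>E. f k x)"
    "wderiv w (\<lambda>x. \<Sum>k\<in>E. f k x) = (\<lambda>x. \<Sum>k\<in>E. wderiv w (f k) x)"
  using smooth_family[of "\<lambda>w x. \<Sum>k\<in>E. wderiv w (f k) x",
      OF continuous_on_sum[OF smooth_cont[OF f]] DERIV_sum[OF smooth_has_deriv[OF f]]]
  by simp_all

subsection \<open>Products\<close>

text \<open>The ways of distributing the letters of a word among two factors, over which Leibniz' rule sums.\<close>

fun splits :: "'a list \<Rightarrow> ('a list \<times> 'a list) list" where
  "splits [] = [([], [])]"
| "splits (i # w) = map (\<lambda>(u, v). (i # u, v)) (splits w) @ map (\<lambda>(u, v). (u, i # v)) (splits w)"

lemma length_splits: "length (splits w) = 2 ^ length w"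
  by (induction w) auto

lemma splits_length: "(u, v) \<in> set (splits w) \<Longrightarrow> length u + length v = length w"
proof (induction w arbitrary: u v)
  case (Cons i w)
  then consider u' where "u = i # u'" "(u', v) \<in> set (splits w)"
    | v' where "v = i # v'" "(u, v') \<in> set (splits w)" by auto
  then show ?case by cases (use Cons.IH in auto)
qed simp

lemma smooth_mult:
  assumes f: "smooth f" and g: "smooth g"
  shows "smooth (\<lambda>x. f x * g x)"
    and "wderiv w (\<lambda>x. f x * g x) = (\<lambda>x. \<Sum>(u, v)\<leftarrow>splits w. wderiv u f x * wderiv v g x)"
proof -
  let ?G = "\<lambda>w x. \<Sum>(u, v)\<leftarrow>splits w. wderiv u f x * wderiv v g x"
  have cont: "continuous_on UNIV (\<lambda>x. \<Sum>(u, v)\<leftarrow>ps. wderiv u f x * wderiv v g x)" for ps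
  proof (induction ps)
    case (Cons p ps)
    then show ?case
      by (cases p) (simp add: continuous_on_add continuous_on_mult smooth_cont f g)
  qed simp
  have der: "((\<lambda>t. \<Sum>(u, v)\<leftarrow>ps. wderiv u f (x + t *\<^sub>R axis i 1) * wderiv v g (x + t *\<^sub>R axis i 1))
     has_field_derivative
       (\<Sum>(u, v)\<leftarrow>map (\<lambda>(u, v). (i # u, v)) ps @ map (\<lambda>(u, v). (u, i # v)) ps.
          wderiv u f x * wderiv v g x)) (at 0)" for ps x i
  proof (induction ps)
    case (Cons p ps)
    obtain u v where p: "p = (u, v)" by fastforce
    show ?case
      using DERIV_add[OF DERIV_mult[OF smooth_has_deriv[OF f, of u x i] smooth_has_deriv[OF g, of v x i]] Cons]
      by (simp add: p algebra_simps)
  qed simp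
  have 1: "continuous_on UNIV (?G w)" for w by (rule cont)
  have 2: "((\<lambda>t. ?G w (x + t *\<^sub>R axis i 1)) has_field_derivative ?G (i # w) x) (at 0)" for w i x
    using der[where ps = "splits w" and x = x and i = i] by (simp only: splits.simps)
  have 3: "?G [] = (\<lambda>x. f x * g x)" by simp
  show "smooth (\<lambda>x. f x * g x)" "wderiv w (\<lambda>x. f x * g x) = ?G w"
    using smooth_family[of ?G, OF 1 2] unfolding 3 by simp_all
qed

subsection \<open>Locality\<close>

lemma wderiv_local:
  assumes "open U" "x \<in> U" "\<And>y. y \<in> U \<Longrightarrow> f y = g y"
  shows "wderiv w f x = wderiv w g x"
  using assms(2)
proof (induction w arbitrary: x)
  case (Cons i w)
  let ?h = "\<lambda>t. x + t *\<^sub>R axis i 1"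
  have "eventually (\<lambda>t. ?h t \<in> U) (at 0)"
  proof -
    have "(?h \<longlongrightarrow> ?h 0) (at 0)" by (intro tendsto_intros)
    then show ?thesis using topological_tendstoD[of ?h "?h 0" "at 0" U] assms(1) Cons.prems by simp
  qed
  then have "eventually (\<lambda>t. wderiv w f (?h t) = wderiv w g (?h t)) (nhds 0)"
    unfolding eventually_nhds_conv_at using Cons by (auto elim: eventually_mono)
  then show ?case
    unfolding wderiv_Cons partial_def by (rule deriv_cong_ev) simp
qed (use assms in simp)

lemma smooth_local:
  assumes "\<And>x. \<exists>U g. open U \<and> x \<in> U \<and> smooth g \<and> (\<forall>y\<in>U. f y = g y)"
  shows "smooth f"
proof -
  have "smooth (wderiv [] f)"
  proof -
    have 1: "continuous_on UNIV (wderiv w f)" for w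
    proof (rule continuous_at_imp_continuous_on, intro ballI)
      fix x
      obtain U g where U: "open U" "x \<in> U" "smooth g" "\<forall>y\<in>U. f y = g y"
        using assms[of x] by (elim exE conjE) simp
      have "isCont (wderiv w g) x"
        using smooth_cont[OF U(3)] by (simp add: continuous_on_eq_continuous_at)
      moreover have "eventually (\<lambda>y. wderiv w f y = wderiv w g y) (nhds x)"
        unfolding eventually_nhds using U wderiv_local[of U _ f g w] by blast
      ultimately show "isCont (wderiv w f) x" using isCont_cong by metis
    qed
    have 2: "((\<lambda>t. wderiv w f (x + t *\<^sub>R axis i 1)) has_field_derivative wderiv (i # w) f x) (at 0)" for w i x
    proof -
      obtain U g where U: "open U" "x \<in> U" "smooth g" "\<forall>y\<in>U. f y = g y"
        using assms[of x] by (elim exE conjE) simp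
      let ?h = "\<lambda>t. x + t *\<^sub>R axis i 1"
      have loc: "wderiv w f y = wderiv w g y" if "y \<in> U" for w y
        using wderiv_local[OF U(1) that] U(4) by blast
      have "eventually (\<lambda>t. ?h t \<in> U) (nhds 0)"
      proof -
        have "(?h \<longlongrightarrow> ?h 0) (nhds 0)" by (intro tendsto_intros filterlim_ident)
        then show ?thesis using topological_tendstoD[of ?h "?h 0" "nhds 0" U] U by simp
      qed
      then have "eventually (\<lambda>t. wderiv w f (?h t) = wderiv w g (?h t)) (nhds 0)"
        by (rule eventually_mono) (rule loc)
      from DERIV_cong_ev[OF refl this refl, of "wderiv (i # w) f x"] 
      show ?thesis using smooth_has_deriv[OF U(3), of w x i] loc[OF U(2), of "i # w"] by simp
    qed
    show ?thesis by (rule smooth_family(1)[where G = "\<lambda>w. wderiv w f"]) (rule 1, rule 2)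
  qed
  then show ?thesis by simp
qed

subsection \<open>Series\<close>

text \<open>Term-by-term differentiation along coordinate lines. Only a tail of the series has to be dominated,
  and where the tail starts may depend on the ball and on the word.\<close>

lemma smooth_series:
  fixes h :: "nat \<Rightarrow> real ^ 'n::finite \<Rightarrow> real"
  assumes h: "\<And>j. smooth (h j)"
    and bd: "\<And>R w. \<exists>b J. summable b \<and> (\<forall>j\<ge>J. \<forall>x\<in>cball 0 R. \<bar>wderiv w (h j) x\<bar> \<le> b j)"
  shows "smooth (\<lambda>x. \<Sum>j. h j x)" "wderiv w (\<lambda>x. \<Sum>j. h j x) = (\<lambda>x. \<Sum>j. wderiv w (h j) x)"
    "summable (\<lambda>j. wderiv w (h j) x)"
proof -
  let ?G = "\<lambda>w x. \<Sum>j. wderiv w (h j) x"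
  have unif: "uniformly_convergent_on (cball 0 R) (\<lambda>n x. \<Sum>j<n. wderiv w (h j) x)" for R w
  proof -
    obtain b J where b: "summable b" "\<forall>j\<ge>J. \<forall>x\<in>cball 0 R. \<bar>wderiv w (h j) x\<bar> \<le> b j"
      using bd[where R = R and w = w] by (elim exE conjE) simp
    have "eventually (\<lambda>j. \<forall>x\<in>cball 0 R. norm (wderiv w (h j) x) \<le> b j) sequentially"
      unfolding eventually_sequentially using b(2) by auto
    then show ?thesis using b(1) by (rule Weierstrass_m_test'_ev)
  qed
  have sm: "summable (\<lambda>j. wderiv w (h j) x)" for w x
    using uniformly_convergent_imp_convergent[OF unif[of "norm x" w], of x]
    by (simp add: summable_iff_convergent)
  then show "summable (\<lambda>j. wderiv w (h j) x)" .
  have 1: "continuous_on UNIV (?G w)" for w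
  proof (rule continuous_at_imp_continuous_on, intro ballI)
    fix x :: "real ^ 'n"
    have ul: "uniform_limit (cball 0 (norm x + 1)) (\<lambda>n x. \<Sum>j<n. wderiv w (h j) x) (?G w) sequentially"
      using unif[of "norm x + 1" w] by (simp add: uniformly_convergent_uniform_limit_iff suminf_eq_lim)
    have "continuous_on (cball 0 (norm x + 1)) (?G w)"
      by (rule uniform_limit_theorem[OF _ ul])
        (auto intro!: always_eventually continuous_on_sum continuous_on_subset[OF smooth_cont[OF h]])
    moreover have "x \<in> interior (cball 0 (norm x + 1))" by simp
    ultimately show "isCont (?G w) x" using continuous_on_interior by blast
  qed
  have 2: "((\<lambda>t. ?G w (x + t *\<^sub>R axis i 1)) has_field_derivative ?G (i # w) x) (at 0)" for w i x
  proof -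
    let ?l = "\<lambda>t. x + t *\<^sub>R axis i 1 :: real ^ 'n"
    have lin: "?l t \<in> cball 0 (norm x + 1)" if "t \<in> cball 0 1" for t
    proof -
      have "norm (?l t) \<le> norm x + \<bar>t\<bar>" using norm_triangle_ineq[of x "t *\<^sub>R axis i 1"] by simp
      also have "\<dots> \<le> norm x + 1" using that by simp
      finally show ?thesis by simp
    qed
    have u: "uniformly_convergent_on (cball 0 1) (\<lambda>n t. \<Sum>j<n. wderiv (i # w) (h j) (?l t))"
    proof -
      obtain l where "uniform_limit (cball 0 (norm x + 1)) (\<lambda>n x. \<Sum>j<n. wderiv (i # w) (h j) x) l sequentially"
        using unif[of "norm x + 1" "i # w"] unfolding uniformly_convergent_on_def by blast
      moreover have "?l \<in> cball 0 1 \<rightarrow> cball 0 (norm x + 1)" using lin by auto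
      ultimately show ?thesis
        unfolding uniformly_convergent_on_def by (intro exI) (rule uniform_limit_compose')
    qed
    have d: "((\<lambda>t. wderiv w (h j) (?l t)) has_field_derivative wderiv (i # w) (h j) (?l t)) (at t within cball 0 1)" for j t
      by (rule has_field_derivative_at_within[OF smooth_has_deriv_at[OF h]])
    have "((\<lambda>t. \<Sum>j. wderiv w (h j) (?l t)) has_field_derivative (\<Sum>j. wderiv (i # w) (h j) (?l 0))) (at 0)"
      by (rule has_field_derivative_series'(2)[of "cball 0 1" _ _ 0 0, OF _ d u]) (auto intro: sm)
    then show ?thesis by simp
  qed
  have 3: "?G [] = (\<lambda>x. \<Sum>j. h j x)" by simp
  show "smooth (\<lambda>x. \<Sum>j. h j x)" "wderiv w (\<lambda>x. \<Sum>j. h j x) = ?G w"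
    using smooth_family[of ?G, OF 1 2] unfolding 3 by simp_all
qed

section \<open>Weights\<close>

text \<open>This is \<open>exp(m \<phi>\<^sup>*(k / m))\<close> for the Young conjugate \<open>\<phi>\<^sup>*\<close> of \<open>\<kappa>\<close>, written in the frequency \<open>s\<close>
  instead of \<open>ln s\<close>.\<close>

definition wt :: "(real \<Rightarrow> real) \<Rightarrow> real \<Rightarrow> nat \<Rightarrow> real" where
  "wt \<kappa> m k = (SUP s\<in>{1..}. s ^ k * exp (- (m * \<kappa> s)))"

lemma powr_sublinear:
  fixes c p a :: real
  assumes c: "c > 0" and p: "p < 1"
  shows "\<exists>S\<ge>1. \<forall>s\<ge>S. a * s powr p \<le> c * s"
proof -
  define S where "S = max 1 ((\<bar>a\<bar> / c) powr (1 / (1 - p)))"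
  have "a * s powr p \<le> c * s" if "s \<ge> S" for s
  proof -
    have s: "s \<ge> 1" using that by (simp add: S_def)
    have "\<bar>a\<bar> / c = ((\<bar>a\<bar> / c) powr (1 / (1 - p))) powr (1 - p)"
      using p c by (subst powr_powr) simp
    also have "\<dots> \<le> s powr (1 - p)"
      using that p by (intro powr_mono2) (auto simp: S_def)
    finally have "a * s powr p \<le> (c * s powr (1 - p)) * s powr p"
      using c by (intro mult_right_mono) (simp_all add: field_simps)
    also have "\<dots> = c * s" using s by (simp add: powr_add[symmetric])
    finally show ?thesis .
  qed
  moreover have "S \<ge> 1" by (simp add: S_def)
  ultimately show ?thesis by blast
qed

text \<open>The essential assumption is the power growth with exponent \<open>r < 1\<close>. It makes \<open>\<kappa>\<close> sublinear and it
  leaves room for Gevrey functions of an order between \<open>1\<close> and \<open>1 / r\<close>.\<close>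

locale growth_weight =
  fixes \<kappa> :: "real \<Rightarrow> real" and r :: real
  assumes r_pos: "0 < r" and r_less: "r < 1"
    and nonneg: "\<And>s. 0 < s \<Longrightarrow> 0 \<le> \<kappa> s"
    and mono: "\<And>s s'. 0 < s \<Longrightarrow> s \<le> s' \<Longrightarrow> \<kappa> s \<le> \<kappa> s'"
    and scale: "\<And>s l. 0 < s \<Longrightarrow> 1 \<le> l \<Longrightarrow> \<kappa> (l * s) \<le> l powr r * \<kappa> s"
    and convex_exp: "convex_on UNIV (\<lambda>x. \<kappa> (exp x))"
    and above_ln: "\<And>D. \<exists>S\<ge>1. \<forall>s\<ge>S. D * ln s \<le> \<kappa> s"
begin

abbreviation "W \<equiv> wt \<kappa>"

lemma scale_linear:
  assumes "0 < s" "1 \<le> l"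
  shows "\<kappa> (l * s) \<le> l * \<kappa> s"
proof -
  have "l powr r \<le> l powr 1" using assms r_less by (intro powr_mono) auto
  then have "l powr r * \<kappa> s \<le> l * \<kappa> s" using assms nonneg by (intro mult_right_mono) auto
  then show ?thesis using scale[OF assms] by linarith
qed

lemma ratio_antimono:
  assumes "0 < s" "s \<le> t"
  shows "s * \<kappa> t \<le> t * \<kappa> s"
proof -
  have "\<kappa> ((t / s) * s) \<le> (t / s) * \<kappa> s" using assms by (intro scale_linear) auto
  then show ?thesis using assms by (simp add: field_simps)
qed

lemma pow_le_exp:
  assumes "real k * ln s \<le> x" "0 < s"
  shows "s ^ k \<le> exp x"
proof -
  have "s ^ k = exp (real k * ln s)" using assms by (simp add: exp_of_nat_mult)
  then show ?thesis using assms by simp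
qed

lemma W_bdd:
  assumes "m > 0"
  shows "bdd_above ((\<lambda>s. s ^ k * exp (- (m * \<kappa> s))) ` {1..})"
proof -
  obtain S where S: "S \<ge> 1" "\<And>s. s \<ge> S \<Longrightarrow> real k / m * ln s \<le> \<kappa> s" using above_ln by blast
  have "s ^ k * exp (- (m * \<kappa> s)) \<le> S ^ k" if "s \<ge> 1" for s
  proof (cases "s \<ge> S")
    case True
    have "real k * ln s \<le> m * \<kappa> s" using S(2)[OF True] assms by (simp add: field_simps)
    then have "s ^ k \<le> exp (m * \<kappa> s)" using that by (intro pow_le_exp) auto
    then have "s ^ k * exp (- (m * \<kappa> s)) \<le> 1" by (simp add: exp_minus field_simps)
    also have "1 \<le> S ^ k" using S by simp
    finally show ?thesis .
  next
    case False
    have "exp (- (m * \<kappa> s)) \<le> 1" using nonneg[of s] that assms by simp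
    then have "s ^ k * exp (- (m * \<kappa> s)) \<le> s ^ k * 1" using that by (intro mult_left_mono) auto
    also have "\<dots> \<le> S ^ k" using False that by (simp add: power_mono)
    finally show ?thesis .
  qed
  then show ?thesis by (intro bdd_aboveI2) auto
qed

lemma W_ge: "m > 0 \<Longrightarrow> s \<ge> 1 \<Longrightarrow> s ^ k * exp (- (m * \<kappa> s)) \<le> W m k"
  unfolding wt_def by (intro cSUP_upper W_bdd) auto

lemma W_least: "(\<And>s. s \<ge> 1 \<Longrightarrow> s ^ k * exp (- (m * \<kappa> s)) \<le> B) \<Longrightarrow> W m k \<le> B"
  unfolding wt_def by (intro cSUP_least) auto

lemma W_pos: "m > 0 \<Longrightarrow> W m k > 0"
  using W_ge[of m 1 k] less_le_trans[of 0 "1 ^ k * exp (- (m * \<kappa> 1))"] by simp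

lemma W_antimono:
  assumes "0 < m" "m \<le> m'"
  shows "W m' k \<le> W m k"
proof (rule W_least)
  fix s :: real assume s: "s \<ge> 1"
  have "m * \<kappa> s \<le> m' * \<kappa> s" using assms nonneg[of s] s by (intro mult_right_mono) auto
  then have "s ^ k * exp (- (m' * \<kappa> s)) \<le> s ^ k * exp (- (m * \<kappa> s))"
    using s by (intro mult_left_mono) auto
  then show "s ^ k * exp (- (m' * \<kappa> s)) \<le> W m k" using W_ge[OF assms(1) s, of k] by linarith
qed

text \<open>Of two frequencies the larger one serves for both factors, because \<open>\<kappa>\<close> is nonnegative.\<close>

lemma W_mult:
  assumes "m > 0"
  shows "W m j * W m k \<le> W m (j + k)"
proof -
  have le: "(s ^ j * exp (- (m * \<kappa> s))) * (t ^ k * exp (- (m * \<kappa> t))) \<le> W m (j + k)"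
    if st: "s \<ge> 1" "t \<ge> 1" for s t
  proof -
    define u where "u = max s t"
    have u: "u \<ge> 1" "s \<le> u" "t \<le> u" using st by (auto simp: u_def)
    have "s ^ j * t ^ k \<le> u ^ j * u ^ k" using u st by (intro mult_mono power_mono) auto
    moreover have "exp (- (m * \<kappa> s)) * exp (- (m * \<kappa> t)) \<le> exp (- (m * \<kappa> u))"
    proof -
      have "0 \<le> m * \<kappa> s" "0 \<le> m * \<kappa> t" using st nonneg assms by auto
      moreover have "u = s \<or> u = t" by (auto simp: u_def)
      ultimately show ?thesis by (auto simp flip: exp_add)
    qed
    ultimately have "(s ^ j * t ^ k) * (exp (- (m * \<kappa> s)) * exp (- (m * \<kappa> t))) \<le> (u ^ j * u ^ k) * exp (- (m * \<kappa> u))"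
      using u st by (intro mult_mono[of "s ^ j * t ^ k"]) simp_all
    also have "\<dots> \<le> W m (j + k)" using W_ge[OF assms u(1), of "j + k"] by (simp add: power_add)
    finally show ?thesis by (simp add: mult_ac)
  qed
  have "W m k \<le> W m (j + k) / W m j"
  proof (rule W_least)
    fix t :: real assume t: "t \<ge> 1"
    define b where "b = t ^ k * exp (- (m * \<kappa> t))"
    have b: "b > 0" using t by (simp add: b_def)
    have "W m j \<le> W m (j + k) / b"
    proof (rule W_least)
      fix s :: real assume "s \<ge> 1"
      from le[OF this t] b show "s ^ j * exp (- (m * \<kappa> s)) \<le> W m (j + k) / b"
        by (simp add: b_def[symmetric] field_simps)
    qed
    then show "t ^ k * exp (- (m * \<kappa> t)) \<le> W m (j + k) / W m j"
      using b W_pos[OF assms, of j] by (simp add: b_def[symmetric] field_simps)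
  qed
  then show ?thesis using W_pos[OF assms, of j] by (simp add: field_simps)
qed

text \<open>The factor \<open>2\<^sup>k\<close> from Leibniz' rule is absorbed by halving \<open>m\<close>, since \<open>\<kappa>(2 s) \<le> 2 \<kappa>(s)\<close>. This loss
  is harmless for classes defined by all \<open>m\<close>.\<close>

lemma W_double:
  assumes "m > 0"
  shows "2 ^ k * W m k \<le> W (m / 2) k"
proof -
  have "W m k \<le> W (m / 2) k / 2 ^ k"
  proof (rule W_least)
    fix s :: real assume s: "s \<ge> 1"
    have "\<kappa> (2 * s) \<le> 2 * \<kappa> s" using s by (intro scale_linear) auto
    then have "m / 2 * \<kappa> (2 * s) \<le> m / 2 * (2 * \<kappa> s)" using assms by (intro mult_left_mono) auto
    then have "(2 * s) ^ k * exp (- (m * \<kappa> s)) \<le> (2 * s) ^ k * exp (- (m / 2 * \<kappa> (2 * s)))"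
      using s by (intro mult_left_mono) auto
    also have "\<dots> \<le> W (m / 2) k" using s assms by (intro W_ge) auto
    finally show "s ^ k * exp (- (m * \<kappa> s)) \<le> W (m / 2) k / 2 ^ k"
      by (simp add: power_mult_distrib field_simps)
  qed
  then show ?thesis by (simp add: field_simps)
qed

subsection \<open>Touching lines\<close>

text \<open>The graph of \<open>\<kappa>\<close> lies below a line of slope \<open>c\<close> and meets it at \<open>t\<close>; equivalently, \<open>t\<close>
  maximises \<open>\<kappa>(s) - c s\<close>.\<close>

definition touch :: "real \<Rightarrow> real \<Rightarrow> bool" where
  "touch c t \<longleftrightarrow> t > 0 \<and> (\<forall>s>0. \<kappa> s \<le> \<kappa> t + c * (s - t))"

lemma continuous: "continuous_on {0<..} \<kappa>"
proof -
  have "continuous_on UNIV (\<lambda>x. \<kappa> (exp x))"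
    using convex_exp by (intro convex_on_continuous) auto
  then have "continuous_on {0<..} (\<lambda>s. \<kappa> (exp (ln s)))"
    by (intro continuous_on_compose2[of UNIV "\<lambda>x. \<kappa> (exp x)" "{0<..}" ln]) (auto intro!: continuous_intros)
  then show ?thesis by (simp cong: continuous_on_cong_simp)
qed

lemma unbounded: "\<exists>Y>X. \<kappa> Y > B"
proof -
  obtain S where S: "S \<ge> 1" "\<And>s. s \<ge> S \<Longrightarrow> (\<bar>B\<bar> + 1) * ln s \<le> \<kappa> s" using above_ln by blast
  define Y where "Y = max (\<bar>X\<bar> + 1) (max S (exp 1))"
  have "ln Y \<ge> ln (exp 1)" unfolding Y_def by (intro ln_mono) auto
  then have "(\<bar>B\<bar> + 1) * 1 \<le> (\<bar>B\<bar> + 1) * ln Y" by (intro mult_left_mono) auto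
  moreover have "(\<bar>B\<bar> + 1) * ln Y \<le> \<kappa> Y" by (intro S(2)) (simp add: Y_def)
  ultimately have "\<kappa> Y > B" by simp
  moreover have "Y > X" by (auto simp: Y_def)
  ultimately show ?thesis by blast
qed

lemma sublinear:
  assumes "c > 0"
  shows "\<exists>S\<ge>1. \<forall>s\<ge>S. \<kappa> s \<le> c * s"
proof -
  obtain S where S: "S \<ge> 1" "\<And>s. s \<ge> S \<Longrightarrow> \<kappa> 1 * s powr r \<le> c * s"
    using powr_sublinear[OF assms r_less] by blast
  have "\<kappa> s \<le> c * s" if "s \<ge> S" for s
    using scale[of 1 s] S(2)[OF that] S(1) that by (simp add: mult.commute)
  then show ?thesis using S(1) by blast
qed

text \<open>For small \<open>c\<close> the function \<open>\<kappa>(s) - c s\<close> exceeds \<open>\<kappa>(X)\<close> somewhere beyond \<open>X\<close>, and it is negative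
  for large \<open>s\<close>. Hence it attains its maximum, and only beyond \<open>X\<close>.\<close>

lemma touch_exists:
  assumes X: "X > 0"
  shows "\<exists>c0>0. \<forall>c. 0 < c \<and> c \<le> c0 \<longrightarrow> (\<exists>t. touch c t) \<and> (\<forall>t. touch c t \<longrightarrow> t > X)"
proof -
  obtain Y where Y: "Y > X" "\<kappa> Y > \<kappa> X" using unbounded by blast
  define c0 where "c0 = (\<kappa> Y - \<kappa> X) / (2 * Y)"
  have c0: "c0 > 0" using Y X by (simp add: c0_def)
  have "(\<exists>t. touch c t) \<and> (\<forall>t. touch c t \<longrightarrow> t > X)" if c: "0 < c" "c \<le> c0" for c
  proof
    have "c * Y \<le> c0 * Y" using c X Y by (intro mult_right_mono) auto
    also have "c0 * Y < \<kappa> Y - \<kappa> X" using X Y by (simp add: c0_def)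
    finally have Yc: "\<kappa> X < \<kappa> Y - c * Y" by simp
    obtain S where S: "S \<ge> 1" "\<And>s. s \<ge> S \<Longrightarrow> \<kappa> s \<le> c * s" using sublinear[OF c(1)] by blast
    define S' where "S' = max Y S"
    have "\<exists>t\<in>{X..S'}. \<forall>s\<in>{X..S'}. \<kappa> s - c * s \<le> \<kappa> t - c * t"
      using X Y by (intro continuous_attains_sup)
        (auto simp: S'_def intro!: continuous_intros continuous_on_subset[OF continuous])
    then obtain t where t: "t \<in> {X..S'}" "\<And>s. s \<in> {X..S'} \<Longrightarrow> \<kappa> s - c * s \<le> \<kappa> t - c * t" by blast
    have tY: "\<kappa> X < \<kappa> t - c * t" using t(2)[of Y] Yc Y by (simp add: S'_def)
    have "\<kappa> s - c * s \<le> \<kappa> t - c * t" if s: "s > 0" for s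
    proof -
      consider "s < X" | "s \<in> {X..S'}" | "s > S'" by fastforce
      then show ?thesis
      proof cases
        case 1
        then show ?thesis using mono[OF s, of X] tY c s mult_pos_pos[of c s] by linarith
      next
        case 2 then show ?thesis by (rule t(2))
      next
        case 3
        then have "\<kappa> s \<le> c * s" by (intro S(2)) (simp add: S'_def)
        then show ?thesis using tY nonneg[OF X] by linarith
      qed
    qed
    then show "\<exists>t. touch c t" unfolding touch_def using t(1) X
      by (intro exI[of _ t]) (auto simp: algebra_simps)
    show "\<forall>t. touch c t \<longrightarrow> t > X"
    proof (intro allI impI)
      fix t assume "touch c t"
      then have t: "t > 0" "\<kappa> Y \<le> \<kappa> t + c * (Y - t)" using X Y by (auto simp: touch_def)
      then have "\<kappa> X < \<kappa> t" using Yc mult_pos_pos[OF c(1) t(1)] by (simp add: algebra_simps)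
      then show "t > X" using mono[of t X] t by force
    qed
  qed
  then show ?thesis using c0 by blast
qed

text \<open>Let \<open>s\<close> tend to \<open>0\<close> in the definition.\<close>

lemma touch_le:
  assumes "touch c t" "c > 0"
  shows "c * t \<le> \<kappa> t"
proof (rule field_le_epsilon)
  fix e :: real assume "e > 0"
  then have "0 < e / c" using assms by simp
  then have "\<kappa> (e / c) \<le> \<kappa> t + c * (e / c - t)" "0 \<le> \<kappa> (e / c)"
    using assms nonneg by (auto simp: touch_def)
  then show "c * t \<le> \<kappa> t + e" using assms by (simp add: right_diff_distrib)
qed

text \<open>In the variable \<open>ln s\<close> the convex function \<open>\<kappa> \<circ> exp\<close> lies below the smooth function given by the
  touching line and meets it at \<open>ln t\<close>. The derivative \<open>c t\<close> of the latter is therefore a subgradient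
  of the former. Thus \<open>t\<close> dominates the supremum in \<open>W m k\<close> when \<open>k\<close> is close to \<open>m c t\<close>.\<close>

lemma touch_ln:
  assumes tc: "touch c t" and s: "s > 0"
  shows "\<kappa> t + c * t * ln (s / t) \<le> \<kappa> s"
proof -
  have t: "t > 0" and I: "\<And>s. s > 0 \<Longrightarrow> \<kappa> s \<le> \<kappa> t + c * (s - t)" using tc by (auto simp: touch_def)
  define d where "d = ln (s / t)"
  have sd: "s = exp (ln t + d)" using s t by (simp add: d_def ln_div)
  have *: "\<kappa> t + c * t * ((1 - exp (- (h * d))) / h) \<le> \<kappa> s" if h: "h > 0" for h
  proof -
    \<comment> \<open>\<open>ln t\<close> is the convex combination of \<open>ln t - h d\<close> and \<open>ln t + d\<close> with weights \<open>u\<close> and \<open>h u\<close>; then let \<open>h\<close> tend to \<open>0\<close>.\<close>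
    define u where "u = 1 / (1 + h)"
    have u: "0 \<le> u" "u \<le> 1" "1 - u = h * u" "u > 0" using h by (auto simp: u_def field_simps)
    have comb: "u * (ln t - h * d) + (h * u) * (ln t + d) = ln t"
    proof -
      have "u * (ln t - h * d) + (h * u) * (ln t + d) = (u + h * u) * ln t" by (simp add: algebra_simps)
      also have "u + h * u = 1" using u(3) by simp
      finally show ?thesis by simp
    qed
    have "\<kappa> (exp (u *\<^sub>R (ln t - h * d) + (1 - u) *\<^sub>R (ln t + d)))
        \<le> u * \<kappa> (exp (ln t - h * d)) + (1 - u) * \<kappa> (exp (ln t + d))"
      using convex_onD[OF convex_exp, of "1 - u" "ln t - h * d" "ln t + d"] u(1,2) by simp
    then have 1: "\<kappa> t \<le> u * \<kappa> (exp (ln t - h * d)) + h * u * \<kappa> s"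
      using comb u(3) t sd by simp
    have et: "exp (ln t - h * d) = t * exp (- (h * d))" using t by (simp add: exp_diff exp_minus divide_inverse)
    have "\<kappa> (exp (ln t - h * d)) \<le> \<kappa> t + c * (t * exp (- (h * d)) - t)"
      unfolding et using t by (intro I) simp
    then have "u * \<kappa> (exp (ln t - h * d)) \<le> u * (\<kappa> t + c * (t * exp (- (h * d)) - t))"
      using u(1) by (intro mult_left_mono)
    with 1 have "\<kappa> t \<le> u * ((\<kappa> t + c * (t * exp (- (h * d)) - t)) + h * \<kappa> s)"
      by (simp add: algebra_simps)
    then have "\<kappa> t * (1 + h) \<le> (\<kappa> t + c * (t * exp (- (h * d)) - t)) + h * \<kappa> s"
      using h by (simp add: u_def field_simps)
    then have "h * \<kappa> t + c * t * (1 - exp (- (h * d))) \<le> h * \<kappa> s" by (simp add: algebra_simps)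
    then show ?thesis using h by (simp add: field_simps)
  qed
  have "((\<lambda>h. exp (- (h * d))) has_field_derivative (- d)) (at 0)"
    by (auto intro!: derivative_eq_intros)
  then have "((\<lambda>h. (exp (- (h * d)) - 1) / h) \<longlongrightarrow> - d) (at 0)" by (simp add: DERIV_def)
  then have "((\<lambda>h. \<kappa> t + c * t * (- ((exp (- (h * d)) - 1) / h))) \<longlongrightarrow> \<kappa> t + c * t * (- (- d))) (at 0)"
    by (intro tendsto_intros)
  then have lim: "((\<lambda>h. \<kappa> t + c * t * ((1 - exp (- (h * d))) / h)) \<longlongrightarrow> \<kappa> t + c * t * d) (at_right 0)"
    by (simp add: minus_divide_left filterlim_at_split)
  have "eventually (\<lambda>h::real. h > 0) (at_right 0)" by (simp add: eventually_at_right_less)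
  then have "eventually (\<lambda>h. \<kappa> t + c * t * ((1 - exp (- (h * d))) / h) \<le> \<kappa> s) (at_right 0)"
    by (rule eventually_mono) (rule *)
  from tendsto_upperbound[OF lim this] show ?thesis by (simp add: d_def)
qed

text \<open>A flatter line touches at a larger frequency, and there the subgradient \<open>c t\<close> of \<open>\<kappa> \<circ> exp\<close> is larger,
  too. This keeps the degrees of the Taylor polynomials monotone in the level.\<close>

lemma touch_mono:
  assumes "touch c t" "touch c' t'" "c < c'" "0 < c"
  shows "t' \<le> t" "c' * t' \<le> c * t"
proof -
  have t: "t > 0" "t' > 0" using assms by (auto simp: touch_def)
  have "\<kappa> t' \<le> \<kappa> t + c * (t' - t)" "\<kappa> t \<le> \<kappa> t' + c' * (t - t')" using assms t by (auto simp: touch_def)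
  then have "0 \<le> (c' - c) * (t - t')" by (simp add: algebra_simps)
  then show le: "t' \<le> t" using assms by (simp add: zero_le_mult_iff)
  \<comment> \<open>At a common touching point the subgradient of \<open>\<kappa> \<circ> exp\<close> would be both \<open>c t\<close> and \<open>c' t\<close>.\<close>
  have "t' \<noteq> t"
  proof
    assume eq: "t' = t"
    define e where "e = (c' - c) / (2 * c')"
    have e: "0 < e" "e \<le> 1" using assms by (auto simp: e_def field_simps)
    have s: "t * (1 + e) > 0" using t e by simp
    have "\<kappa> t + c' * t * ln (t * (1 + e) / t) \<le> \<kappa> (t * (1 + e))"
      using touch_ln[OF assms(2) s] eq by simp
    also have "\<dots> \<le> \<kappa> t + c * (t * (1 + e) - t)" using assms(1) s by (auto simp: touch_def)
    finally have "t * (c' * ln (1 + e)) \<le> t * (c * e)"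
      unfolding nonzero_mult_div_cancel_left[OF less_imp_neq[OF t(1), symmetric]]
      by (simp add: algebra_simps)
    then have "c' * ln (1 + e) \<le> c * e" using t by simp
    moreover have "c' * (e - e\<^sup>2) \<le> c' * ln (1 + e)"
      using ln_one_plus_pos_lower_bound[of e] e assms by (intro mult_left_mono) auto
    ultimately have "e * (c' * (1 - e)) \<le> e * c" by (simp add: power2_eq_square algebra_simps)
    then have "c' * (1 - e) \<le> c" using e by simp
    then show False using assms by (simp add: e_def field_simps)
  qed
  then have lt: "t' < t" using le by simp
  have "\<kappa> t + c * t * ln (t' / t) \<le> \<kappa> t'" "\<kappa> t' + c' * t' * ln (t / t') \<le> \<kappa> t"
    using touch_ln assms t by auto
  moreover have "ln (t' / t) = - ln (t / t')" using t by (simp add: ln_div)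
  ultimately have "c' * t' * ln (t / t') \<le> c * t * ln (t / t')" by simp
  moreover have "ln (t / t') > 0" using t lt by simp
  ultimately show "c' * t' \<le> c * t" by (simp add: mult_le_cancel_right_pos)
qed

end

section \<open>Smooth steps by repeated averaging\<close>

definition box_avg :: "real \<Rightarrow> (real \<Rightarrow> real) \<Rightarrow> real \<Rightarrow> real" where
  "box_avg a u x = integral {0..1} (\<lambda>v. u (x - a * v))"

definition diff_quot :: "real \<Rightarrow> (real \<Rightarrow> real) \<Rightarrow> real \<Rightarrow> real" where
  "diff_quot a u x = (u x - u (x - a)) / a"

lemma box_avg_integrable:
  fixes u :: "real \<Rightarrow> real"
  assumes "continuous_on UNIV u"
  shows "(\<lambda>v. u (x - a * v)) integrable_on {0..1::real}"
  by (intro integrable_continuous_real continuous_on_compose2[OF assms] continuous_intros) auto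

lemma box_avg_deriv:
  assumes u: "continuous_on UNIV u" and a: "a > 0"
  shows "(box_avg a u has_field_derivative diff_quot a u x) (at x)"
proof -
  have "\<exists>F. \<forall>x. - \<infinity> < ereal x \<longrightarrow> ereal x < \<infinity> \<longrightarrow> (F has_vector_derivative u x) (at x)"
    using u by (intro einterval_antiderivative) (auto simp: continuous_on_eq_continuous_at)
  then obtain U where U: "\<And>x. (U has_field_derivative u x) (at x)"
    by (auto simp: has_real_derivative_iff_has_vector_derivative)
  have "box_avg a u y = (U y - U (y - a)) / a" for y
  proof -
    have "((\<lambda>v. - U (y - a * v) / a) has_field_derivative u (y - a * v)) (at v)" for v
      using a by (auto intro!: derivative_eq_intros DERIV_chain2[OF U])
    then have "((\<lambda>v. u (y - a * v)) has_integral (- U (y - a * 1) / a - (- U (y - a * 0) / a))) {0..1}"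
      by (intro fundamental_theorem_of_calculus)
        (auto simp: has_real_derivative_iff_has_vector_derivative[symmetric] intro: has_field_derivative_at_within)
    then show ?thesis unfolding box_avg_def by (simp add: integral_unique diff_divide_distrib)
  qed
  then have "box_avg a u = (\<lambda>y. (U y - U (y - a)) / a)" by auto
  then show ?thesis
    using a by (auto intro!: derivative_eq_intros DERIV_chain2[OF U] simp: diff_quot_def diff_divide_distrib)
qed

text \<open>This class of profiles is preserved by averaging: a box of width \<open>a\<close> only adds \<open>a\<close> to the length \<open>s\<close>
  of the ramp. The Lipschitz constant survives in the limit of infinitely many averages and makes the
  limit continuous.\<close>

definition ramp :: "real \<Rightarrow> real \<Rightarrow> (real \<Rightarrow> real) \<Rightarrow> bool" where
  "ramp e s u \<longleftrightarrow> (\<forall>x. 0 \<le> u x \<and> u x \<le> 1) \<and> (\<forall>x y. x \<le> y \<longrightarrow> u x \<le> u y \<and> u y - u x \<le> (y - x) / e)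
     \<and> (\<forall>x\<le>0. u x = 0) \<and> (\<forall>x\<ge>s. u x = 1)"

lemma rampD:
  assumes "ramp e s u"
  shows "0 \<le> u x" "u x \<le> 1" "x \<le> y \<Longrightarrow> u x \<le> u y" "x \<le> y \<Longrightarrow> u y - u x \<le> (y - x) / e"
    "x \<le> 0 \<Longrightarrow> u x = 0" "s \<le> x \<Longrightarrow> u x = 1"
  using assms unfolding ramp_def by simp_all

lemma ramp_continuous:
  assumes "ramp e s u" "e > 0"
  shows "continuous_on UNIV u"
proof -
  have le: "\<bar>u y - u x\<bar> \<le> \<bar>y - x\<bar> / e" for x y
    using rampD(3,4)[OF assms(1), of x y] rampD(3,4)[OF assms(1), of y x]
    by (cases "x \<le> y") simp_all
  have "(1 / e)-lipschitz_on UNIV u"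
    using le assms by (intro lipschitz_onI) (auto simp: dist_real_def)
  then show ?thesis by (rule lipschitz_on_continuous_on)
qed

lemma ramp_box_avg:
  assumes u: "ramp e s u" and e: "e > 0" and a: "a > 0"
  shows "ramp e (s + a) (box_avg a u)"
proof -
  have c: "continuous_on UNIV u" using ramp_continuous[OF u e] .
  note int = box_avg_integrable[OF c]
  have 1: "0 \<le> box_avg a u x \<and> box_avg a u x \<le> 1" for x
    unfolding box_avg_def
    using integral_nonneg[OF int[of x a] rampD(1)[OF u]]
      integral_le[OF int[of x a] integrable_const_ivl[of 1] rampD(2)[OF u]] by simp
  have 2: "box_avg a u x \<le> box_avg a u y" if "x \<le> y" for x y
    unfolding box_avg_def by (intro integral_le int rampD(3)[OF u]) (use that in simp)
  have 3: "box_avg a u y - box_avg a u x \<le> (y - x) / e" if "x \<le> y" for x y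
  proof -
    have "box_avg a u y - box_avg a u x = integral {0..1} (\<lambda>v. u (y - a * v) - u (x - a * v))"
      unfolding box_avg_def by (rule integral_diff[symmetric]) (rule int)+
    also have "\<dots> \<le> integral {0..1} (\<lambda>v::real. (y - x) / e)"
    proof (intro integral_le integrable_diff int integrable_const_ivl)
      fix v :: real
      have "x - a * v \<le> y - a * v" using that by simp
      then have "u (y - a * v) - u (x - a * v) \<le> ((y - a * v) - (x - a * v)) / e"
        by (rule rampD(4)[OF u])
      then show "u (y - a * v) - u (x - a * v) \<le> (y - x) / e" by simp
    qed
    finally show ?thesis by simp
  qed
  have 4: "box_avg a u x = 0" if "x \<le> 0" for x
  proof -
    have "u (x - a * v) = 0" if "v \<in> {0..1}" for v
    proof -
      have "0 \<le> a * v" using a that by simp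
      then show ?thesis using \<open>x \<le> 0\<close> by (intro rampD(5)[OF u]) simp
    qed
    then have "box_avg a u x = integral {0..1} (\<lambda>v::real. 0::real)"
      unfolding box_avg_def by (rule integral_cong)
    then show ?thesis by simp
  qed
  have 5: "box_avg a u x = 1" if "x \<ge> s + a" for x
  proof -
    have "u (x - a * v) = 1" if "v \<in> {0..1}" for v
    proof -
      have "a * v \<le> a" using a that by (simp add: mult_left_le)
      then show ?thesis using \<open>x \<ge> s + a\<close> by (intro rampD(6)[OF u]) simp
    qed
    then have "box_avg a u x = integral {0..1} (\<lambda>v::real. 1::real)"
      unfolding box_avg_def by (rule integral_cong)
    then show ?thesis by simp
  qed
  show ?thesis unfolding ramp_def using 1 2 3 4 5 by blast
qed

fun box_iter :: "real \<Rightarrow> (nat \<Rightarrow> real) \<Rightarrow> nat \<Rightarrow> nat \<Rightarrow> real \<Rightarrow> real" where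
  "box_iter e a 0 k = (\<lambda>x. max 0 (min 1 (x / e)))"
| "box_iter e a (Suc n) k = box_avg (a k) (box_iter e a n (Suc k))"

lemma ramp_box_iter:
  assumes "e > 0" "\<And>i. a i > 0"
  shows "ramp e (e + (\<Sum>i<n. a (k + i))) (box_iter e a n k)"
proof (induction n arbitrary: k)
  case 0
  show ?case
  proof -
    have 1: "x / e \<le> y / e" "(y - x) / e = y / e - x / e" if "x \<le> y" for x y
      using that assms by (simp_all add: diff_divide_distrib divide_right_mono)
    have 2: "x / e \<le> 0" if "x \<le> 0" for x using that assms by (simp add: divide_le_0_iff)
    have 3: "1 \<le> x / e" if "x \<ge> e" for x using that assms by simp
    have 4: "max 0 (min 1 p) \<le> max 0 (min 1 q) \<and> max 0 (min 1 q) - max 0 (min 1 p) \<le> q - p"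
      if "p \<le> q" for p q :: real using that by (auto simp: max_def min_def)
    have 5: "p \<le> 0 \<Longrightarrow> max 0 (min 1 p) = 0" "1 \<le> p \<Longrightarrow> max 0 (min 1 p) = 1" for p :: real
      by (auto simp: max_def min_def)
    show ?thesis unfolding ramp_def
    proof (intro conjI allI impI)
      fix x y :: real assume "x \<le> y"
      then show "box_iter e a 0 k x \<le> box_iter e a 0 k y"
        "box_iter e a 0 k y - box_iter e a 0 k x \<le> (y - x) / e"
        using 1[of x y] 4[of "x / e" "y / e"] by simp_all
      show "box_iter e a 0 k x = 0" if "x \<le> 0" for x using 5(1)[OF 2[OF that]] by simp
      show "box_iter e a 0 k x = 1" if "e + (\<Sum>i<0. a (k + i)) \<le> x" for x
        using 5(2)[OF 3[of x]] that by simp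
    qed simp_all
  qed
next
  case (Suc n)
  have "(\<Sum>i<Suc n. a (k + i)) = a k + (\<Sum>i<n. a (Suc k + i))"
    by (subst sum.lessThan_Suc_shift) simp
  then show ?case using ramp_box_avg[OF Suc.IH[of "Suc k"] assms(1) assms(2)[of k]] by (simp add: add.commute add.left_commute)
qed

lemma box_avg_mono:
  assumes "continuous_on UNIV u" "continuous_on UNIV v" "\<And>x. u x \<le> v x"
  shows "box_avg a u x \<le> box_avg a v x"
  unfolding box_avg_def by (intro integral_le box_avg_integrable assms)

text \<open>The average of a nondecreasing function over \<open>[x - a, x]\<close> is at most its value at \<open>x\<close>. So the
  iterated averages decrease when a further box is inserted, and they converge.\<close>

lemma box_iter_antimono:
  assumes e: "e > 0" and a: "\<And>i. a i > 0"
  shows "box_iter e a (Suc n) k x \<le> box_iter e a n k x"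
proof (induction n arbitrary: k x)
  case 0
  have r: "ramp e e (box_iter e a 0 k)" for k using ramp_box_iter[OF assms, where n = 0 and k = k] by simp
  have "box_iter e a (Suc 0) k x \<le> integral {0..1} (\<lambda>v::real. box_iter e a 0 k x)"
    unfolding box_iter.simps(2) box_avg_def
  proof (intro integral_le box_avg_integrable[OF ramp_continuous[OF r e]] integrable_const_ivl)
    fix v :: real assume "v \<in> {0..1}"
    then have "x - a k * v \<le> x" using a[of k] by simp
    then have "box_iter e a 0 k (x - a k * v) \<le> box_iter e a 0 k x" by (rule rampD(3)[OF r])
    then show "box_iter e a 0 (Suc k) (x - a k * v) \<le> box_iter e a 0 k x" by simp
  qed
  then show ?case by simp
next
  case (Suc n)
  have c: "continuous_on UNIV (box_iter e a n k)" for n k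
    using ramp_continuous[OF ramp_box_iter[OF e a] e] .
  have "box_avg (a k) (box_iter e a (Suc n) (Suc k)) x \<le> box_avg (a k) (box_iter e a n (Suc k)) x"
    by (rule box_avg_mono[OF c c]) (rule Suc.IH)
  then show ?case by simp
qed

fun iter_quot :: "(nat \<Rightarrow> real) \<Rightarrow> nat \<Rightarrow> (real \<Rightarrow> real) \<Rightarrow> real \<Rightarrow> real" where
  "iter_quot a 0 u = u"
| "iter_quot a (Suc k) u = iter_quot a k (diff_quot (a k) u)"

lemma iter_quot_deriv:
  assumes "\<And>x. (u has_field_derivative u' x) (at x)"
  shows "(iter_quot a k u has_field_derivative iter_quot a k u' x) (at x)"
  using assms
proof (induction k arbitrary: u u' x)
  case (Suc k)
  have "(diff_quot (a k) u has_field_derivative diff_quot (a k) u' x) (at x)" for x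
  proof -
    have "((\<lambda>x. u (x - a k)) has_field_derivative u' (x - a k)) (at x)"
      using DERIV_shift[of u "u' (x - a k)" x "- a k"] Suc.prems by simp
    then show ?thesis
      unfolding diff_quot_def by (intro DERIV_cdivide DERIV_diff Suc.prems)
  qed
  from Suc.IH[OF this] show ?case by simp
qed simp

text \<open>Each difference quotient at most doubles the supremum and divides it by the width of its box.\<close>

lemma iter_quot_bound:
  assumes "\<And>x. \<bar>u x\<bar> \<le> B" "\<And>i. a i > 0"
  shows "\<bar>iter_quot a k u x\<bar> \<le> B * (\<Prod>i<k. 2 / a i)"
  using assms(1)
proof (induction k arbitrary: u B)
  case (Suc k)
  have "\<bar>diff_quot (a k) u x\<bar> \<le> B * (2 / a k)" for x
  proof -
    have "\<bar>u x - u (x - a k)\<bar> \<le> B * 2" using Suc.prems[of x] Suc.prems[of "x - a k"] by linarith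
    then show ?thesis unfolding diff_quot_def using assms(2)[of k] by (simp add: divide_right_mono)
  qed
  from Suc.IH[OF this] show ?case by (simp add: mult_ac)
qed simp

text \<open>Let \<open>S k\<close> be the limit of averaging over the boxes of widths \<open>a k, a (Suc k), \<dots>\<close>. Then \<open>S k\<close> is the
  average of \<open>S (Suc k)\<close> over the box \<open>a k\<close>, and its derivative is the difference quotient of
  \<open>S (Suc k)\<close> of the same width. So every differentiation uses up one box at the price \<open>2 / a k\<close>, and
  the function \<open>S 0\<close> is smooth.\<close>

lemma smooth_step:
  assumes e: "e > 0" and a: "\<And>i. a i > 0" and s: "\<And>n. (\<Sum>i<n. a i) \<le> s"
  obtains H :: "nat \<Rightarrow> real \<Rightarrow> real" where
    "\<And>k x. (H k has_field_derivative H (Suc k) x) (at x)"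
    "\<And>x. x \<le> 0 \<Longrightarrow> H 0 x = 0" "\<And>x. x \<ge> e + s \<Longrightarrow> H 0 x = 1"
    "\<And>k x. \<bar>H k x\<bar> \<le> (\<Prod>i<k. 2 / a i)"
proof -
  define S where "S k x = lim (\<lambda>n. box_iter e a n k x)" for k x
  note r = ramp_box_iter[of e a, OF e a]
  have lim: "(\<lambda>n. box_iter e a n k x) \<longlonglongrightarrow> S k x" for k x
  proof -
    have "decseq (\<lambda>n. box_iter e a n k x)"
      by (rule decseq_SucI) (rule box_iter_antimono[OF e a])
    moreover have "\<forall>n. 0 \<le> box_iter e a n k x" using rampD(1)[OF r] by blast
    ultimately obtain L where "(\<lambda>n. box_iter e a n k x) \<longlonglongrightarrow> L" using decseq_convergent by blast
    then show ?thesis unfolding S_def by (simp add: limI)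
  qed
  have S0: "0 \<le> S k x" for k x
    by (rule LIMSEQ_le_const[OF lim]) (use rampD(1)[OF r] in simp)
  have S1: "S k x \<le> 1" for k x
    by (rule LIMSEQ_le_const2[OF lim]) (use rampD(2)[OF r] in simp)
  have Sinc: "S k x \<le> S k y" if "x \<le> y" for k x y
    by (rule LIMSEQ_le[OF lim lim]) (use rampD(3)[OF r that] in simp)
  have Slip: "S k y - S k x \<le> (y - x) / e" if "x \<le> y" for k x y
    by (rule LIMSEQ_le_const2[OF tendsto_diff[OF lim lim]]) (use rampD(4)[OF r that] in simp)
  have Scont: "continuous_on UNIV (S k)" for k
  proof -
    have le: "\<bar>S k y - S k x\<bar> \<le> \<bar>y - x\<bar> / e" for x y
      using Sinc[of x y k] Sinc[of y x k] Slip[of x y k] Slip[of y x k]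
      by (cases "x \<le> y") simp_all
    have "(1 / e)-lipschitz_on UNIV (S k)"
      using le e by (intro lipschitz_onI) (auto simp: dist_real_def)
    then show ?thesis by (rule lipschitz_on_continuous_on)
  qed
  have rec: "S k = box_avg (a k) (S (Suc k))" for k
  proof
    fix x
    have "(\<lambda>n. integral {0..1} (\<lambda>v. box_iter e a n (Suc k) (x - a k * v)))
        \<longlonglongrightarrow> integral {0..1} (\<lambda>v. S (Suc k) (x - a k * v))"
    proof (rule dominated_convergence(2)[where h = "\<lambda>_. 1"])
      show "norm (box_iter e a n (Suc k) (x - a k * v)) \<le> 1" for n v
        using rampD(1,2)[OF r, of n "Suc k"] by simp
    qed (auto intro: box_avg_integrable ramp_continuous[OF r e] lim)
    then have "(\<lambda>n. box_iter e a (Suc n) k x) \<longlonglongrightarrow> box_avg (a k) (S (Suc k)) x"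
      by (simp add: box_avg_def)
    then show "S k x = box_avg (a k) (S (Suc k)) x"
      using LIMSEQ_Suc[OF lim[of k x]] LIMSEQ_unique by blast
  qed
  define H where "H k = iter_quot a k (S k)" for k
  show ?thesis
  proof
    show "(H k has_field_derivative H (Suc k) x) (at x)" for k x
    proof -
      have "(S k has_field_derivative diff_quot (a k) (S (Suc k)) x) (at x)" for x
        by (subst rec) (rule box_avg_deriv[OF Scont a])
      from iter_quot_deriv[OF this] show ?thesis by (simp add: H_def)
    qed
    show "H 0 x = 0" if "x \<le> 0" for x
    proof -
      have "box_iter e a n 0 x = 0" for n using rampD(5)[OF r that] .
      then show ?thesis using LIMSEQ_unique[OF lim[of 0 x]] by (simp add: H_def)
    qed
    show "H 0 x = 1" if "x \<ge> e + s" for x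
    proof -
      have "box_iter e a n 0 x = 1" for n
      proof -
        have "x \<ge> e + (\<Sum>i<n. a (0 + i))" using s[of n] that by simp
        then show ?thesis by (rule rampD(6)[OF r])
      qed
      then show ?thesis using LIMSEQ_unique[OF lim[of 0 x]] by (simp add: H_def)
    qed
    show "\<bar>H k x\<bar> \<le> (\<Prod>i<k. 2 / a i)" for k x
      using iter_quot_bound[of "S k" 1 a k x] S0[of k] S1[of k] a by (simp add: H_def)
  qed
qed

section \<open>Cut-off functions\<close>

lemma two_power_prod_le: "2 ^ j * (\<Prod>l<j. 1 + real l) \<le> (1 + real j) ^ j"
proof (induction j)
  case (Suc j)
  have "1 + real (Suc j) * (1 / (1 + real j)) \<le> (1 + 1 / (1 + real j)) ^ Suc j"
    by (rule Bernoulli_inequality) (simp add: field_simps)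
  then have "2 \<le> ((2 + real j) / (1 + real j)) ^ Suc j" by (simp add: field_simps)
  then have b: "2 * (1 + real j) ^ Suc j \<le> (2 + real j) ^ Suc j"
    by (simp add: power_divide field_simps del: power_Suc)
  have "2 ^ Suc j * (\<Prod>l<Suc j. 1 + real l) = 2 * (1 + real j) * (2 ^ j * (\<Prod>l<j. 1 + real l))"
    by simp
  also have "\<dots> \<le> 2 * (1 + real j) * (1 + real j) ^ j" using Suc by (intro mult_left_mono) auto
  also have "\<dots> = 2 * (1 + real j) ^ Suc j" by simp
  also have "\<dots> \<le> (2 + real j) ^ Suc j" by (rule b)
  also have "2 + real j = 1 + real (Suc j)" by simp
  finally show ?case .
qed simp

context growth_weight
begin

text \<open>Any exponent strictly between \<open>1\<close> and \<open>1 / r\<close> would do: exponents above \<open>1\<close> make the sum of the reciprocal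
  nodes converge, and exponents below \<open>1 / r\<close> make \<open>\<kappa>\<close> at the nodes sublinear in the index.\<close>

definition node_exp :: real where "node_exp = 2 / (1 + r)"

lemma node_exp: "1 < node_exp" "node_exp * r < 1" "0 \<le> node_exp * r"
  using r_pos r_less by (simp_all add: node_exp_def)

text \<open>The boxes will have widths \<open>2 / node \<tau> N i\<close>. The first \<open>N\<close> nodes equal \<open>\<tau>\<close>, afterwards they
  grow like a Gevrey sequence. They are constant on blocks of length \<open>N\<close>, which makes sums and products
  over whole blocks explicit.\<close>

definition node :: "real \<Rightarrow> nat \<Rightarrow> nat \<Rightarrow> real" where
  "node \<tau> N i = \<tau> * (1 + real (i div N)) powr node_exp"

lemma node_pos: "\<tau> > 0 \<Longrightarrow> node \<tau> N i > 0"
  by (simp add: node_def)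

text \<open>With \<open>j = k div N\<close> and \<open>s = node \<tau> N k\<close>, the \<open>l\<close>-th block contributes at most
  \<open>((1 + l) / (1 + j))\<^sup>N\<close> to the product of the quotients \<open>node \<tau> N i / s\<close>, and the product of
  \<open>(1 + l) / (1 + j)\<close> over \<open>l < j\<close> is at most \<open>2\<^sup>-\<^sup>j\<close>.\<close>

lemma prod_node_le:
  assumes \<tau>: "\<tau> > 0" and N: "N \<ge> 1"
  shows "(\<Prod>i<k. node \<tau> N i) \<le> (\<tau> * (1 + real (k div N)) powr node_exp) ^ k / 2 ^ (N * (k div N))"
proof -
  define j where "j = k div N"
  define s where "s = \<tau> * (1 + real j) powr node_exp"
  have s: "s > 0" using \<tau> by (simp add: s_def)
  have jk: "j * N \<le> k" by (simp add: j_def)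
  have f: "0 \<le> node \<tau> N i / s" "node \<tau> N i / s \<le> (1 + real (i div N)) / (1 + real j)" if "i < k" for i
  proof -
    have "i div N \<le> j" unfolding j_def using that by (intro div_le_mono) auto
    then have x: "0 \<le> (1 + real (i div N)) / (1 + real j)" "(1 + real (i div N)) / (1 + real j) \<le> 1" by auto
    have "node \<tau> N i / s = ((1 + real (i div N)) / (1 + real j)) powr node_exp"
      using \<tau> by (simp add: node_def s_def powr_divide)
    also have "\<dots> \<le> ((1 + real (i div N)) / (1 + real j)) powr 1"
      using x node_exp by (intro powr_mono') auto
    also have "\<dots> = (1 + real (i div N)) / (1 + real j)" using x by simp
    finally show "node \<tau> N i / s \<le> (1 + real (i div N)) / (1 + real j)" .
    show "0 \<le> node \<tau> N i / s" using s node_pos[OF \<tau>, of N i] by simp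
  qed
  have f1: "node \<tau> N i / s \<le> 1" if "i < k" for i
  proof -
    have "i div N \<le> j" unfolding j_def using that by (intro div_le_mono) auto
    then show ?thesis by (intro order_trans[OF f(2)[OF that]]) simp
  qed
  have "(\<Prod>i<k. node \<tau> N i / s) = (\<Prod>i<j * N. node \<tau> N i / s) * (\<Prod>i\<in>{j * N..<k}. node \<tau> N i / s)"
    using prod.atLeastLessThan_concat[of 0 "j * N" k "\<lambda>i. node \<tau> N i / s"] jk by (simp add: atLeast0LessThan)
  also have "\<dots> \<le> (\<Prod>i<j * N. node \<tau> N i / s) * 1"
    using jk f by (intro mult_left_mono prod_le_1 prod_nonneg) (auto intro: f1)
  also have "\<dots> \<le> (\<Prod>i<j * N. (1 + real (i div N)) / (1 + real j))"
    using jk f by (simp, intro prod_mono) auto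
  also have "\<dots> = (\<Prod>l<j. \<Prod>i\<in>{l * N..<l * N + N}. (1 + real (i div N)) / (1 + real j))"
    by (rule prod.nat_group[symmetric])
  also have "\<dots> = (\<Prod>l<j. ((1 + real l) / (1 + real j)) ^ N)"
  proof (rule prod.cong[OF refl])
    fix l
    have "i div N = l" if "i \<in> {l * N..<l * N + N}" for i
      using that N by (intro div_nat_eqI) (auto simp: mult.commute)
    then have "(\<Prod>i\<in>{l * N..<l * N + N}. (1 + real (i div N)) / (1 + real j))
        = (\<Prod>i\<in>{l * N..<l * N + N}. (1 + real l) / (1 + real j))"
      by (intro prod.cong) auto
    then show "(\<Prod>i\<in>{l * N..<l * N + N}. (1 + real (i div N)) / (1 + real j)) = ((1 + real l) / (1 + real j)) ^ N"
      by simp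
  qed
  also have "\<dots> = ((\<Prod>l<j. 1 + real l) / (1 + real j) ^ j) ^ N"
    by (simp add: prod_power_distrib[symmetric] prod_dividef)
  also have "\<dots> \<le> (1 / 2 ^ j) ^ N"
  proof (intro power_mono)
    show "(\<Prod>l<j. 1 + real l) / (1 + real j) ^ j \<le> 1 / 2 ^ j"
      using two_power_prod_le[of j] by (simp add: field_simps)
    show "0 \<le> (\<Prod>l<j. 1 + real l) / (1 + real j) ^ j" by (simp add: prod_nonneg)
  qed
  also have "(1 / 2 ^ j) ^ N = (1 / 2 ^ (N * j) :: real)" by (simp add: power_divide power_mult[symmetric] mult.commute)
  finally have "(\<Prod>i<k. node \<tau> N i) / s ^ k \<le> 1 / 2 ^ (N * j)" by (simp add: prod_dividef)
  then show ?thesis using s by (simp add: field_simps flip: j_def s_def)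
qed

text \<open>Use the frequency \<open>s = node \<tau> N k\<close> in the supremum \<open>W m k\<close>: what \<open>exp(- m \<kappa>(s))\<close> loses is
  compensated by the factor \<open>2\<^sup>-\<^sup>N\<^sup>j\<close> in the previous estimate.\<close>

lemma prod_node_W:
  assumes \<tau>: "\<tau> \<ge> 1" and N: "N \<ge> 1" and m: "m > 0"
    and b: "\<And>j. m * \<kappa> (\<tau> * (1 + real j) powr node_exp) \<le> real N * (1 + real j) / 2 + c"
  shows "(\<Prod>i<k. node \<tau> N i) \<le> 2 ^ N * exp c * W m k"
proof -
  define j where "j = k div N"
  define s where "s = \<tau> * (1 + real j) powr node_exp"
  have s: "s \<ge> 1"
  proof -
    have "1 * 1 \<le> \<tau> * (1 + real j) powr node_exp"
      using \<tau> node_exp by (intro mult_mono ge_one_powr_ge_zero) auto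
    then show ?thesis by (simp add: s_def)
  qed
  have "exp (m * \<kappa> s - c) \<le> exp (real (N * (1 + j)) * (1 / 2))"
    using b[of j] by (simp add: s_def algebra_simps add_divide_distrib)
  also have "\<dots> = exp (1 / 2) ^ (N * (1 + j))" by (rule exp_of_nat_mult)
  also have "\<dots> \<le> 2 ^ (N * (1 + j))"
  proof (intro power_mono)
    have "exp (1 / 2) \<le> exp (ln (2 :: real))" using ln2_ge_two_thirds by (subst exp_le_cancel_iff) simp
    then show "exp (1 / 2) \<le> (2 :: real)" by simp
  qed simp
  finally have "exp (- (2 * 0)) \<le> 2 ^ (N * (1 + j)) * exp (c - m * \<kappa> s)"
    by (simp add: exp_diff field_simps)
  then have "1 \<le> 2 ^ N * 2 ^ (N * j) * (exp c * exp (- (m * \<kappa> s)))"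
    by (simp add: exp_diff exp_minus power_add divide_inverse)
  then have "s ^ k * 1 \<le> s ^ k * (2 ^ N * 2 ^ (N * j) * (exp c * exp (- (m * \<kappa> s))))"
    using s by (intro mult_left_mono) auto
  then have "s ^ k / 2 ^ (N * j) \<le> 2 ^ N * exp c * (s ^ k * exp (- (m * \<kappa> s)))"
    by (simp add: field_simps)
  also have "\<dots> \<le> 2 ^ N * exp c * W m k" using W_ge[OF m s] by (intro mult_left_mono) auto
  finally show ?thesis using prod_node_le[of \<tau> N k] \<tau> N by (simp add: s_def j_def)
qed

lemma \<kappa>_node: "\<tau> \<ge> 1 \<Longrightarrow> \<kappa> (\<tau> * (1 + real j) powr node_exp) \<le> (1 + real j) powr (node_exp * r) * \<kappa> \<tau>"
  using scale[of \<tau> "(1 + real j) powr node_exp"] node_exp by (simp add: powr_powr mult.commute ge_one_powr_ge_zero)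

text \<open>The quantitative bound: the cost of a bump is \<open>2\<^sup>N\<close>, where \<open>N\<close> is proportional to \<open>m \<kappa>(\<tau>)\<close>.\<close>

lemma prod_node_large:
  assumes \<tau>: "\<tau> \<ge> 1" and N: "N \<ge> 1" and m: "m > 0" and le: "2 * m * \<kappa> \<tau> \<le> real N"
  shows "(\<Prod>i<k. node \<tau> N i) \<le> 2 ^ N * W m k"
proof -
  have "m * \<kappa> (\<tau> * (1 + real j) powr node_exp) \<le> real N * (1 + real j) / 2 + 0" for j
  proof -
    have "(1 + real j) powr (node_exp * r) \<le> (1 + real j) powr 1" using node_exp by (intro powr_mono) auto
    then have "(1 + real j) powr (node_exp * r) * \<kappa> \<tau> \<le> (1 + real j) * \<kappa> \<tau>"
      using nonneg[of \<tau>] \<tau> by (intro mult_right_mono) auto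
    then have "\<kappa> (\<tau> * (1 + real j) powr node_exp) \<le> (1 + real j) * \<kappa> \<tau>"
      using \<kappa>_node[OF \<tau>, of j] by linarith
    then have "m * \<kappa> (\<tau> * (1 + real j) powr node_exp) \<le> m * ((1 + real j) * \<kappa> \<tau>)"
      using m by (intro mult_left_mono) auto
    also have "\<dots> = (1 + real j) * (2 * m * \<kappa> \<tau>) / 2" by simp
    also have "\<dots> \<le> (1 + real j) * real N / 2" using le by (intro divide_right_mono mult_left_mono) auto
    finally show ?thesis by (simp add: mult.commute)
  qed
  from prod_node_W[OF \<tau> N m this] show ?thesis by simp
qed

text \<open>The qualitative bound, for all \<open>m\<close>: along the nodes \<open>\<kappa>\<close> grows like a power of \<open>j\<close> with exponent
  less than \<open>1\<close>.\<close>

lemma prod_node_any: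
  assumes \<tau>: "\<tau> \<ge> 1" and N: "N \<ge> 1" and m: "m > 0"
  shows "\<exists>C. \<forall>k. (\<Prod>i<k. node \<tau> N i) \<le> C * W m k"
proof -
  obtain S where S: "S \<ge> 1" "\<And>s. s \<ge> S \<Longrightarrow> (m * \<kappa> \<tau>) * s powr (node_exp * r) \<le> real N / 2 * s"
    using powr_sublinear[of "real N / 2" "node_exp * r" "m * \<kappa> \<tau>"] N node_exp by auto
  define c where "c = (m * \<kappa> \<tau>) * S powr (node_exp * r)"
  have m\<kappa>: "m * \<kappa> \<tau> \<ge> 0" using m \<tau> nonneg[of \<tau>] by simp
  have "m * \<kappa> (\<tau> * (1 + real j) powr node_exp) \<le> real N * (1 + real j) / 2 + c" for j
  proof -
    have "m * \<kappa> (\<tau> * (1 + real j) powr node_exp) \<le> m * ((1 + real j) powr (node_exp * r) * \<kappa> \<tau>)"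
      using m \<kappa>_node[OF \<tau>, of j] by (intro mult_left_mono) auto
    also have "\<dots> = (m * \<kappa> \<tau>) * (1 + real j) powr (node_exp * r)" by simp
    also have "\<dots> \<le> real N / 2 * (1 + real j) + c"
    proof (cases "1 + real j \<ge> S")
      case True
      have "0 \<le> c" using m\<kappa> by (simp add: c_def)
      then show ?thesis using S(2)[OF True] by linarith
    next
      case False
      have "(m * \<kappa> \<tau>) * (1 + real j) powr (node_exp * r) \<le> c"
        unfolding c_def using m\<kappa> node_exp False by (intro mult_left_mono powr_mono2) auto
      moreover have "0 \<le> real N / 2 * (1 + real j)" by simp
      ultimately show ?thesis by linarith
    qed
    finally show ?thesis by simp
  qed
  from prod_node_W[OF \<tau> N m this] show ?thesis by blast
qed

definition node_sum :: real where "node_sum = 4 * (\<Sum>l. (1 + real l) powr - node_exp)"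

lemma summable_nodes: "summable (\<lambda>l. (1 + real l) powr - node_exp)"
proof -
  have "summable (\<lambda>n. real (Suc n) powr - node_exp)"
    using node_exp by (subst summable_Suc_iff) (simp add: summable_real_powr_iff)
  then show ?thesis by (simp add: add.commute)
qed

lemma node_sum_ge: "node_sum \<ge> 1"
proof -
  have "(\<Sum>l<1. (1 + real l) powr - node_exp) \<le> (\<Sum>l. (1 + real l) powr - node_exp)"
    by (rule sum_le_suminf[OF summable_nodes]) auto
  then show ?thesis by (simp add: node_sum_def)
qed

lemma sum_node_le:
  assumes \<tau>: "\<tau> > 0" and N: "N \<ge> 1"
  shows "(\<Sum>i<n. 2 / node \<tau> N i) \<le> real N * node_sum / (2 * \<tau>)"
proof -
  have "(\<Sum>i<n. 2 / node \<tau> N i) \<le> (\<Sum>i<n * N. 2 / node \<tau> N i)"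
    using N node_pos[OF \<tau>] by (intro sum_mono2) (auto intro: less_imp_le less_le_trans)
  also have "\<dots> = (\<Sum>l<n. \<Sum>i\<in>{l * N..<l * N + N}. 2 / node \<tau> N i)"
    by (rule sum.nat_group[symmetric])
  also have "\<dots> = (\<Sum>l<n. 2 * real N / \<tau> * (1 + real l) powr - node_exp)"
  proof (rule sum.cong[OF refl])
    fix l
    have "i div N = l" if "i \<in> {l * N..<l * N + N}" for i
      using that N by (intro div_nat_eqI) (auto simp: mult.commute)
    then have "(\<Sum>i\<in>{l * N..<l * N + N}. 2 / node \<tau> N i)
       = (\<Sum>i\<in>{l * N..<l * N + N}. 2 / (\<tau> * (1 + real l) powr node_exp))"
      by (intro sum.cong) (auto simp: node_def)
    also have "\<dots> = 2 * real N / \<tau> * (1 + real l) powr - node_exp" by (simp add: powr_minus divide_inverse)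
    finally show "(\<Sum>i\<in>{l * N..<l * N + N}. 2 / node \<tau> N i) = 2 * real N / \<tau> * (1 + real l) powr - node_exp" .
  qed
  also have "\<dots> = 2 * real N / \<tau> * (\<Sum>l<n. (1 + real l) powr - node_exp)" by (simp add: sum_distrib_left)
  also have "\<dots> \<le> 2 * real N / \<tau> * (\<Sum>l. (1 + real l) powr - node_exp)"
    using \<tau> by (intro mult_left_mono sum_le_suminf[OF summable_nodes]) auto
  also have "\<dots> = real N * node_sum / (2 * \<tau>)" by (simp add: node_sum_def)
  finally show ?thesis .
qed

text \<open>The difference of two translates of a smooth step of length \<open>d\<close>. Its translates by multiples of \<open>d\<close>
  therefore form a telescoping sum with value \<open>1\<close>.\<close>

lemma bump_exists:
  assumes d: "d > 0" and \<tau>: "\<tau> \<ge> 1" and N: "N \<ge> 1" and le: "real N * node_sum \<le> d * \<tau>"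
  obtains \<psi> :: "nat \<Rightarrow> real \<Rightarrow> real" where
    "\<And>k x. (\<psi> k has_field_derivative \<psi> (Suc k) x) (at x)"
    "\<And>k x. \<bar>x\<bar> > d \<Longrightarrow> \<psi> k x = 0"
    "\<And>x K. finite K \<Longrightarrow> (\<And>k::int. \<bar>x - d * of_int k\<bar> \<le> d \<Longrightarrow> k \<in> K) \<Longrightarrow> (\<Sum>k\<in>K. \<psi> 0 (x - d * of_int k)) = 1"
    "\<And>k x. \<bar>\<psi> k x\<bar> \<le> 2 * (\<Prod>i<k. node \<tau> N i)"
proof -
  have pos: "0 < 2 / node \<tau> N i" for i using node_pos[of \<tau> N i] \<tau> by simp
  have s: "(\<Sum>i<n. 2 / node \<tau> N i) \<le> d / 2" for n
  proof -
    have "(\<Sum>i<n. 2 / node \<tau> N i) \<le> real N * node_sum / (2 * \<tau>)" using \<tau> N by (intro sum_node_le) auto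
    also have "\<dots> \<le> d / 2" using le \<tau> by (simp add: field_simps)
    finally show ?thesis .
  qed
  \<comment> \<open>Half of the length \<open>d\<close> is used by the boxes, the other half by the initial ramp of \<open>smooth_step\<close>.\<close>
  have d2: "d / 2 > 0" using d by simp
  obtain H :: "nat \<Rightarrow> real \<Rightarrow> real" where
    H: "\<And>k x. (H k has_field_derivative H (Suc k) x) (at x)"
      "\<And>x. x \<le> 0 \<Longrightarrow> H 0 x = 0" "\<And>x. x \<ge> d / 2 + d / 2 \<Longrightarrow> H 0 x = 1"
      "\<And>k x. \<bar>H k x\<bar> \<le> (\<Prod>i<k. 2 / (2 / node \<tau> N i))"
    using smooth_step[of "d / 2" "\<lambda>i. 2 / node \<tau> N i" "d / 2", OF d2 pos s] by blast
  have H1: "H 0 x = 1" if "x \<ge> d" for x using H(3) that by simp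
  define \<psi> where "\<psi> k x = H k (x + d) - H k x" for k x
  have der: "(\<psi> k has_field_derivative \<psi> (Suc k) x) (at x)" for k x
  proof -
    have "((\<lambda>x. H k (x + d)) has_field_derivative H (Suc k) (x + d)) (at x)"
      using DERIV_shift[of "H k" "H (Suc k) (x + d)" x d] H(1) by simp
    then show ?thesis unfolding \<psi>_def[abs_def] by (intro DERIV_diff H(1))
  qed
  show ?thesis
  proof
    show "(\<psi> k has_field_derivative \<psi> (Suc k) x) (at x)" for k x by (rule der)
    show "\<bar>\<psi> k x\<bar> \<le> 2 * (\<Prod>i<k. node \<tau> N i)" for k x
      using H(4)[of k x] H(4)[of k "x + d"] by (simp add: \<psi>_def)
    show "\<psi> k x = 0" if "\<bar>x\<bar> > d" for k x
      using that
    proof (induction k arbitrary: x)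
      case 0
      then show ?case using H(2)[of x] H(2)[of "x + d"] H1[of x] H1[of "x + d"] d
        by (cases "x < 0") (auto simp: \<psi>_def)
    next
      case (Suc k)
      have "eventually (\<lambda>y. \<bar>y\<bar> > d) (nhds x)"
      proof -
        have "open {y::real. d < \<bar>y\<bar>}" by (intro open_Collect_less continuous_intros)
        then show ?thesis using Suc.prems unfolding eventually_nhds by blast
      qed
      then have "eventually (\<lambda>y. \<psi> k y = 0) (nhds x)" by (rule eventually_mono) (rule Suc.IH)
      then have "(\<psi> k has_field_derivative 0) (at x)"
        using DERIV_cong_ev[of x x "\<psi> k" "\<lambda>_. 0" 0 0] by simp
      then show ?case using der[of k x] DERIV_unique by blast
    qed
    show "(\<Sum>k\<in>K. \<psi> 0 (x - d * of_int k)) = 1"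
      if K: "finite K" "\<And>k::int. \<bar>x - d * of_int k\<bar> \<le> d \<Longrightarrow> k \<in> K" for x K
    proof -
      define p where "p = \<lfloor>x / d\<rfloor>"
      have "of_int p \<le> x / d" "x / d < of_int p + 1" by (auto simp: p_def)
      then have p: "0 \<le> x - d * of_int p" "x - d * of_int p < d" using d by (simp_all add: field_simps)
      have pe: "x - d * of_int (p + 1) = (x - d * of_int p) - d" by (simp add: algebra_simps)
      have "{p, p + 1} \<subseteq> K" using p pe by (auto intro!: K(2))
      moreover have "\<psi> 0 (x - d * of_int k) = 0" if "k \<in> K - {p, p + 1}" for k
      proof -
        consider "k \<le> p - 1" | "k \<ge> p + 2" using \<open>k \<in> K - {p, p + 1}\<close> by force
        then show ?thesis
        proof cases
          case 1
          then have "d * of_int k \<le> d * of_int (p - 1)" using d by (intro mult_left_mono) linarith+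
          then have "x - d * of_int k \<ge> d" using p by (simp add: algebra_simps)
          then show ?thesis using H1 d by (simp add: \<psi>_def)
        next
          case 2
          then have "d * of_int (p + 2) \<le> d * of_int k" using d by (intro mult_left_mono) linarith+
          then have "x - d * of_int k + d \<le> 0" using p by (simp add: algebra_simps)
          then show ?thesis using H(2) d by (simp add: \<psi>_def)
        qed
      qed
      ultimately have "(\<Sum>k\<in>K. \<psi> 0 (x - d * of_int k)) = (\<Sum>k\<in>{p, p + 1}. \<psi> 0 (x - d * of_int k))"
        using K(1) by (intro sum.mono_neutral_right) auto
      also have "\<dots> = \<psi> 0 (x - d * of_int p) + \<psi> 0 ((x - d * of_int p) - d)" by (simp add: pe[symmetric])
      also have "\<dots> = 1" using p H1[of "x - d * of_int p + d"] H(2)[of "x - d * of_int p - d"]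
        by (simp add: \<psi>_def)
      finally show ?thesis .
    qed
  qed
qed

text \<open>The frequency is raised from \<open>t\<close> to the first \<open>\<tau>\<close> for which about \<open>2 M \<kappa>(\<tau>)\<close> boxes of width \<open>1 / \<tau>\<close> fit
  into the length \<open>d\<close>. The touching line bounds \<open>\<kappa>(\<tau>)\<close> by \<open>\<kappa>(t) + c \<tau>\<close>, and \<open>c \<tau>\<close> is at most
  \<open>\<kappa>(\<tau>) / 2\<close> when \<open>c\<close> is small compared with \<open>d / M\<close>. So the cost remains a power of \<open>exp(\<kappa>(t))\<close>.\<close>

lemma cutoff_parameters:
  assumes tc: "touch c t" "c > 0" and t: "t \<ge> 1" "\<kappa> t \<ge> 1" and M: "M \<ge> 1" and d: "d > 0"
    and le: "6 * node_sum * M * c \<le> d"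
  shows "\<exists>\<tau> N. \<tau> \<ge> 1 \<and> N \<ge> 1 \<and> real N * node_sum \<le> d * \<tau> \<and> 2 * M * \<kappa> \<tau> \<le> real N \<and> real N \<le> 6 * M * \<kappa> t"
proof -
  define g where "g s = 3 * node_sum * M * \<kappa> s - d * s" for s
  have ZM: "3 * node_sum * M > 0" using node_sum_ge M by simp
  have "\<exists>\<tau>\<ge>t. g \<tau> \<le> 0 \<and> (\<tau> = t \<or> g \<tau> = 0)"
  proof (cases "g t \<le> 0")
    case False
    obtain S where S: "S \<ge> 1" "\<And>s. s \<ge> S \<Longrightarrow> \<kappa> s \<le> d / (3 * node_sum * M) * s"
      using sublinear[of "d / (3 * node_sum * M)"] d ZM by auto
    define T where "T = max S t"
    have "g T \<le> 0" using S(2)[of T] ZM by (simp add: g_def T_def field_simps)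
    moreover have "continuous_on {t..T} g"
      unfolding g_def using t by (intro continuous_intros continuous_on_subset[OF continuous]) auto
    ultimately have "\<exists>x\<ge>t. x \<le> T \<and> g x = 0" using False by (intro IVT2') (auto simp: T_def)
    then show ?thesis by force
  qed auto
  then obtain \<tau> where \<tau>: "\<tau> \<ge> t" "g \<tau> \<le> 0" "\<tau> = t \<or> g \<tau> = 0" by blast
  have \<kappa>\<tau>: "\<kappa> \<tau> \<ge> 1" using mono[of t \<tau>] \<tau> t by simp
  have "\<kappa> \<tau> \<le> 2 * \<kappa> t"
    using \<tau>(3)
  proof
    assume "g \<tau> = 0"
    then have eq: "d * \<tau> = 3 * node_sum * M * \<kappa> \<tau>" by (simp add: g_def)
    have "\<kappa> \<tau> \<le> \<kappa> t + c * (\<tau> - t)" using tc \<tau> t by (auto simp: touch_def)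
    also have "\<dots> \<le> \<kappa> t + c * \<tau>" using tc t by simp
    finally have "d * \<kappa> \<tau> \<le> d * (\<kappa> t + c * \<tau>)" using d by simp
    also have "\<dots> = d * \<kappa> t + c * (d * \<tau>)" by (simp add: algebra_simps)
    also have "\<dots> = d * \<kappa> t + c * (3 * node_sum * M * \<kappa> \<tau>)" by (simp only: eq)
    also have "\<dots> = d * \<kappa> t + (6 * node_sum * M * c) * \<kappa> \<tau> / 2" by simp
    also have "\<dots> \<le> d * \<kappa> t + d * \<kappa> \<tau> / 2"
      using le \<kappa>\<tau> by (intro add_left_mono divide_right_mono mult_right_mono) auto
    finally have "d * \<kappa> \<tau> \<le> d * (2 * \<kappa> t)" by simp
    then show ?thesis using d by simp
  qed (use t in simp)
  define N where "N = nat \<lceil>2 * M * \<kappa> \<tau>\<rceil>"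
  have M\<kappa>: "1 \<le> M * \<kappa> \<tau>" using mult_mono[OF M \<kappa>\<tau>] M by simp
  have N: "2 * M * \<kappa> \<tau> \<le> real N" "real N \<le> 2 * M * \<kappa> \<tau> + 1" using M\<kappa> by (auto simp: N_def)
  have N3: "real N \<le> 3 * (M * \<kappa> \<tau>)" using N M\<kappa> by linarith
  have "real N * node_sum \<le> 3 * (M * \<kappa> \<tau>) * node_sum" using N3 node_sum_ge by (intro mult_right_mono) auto
  also have "\<dots> \<le> d * \<tau>" using \<tau>(2) by (simp add: g_def mult_ac)
  finally have NZ: "real N * node_sum \<le> d * \<tau>" .
  have "M * \<kappa> \<tau> \<le> M * (2 * \<kappa> t)" using M \<open>\<kappa> \<tau> \<le> 2 * \<kappa> t\<close> by (intro mult_left_mono) auto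
  then have "real N \<le> 6 * M * \<kappa> t" using N3 by simp
  moreover have "N \<ge> 1" using N M\<kappa> by linarith
  moreover have "\<tau> \<ge> 1" using \<tau> t by simp
  ultimately show ?thesis using NZ N by blast
qed

end

section \<open>Bounds on all derivatives\<close>

context growth_weight
begin

definition derivs_le :: "real \<Rightarrow> (real ^ 'n::finite \<Rightarrow> real) \<Rightarrow> real ^ 'n \<Rightarrow> real \<Rightarrow> bool" where
  "derivs_le m f x B \<longleftrightarrow> (\<forall>w. \<bar>wderiv w f x\<bar> \<le> B * W m (length w))"

lemma derivs_leI: "(\<And>w. \<bar>wderiv w f x\<bar> \<le> B * W m (length w)) \<Longrightarrow> derivs_le m f x B"
  and derivs_leD: "derivs_le m f x B \<Longrightarrow> \<bar>wderiv w f x\<bar> \<le> B * W m (length w)"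
  by (simp_all add: derivs_le_def)

lemma derivs_le_nonneg: "derivs_le m f x B \<Longrightarrow> m > 0 \<Longrightarrow> 0 \<le> B"
  using derivs_leD[of m f x B "[]"] W_pos[of m 0] by (smt (verit) list.size(3) mult_neg_pos)

lemma derivs_le_antimono:
  assumes "derivs_le m f x B" "0 < m'" "m' \<le> m" "B \<le> B'"
  shows "derivs_le m' f x B'"
proof (rule derivs_leI)
  fix w
  have B: "0 \<le> B" by (rule derivs_le_nonneg[OF assms(1)]) (use assms in simp)
  have "\<bar>wderiv w f x\<bar> \<le> B * W m (length w)" by (rule derivs_leD) fact
  also have "\<dots> \<le> B' * W m' (length w)"
    using assms B W_antimono[of m' m "length w"] W_pos[of m "length w"]
    by (intro mult_mono) auto
  finally show "\<bar>wderiv w f x\<bar> \<le> B' * W m' (length w)" .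
qed

text \<open>Leibniz' rule has \<open>2\<^sup>|\<^sup>w\<^sup>|\<close> terms, each of which is estimated by \<open>W_mult\<close>; their number is
  absorbed by \<open>W_double\<close>.\<close>

lemma derivs_le_mult:
  assumes f: "smooth f" "derivs_le m f x A" and g: "smooth g" "derivs_le m g x B" and m: "m > 0"
  shows "derivs_le (m / 2) (\<lambda>x. f x * g x) x (A * B)"
proof (rule derivs_leI)
  fix w
  have AB: "0 \<le> A" "0 \<le> B" using derivs_le_nonneg f g m by auto
  have term_le: "\<bar>wderiv u f x * wderiv v g x\<bar> \<le> A * B * W m (length w)" if "(u, v) \<in> set (splits w)" for u v
  proof -
    have "\<bar>wderiv u f x * wderiv v g x\<bar> \<le> (A * W m (length u)) * (B * W m (length v))"
      unfolding abs_mult using AB less_imp_le[OF W_pos[OF m]] by (intro mult_mono derivs_leD f g) auto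
    also have "\<dots> = A * B * (W m (length u) * W m (length v))" by simp
    also have "\<dots> \<le> A * B * W m (length w)"
      using W_mult[OF m, of "length u" "length v"] splits_length[OF that] AB
      by (intro mult_left_mono) auto
    finally show ?thesis .
  qed
  have "\<bar>\<Sum>(u, v)\<leftarrow>ps. wderiv u f x * wderiv v g x\<bar> \<le> real (length ps) * (A * B * W m (length w))"
    if "set ps \<subseteq> set (splits w)" for ps
    using that
  proof (induction ps)
    case (Cons p ps)
    obtain u v where p: "p = (u, v)" by fastforce
    have "\<bar>wderiv u f x * wderiv v g x\<bar> \<le> A * B * W m (length w)" using Cons.prems p by (intro term_le) auto
    then show ?case using Cons by (simp add: p algebra_simps)
  qed simp
  from this[of "splits w"]
  have "\<bar>wderiv w (\<lambda>x. f x * g x) x\<bar> \<le> 2 ^ length w * (A * B * W m (length w))"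
    by (simp add: smooth_mult(2)[OF f(1) g(1)] length_splits)
  also have "\<dots> = A * B * (2 ^ length w * W m (length w))" by simp
  also have "\<dots> \<le> A * B * W (m / 2) (length w)"
    using AB W_double[OF m] by (intro mult_left_mono) auto
  finally show "\<bar>wderiv w (\<lambda>x. f x * g x) x\<bar> \<le> A * B * W (m / 2) (length w)" .
qed

lemma derivs_le_sum:
  assumes "\<And>k. k \<in> E \<Longrightarrow> smooth (f k)" "\<And>k. k \<in> E \<Longrightarrow> derivs_le m (f k) x (B k)"
  shows "derivs_le m (\<lambda>x. \<Sum>k\<in>E. f k x) x (\<Sum>k\<in>E. B k)"
proof (rule derivs_leI)
  fix w
  have "\<bar>\<Sum>k\<in>E. wderiv w (f k) x\<bar> \<le> (\<Sum>k\<in>E. \<bar>wderiv w (f k) x\<bar>)" by (rule sum_abs)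
  also have "\<dots> \<le> (\<Sum>k\<in>E. B k * W m (length w))" by (intro sum_mono derivs_leD assms)
  finally show "\<bar>wderiv w (\<lambda>x. \<Sum>k\<in>E. f k x) x\<bar> \<le> (\<Sum>k\<in>E. B k) * W m (length w)"
    by (simp add: smooth_sum(2)[OF assms(1)] sum_distrib_right)
qed

lemma derivs_le_local:
  assumes "open U" "x \<in> U" "\<And>y. y \<in> U \<Longrightarrow> f y = g y" "derivs_le m g x B"
  shows "derivs_le m f x B"
  using assms(4) wderiv_local[OF assms(1-3)] by (simp add: derivs_le_def)

subsection \<open>The Beurling class as an algebra of smooth functions\<close>

definition beurling_smooth :: "(real ^ 'n::finite \<Rightarrow> real) \<Rightarrow> bool" where
  "beurling_smooth f \<longleftrightarrow> smooth f \<and> (\<forall>R m. m > 0 \<longrightarrow> (\<exists>C. \<forall>x\<in>ball 0 R. derivs_le m f x C))"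

lemma beurling_smooth_smooth: "beurling_smooth f \<Longrightarrow> smooth f"
  by (simp add: beurling_smooth_def)

lemma beurling_smoothD: "beurling_smooth f \<Longrightarrow> m > 0 \<Longrightarrow> \<exists>C. \<forall>x\<in>ball 0 R. derivs_le m f x C"
  by (simp add: beurling_smooth_def)

lemma beurling_smooth_mult:
  assumes "beurling_smooth f" "beurling_smooth g"
  shows "beurling_smooth (\<lambda>x. f x * g x)"
  unfolding beurling_smooth_def
proof (intro conjI allI impI)
  show "smooth (\<lambda>x. f x * g x)" using assms by (intro smooth_mult) (auto simp: beurling_smooth_def)
  fix R m :: real assume m: "m > 0"
  then obtain A B where AB: "\<forall>x\<in>ball 0 R. derivs_le (2 * m) f x A" "\<forall>x\<in>ball 0 R. derivs_le (2 * m) g x B"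
    using beurling_smoothD[OF assms(1), of "2 * m" R] beurling_smoothD[OF assms(2), of "2 * m" R] by auto
  have "derivs_le (2 * m / 2) (\<lambda>x. f x * g x) x (A * B)" if "x \<in> ball 0 R" for x
    using AB that m by (intro derivs_le_mult beurling_smooth_smooth assms) auto
  then show "\<exists>C. \<forall>x\<in>ball 0 R. derivs_le m (\<lambda>x. f x * g x) x C" by (intro exI[of _ "A * B"]) simp
qed

lemma beurling_smooth_sum:
  assumes "\<And>k. k \<in> E \<Longrightarrow> beurling_smooth (f k)"
  shows "beurling_smooth (\<lambda>x. \<Sum>k\<in>E. f k x)"
  unfolding beurling_smooth_def
proof (intro conjI allI impI)
  show "smooth (\<lambda>x. \<Sum>k\<in>E. f k x)" by (intro smooth_sum beurling_smooth_smooth assms)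
  fix R m :: real assume m: "m > 0"
  have "\<forall>k\<in>E. \<exists>C. \<forall>x\<in>ball 0 R. derivs_le m (f k) x C" using beurling_smoothD[OF assms m] by blast
  then obtain C where C: "\<And>k x. k \<in> E \<Longrightarrow> x \<in> ball 0 R \<Longrightarrow> derivs_le m (f k) x (C k)" by metis
  have "derivs_le m (\<lambda>x. \<Sum>k\<in>E. f k x) x (\<Sum>k\<in>E. C k)" if "x \<in> ball 0 R" for x
    by (rule derivs_le_sum) (auto intro: C that beurling_smooth_smooth assms)
  then show "\<exists>C. \<forall>x\<in>ball 0 R. derivs_le m (\<lambda>x. \<Sum>k\<in>E. f k x) x C" by blast
qed

lemma beurling_smooth_diff:
  assumes "beurling_smooth f" "beurling_smooth g"
  shows "beurling_smooth (\<lambda>x. f x - g x)"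
  unfolding beurling_smooth_def
proof (intro conjI allI impI)
  show "smooth (\<lambda>x. f x - g x)" by (intro smooth_diff beurling_smooth_smooth assms)
  fix R m :: real assume m: "m > 0"
  obtain A B where AB: "\<forall>x\<in>ball 0 R. derivs_le m f x A" "\<forall>x\<in>ball 0 R. derivs_le m g x B"
    using beurling_smoothD[OF assms(1) m, of R] beurling_smoothD[OF assms(2) m, of R] by auto
  have "derivs_le m (\<lambda>x. f x - g x) x (A + B)" if "x \<in> ball 0 R" for x
  proof (rule derivs_leI)
    fix w
    have "\<bar>wderiv w f x - wderiv w g x\<bar> \<le> A * W m (length w) + B * W m (length w)"
      using derivs_leD[of m f x A w] derivs_leD[of m g x B w] AB that by force
    then show "\<bar>wderiv w (\<lambda>x. f x - g x) x\<bar> \<le> (A + B) * W m (length w)"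
      by (simp add: smooth_diff(2)[OF assms[THEN beurling_smooth_smooth]] distrib_right)
  qed
  then show "\<exists>C. \<forall>x\<in>ball 0 R. derivs_le m (\<lambda>x. f x - g x) x C" by blast
qed

lemma beurling_smooth_local:
  assumes "\<And>R. \<exists>g. beurling_smooth g \<and> (\<forall>x\<in>ball 0 R. f x = g x)"
  shows "beurling_smooth f"
  unfolding beurling_smooth_def
proof (intro conjI allI impI)
  show "smooth f"
  proof (rule smooth_local)
    fix x :: "real ^ 'a"
    obtain g where g: "beurling_smooth g" "\<forall>y\<in>ball 0 (norm x + 1). f y = g y" using assms[of "norm x + 1"] by auto
    show "\<exists>U g. open U \<and> x \<in> U \<and> smooth g \<and> (\<forall>y\<in>U. f y = g y)"
      by (intro exI[of _ "ball 0 (norm x + 1)"] exI[of _ g]) (use g beurling_smooth_smooth in auto)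
  qed
  fix R m :: real assume m: "m > 0"
  obtain g where g: "beurling_smooth g" "\<forall>y\<in>ball 0 R. f y = g y" using assms[of R] by auto
  obtain C where "\<forall>x\<in>ball 0 R. derivs_le m g x C" using beurling_smoothD[OF g(1) m, of R] by auto
  then have "\<forall>x\<in>ball 0 R. derivs_le m f x C" using g(2) derivs_le_local[of "ball 0 R" _ f g m C] by auto
  then show "\<exists>C. \<forall>x\<in>ball 0 R. derivs_le m f x C" by blast
qed

end

section \<open>Lattice bumps\<close>

definition deriv_chain :: "(nat \<Rightarrow> real \<Rightarrow> real) \<Rightarrow> bool" where
  "deriv_chain \<psi> \<longleftrightarrow> (\<forall>j x. (\<psi> j has_field_derivative \<psi> (Suc j) x) (at x))"

definition lattice_bump :: "real \<Rightarrow> (nat \<Rightarrow> real \<Rightarrow> real) \<Rightarrow> ('n::finite \<Rightarrow> int) \<Rightarrow> real ^ 'n \<Rightarrow> real" where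
  "lattice_bump d \<psi> k x = (\<Prod>i\<in>UNIV. \<psi> 0 (x $ i - d * of_int (k i)))"

definition near :: "real \<Rightarrow> real \<Rightarrow> real ^ 'n::finite \<Rightarrow> ('n \<Rightarrow> int) set" where
  "near d \<rho> x = {k. \<forall>i. \<bar>x $ i - d * of_int (k i)\<bar> \<le> \<rho>}"

lemma lattice_bump_smooth:
  fixes k :: "'n::finite \<Rightarrow> int"
  assumes der: "deriv_chain \<psi>"
  shows "smooth (lattice_bump d \<psi> k)"
    and "wderiv w (lattice_bump d \<psi> k) = (\<lambda>x. \<Prod>i\<in>UNIV. \<psi> (count_list w i) (x $ i - d * of_int (k i)))"
proof -
  let ?G = "\<lambda>w x. \<Prod>i\<in>UNIV. \<psi> (count_list w i) (x $ i - d * of_int (k i))"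
  have cont: "continuous_on UNIV (\<psi> j)" for j
    using der unfolding deriv_chain_def
    by (intro continuous_at_imp_continuous_on ballI) (blast intro: DERIV_isCont)
  have 1: "continuous_on UNIV (?G w)" for w
    by (intro continuous_on_prod continuous_on_compose2[OF cont] continuous_intros) auto
  have 2: "((\<lambda>t. ?G w (x + t *\<^sub>R axis i 1)) has_field_derivative ?G (i # w) x) (at 0)" for w i and x :: "real ^ 'n"
  proof -
    let ?c = "\<Prod>i'\<in>UNIV - {i}. \<psi> (count_list w i') (x $ i' - d * of_int (k i'))"
    have eq: "?G w (x + t *\<^sub>R axis i 1) = \<psi> (count_list w i) (x $ i - d * of_int (k i) + t) * ?c" for t
      by (subst prod.remove[of UNIV i]) (auto simp: axis_def algebra_simps intro!: prod.cong)
    have eq2: "?G (i # w) x = \<psi> (Suc (count_list w i)) (x $ i - d * of_int (k i)) * ?c"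
      by (subst prod.remove[of UNIV i]) (auto intro!: prod.cong)
    have "((\<lambda>t. \<psi> (count_list w i) (t + (x $ i - d * of_int (k i)))) has_field_derivative
        \<psi> (Suc (count_list w i)) (x $ i - d * of_int (k i))) (at 0)"
      using DERIV_shift[of "\<psi> (count_list w i)" "\<psi> (Suc (count_list w i)) (x $ i - d * of_int (k i))"
          0 "x $ i - d * of_int (k i)"] der by (simp add: deriv_chain_def)
    then show ?thesis unfolding eq eq2 by (intro DERIV_cmult_right) (simp add: add.commute)
  qed
  have 3: "?G [] = lattice_bump d \<psi> k" by (rule ext) (simp add: lattice_bump_def)
  show "smooth (lattice_bump d \<psi> k)" "wderiv w (lattice_bump d \<psi> k) = ?G w"
    using smooth_family[of ?G, OF 1 2] unfolding 3 by simp_all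
qed

lemma lattice_bump_support:
  assumes "\<And>j x. \<bar>x\<bar> > d \<Longrightarrow> \<psi> j x = 0" "k \<notin> near d d x"
  shows "lattice_bump d \<psi> k x = 0"
proof -
  obtain i where "\<bar>x $ i - d * of_int (k i)\<bar> > d" using assms(2) by (auto simp: near_def not_le)
  then have "\<psi> 0 (x $ i - d * of_int (k i)) = 0" by (rule assms(1))
  then show ?thesis unfolding lattice_bump_def by (intro prod_zero) auto
qed

lemma ints_in_interval:
  assumes "d > 0"
  shows "{k::int. \<bar>y - d * of_int k\<bar> \<le> \<rho>} \<subseteq> {\<lceil>(y - \<rho>) / d\<rceil>..\<lfloor>(y + \<rho>) / d\<rfloor>}"
  using assms by (auto simp: ceiling_le_iff le_floor_iff field_simps)

lemma near_PiE: "near d \<rho> x = (\<Pi>\<^sub>E i\<in>UNIV. {k::int. \<bar>x $ i - d * of_int k\<bar> \<le> \<rho>})"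
  by (auto simp: near_def PiE_UNIV_domain)

lemma near_finite: "d > 0 \<Longrightarrow> finite (near d \<rho> x)"
  unfolding near_PiE by (intro finite_PiE) (auto intro: finite_subset[OF ints_in_interval])

lemma near_card:
  fixes x :: "real ^ 'n::finite"
  assumes "d > 0"
  shows "card (near d (2 * d) x) \<le> 5 ^ CARD('n)"
proof -
  have "card {k::int. \<bar>y - d * of_int k\<bar> \<le> 2 * d} \<le> 5" for y
  proof -
    have "card {k::int. \<bar>y - d * of_int k\<bar> \<le> 2 * d} \<le> card {\<lceil>(y - 2 * d) / d\<rceil>..\<lfloor>(y + 2 * d) / d\<rfloor>}"
      by (intro card_mono ints_in_interval assms) auto
    also have "\<dots> = nat (\<lfloor>(y + 2 * d) / d\<rfloor> + 1 - \<lceil>(y - 2 * d) / d\<rceil>)" by simp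
    also have "\<dots> \<le> 5"
    proof -
      have "(y + 2 * d) / d = y / d + 2" "(y - 2 * d) / d = y / d - 2" using assms by (simp_all add: field_simps)
      then show ?thesis by linarith
    qed
    finally show ?thesis .
  qed
  then have "(\<Prod>i\<in>UNIV. card {k::int. \<bar>x $ i - d * of_int k\<bar> \<le> 2 * d}) \<le> (\<Prod>i\<in>(UNIV :: 'n set). 5)"
    by (intro prod_mono) auto
  then show ?thesis unfolding near_PiE by (simp add: card_PiE)
qed

lemma near_mono:
  assumes "\<And>i. \<bar>y $ i - x $ i\<bar> \<le> \<delta>" "\<rho> + \<delta> \<le> \<rho>'"
  shows "near d \<rho> y \<subseteq> near d \<rho>' x"
proof
  fix k assume k: "k \<in> near d \<rho> y"
  show "k \<in> near d \<rho>' x"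
    unfolding near_def
  proof (intro CollectI allI)
    fix i
    have "\<bar>y $ i - d * of_int (k i)\<bar> \<le> \<rho>" using k by (simp add: near_def)
    then show "\<bar>x $ i - d * of_int (k i)\<bar> \<le> \<rho>'" using assms(1)[of i] assms(2) by linarith
  qed
qed

lemma lattice_partition:
  fixes x y :: "real ^ 'n::finite"
  assumes d: "d > 0"
    and pu: "\<And>x K. finite K \<Longrightarrow> (\<And>k::int. \<bar>x - d * of_int k\<bar> \<le> d \<Longrightarrow> k \<in> K) \<Longrightarrow> (\<Sum>k\<in>K. \<psi> 0 (x - d * of_int k)) = 1"
    and sub: "near d d y \<subseteq> E" and E: "finite E"
    and supp: "\<And>j x. \<bar>x\<bar> > d \<Longrightarrow> \<psi> j x = 0"
  shows "(\<Sum>k\<in>E. lattice_bump d \<psi> k y) = 1"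
proof -
  have fin: "finite {k::int. \<bar>z - d * of_int k\<bar> \<le> d}" for z
    by (rule finite_subset[OF ints_in_interval[OF d]]) simp
  have "(\<Sum>k\<in>E. lattice_bump d \<psi> k y) = (\<Sum>k\<in>near d d y. lattice_bump d \<psi> k y)"
    using sub E by (intro sum.mono_neutral_right) (auto intro: lattice_bump_support supp)
  also have "\<dots> = (\<Prod>i\<in>UNIV. \<Sum>k\<in>{k::int. \<bar>y $ i - d * of_int k\<bar> \<le> d}. \<psi> 0 (y $ i - d * of_int k))"
    unfolding near_PiE lattice_bump_def by (rule prod_sum_PiE[symmetric]) (auto intro: fin)
  also have "\<dots> = 1" using pu[OF fin] by simp
  finally show ?thesis .
qed

context growth_weight
begin

lemma W_prod:
  assumes "m > 0" "finite S" "S \<noteq> {}"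
  shows "(\<Prod>i\<in>S. W m (f i)) \<le> W m (\<Sum>i\<in>S. f i)"
  using assms(2,3)
proof (induction S rule: finite_ne_induct)
  case (insert i S)
  have "(\<Prod>i\<in>insert i S. W m (f i)) = W m (f i) * (\<Prod>i\<in>S. W m (f i))" using insert by simp
  also have "\<dots> \<le> W m (f i) * W m (\<Sum>i\<in>S. f i)"
    using insert W_pos[OF assms(1)] by (intro mult_left_mono) (auto intro: less_imp_le)
  also have "\<dots> \<le> W m (f i + (\<Sum>i\<in>S. f i))" by (rule W_mult[OF assms(1)])
  finally show ?case using insert by simp
qed simp

lemma lattice_bump_derivs_le:
  fixes k :: "'n::finite \<Rightarrow> int"
  assumes der: "deriv_chain \<psi>"
    and b: "\<And>j x. \<bar>\<psi> j x\<bar> \<le> B * W m j" and m: "m > 0"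
  shows "derivs_le m (lattice_bump d \<psi> k) x (B ^ CARD('n))"
proof (rule derivs_leI)
  fix w :: "'n list"
  have B: "B \<ge> 0"
  proof -
    have "0 \<le> B * W m 0" using b[of 0 0] abs_ge_zero order_trans by blast
    then show ?thesis using W_pos[OF m, of 0] by (simp add: zero_le_mult_iff)
  qed
  have "\<bar>wderiv w (lattice_bump d \<psi> k) x\<bar> = (\<Prod>i\<in>UNIV. \<bar>\<psi> (count_list w i) (x $ i - d * of_int (k i))\<bar>)"
    by (simp add: lattice_bump_smooth(2)[OF der] abs_prod)
  also have "\<dots> \<le> (\<Prod>i\<in>UNIV. B * W m (count_list w i))" by (intro prod_mono conjI b) auto
  also have "\<dots> = B ^ CARD('n) * (\<Prod>i\<in>UNIV. W m (count_list w i))" by (simp add: prod.distrib)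
  also have "\<dots> \<le> B ^ CARD('n) * W m (\<Sum>i\<in>UNIV. count_list w i)"
    using B by (intro mult_left_mono W_prod m) auto
  also have "(\<Sum>i\<in>UNIV. count_list w i) = length w" by (simp add: sum_count_set)
  finally show "\<bar>wderiv w (lattice_bump d \<psi> k) x\<bar> \<le> B ^ CARD('n) * W m (length w)" .
qed

lemma lattice_bump_beurling_smooth:
  fixes k :: "'n::finite \<Rightarrow> int"
  assumes der: "deriv_chain \<psi>"
    and b: "\<And>m. m > 0 \<Longrightarrow> \<exists>B. \<forall>j x. \<bar>\<psi> j x\<bar> \<le> B * W m j"
  shows "beurling_smooth (lattice_bump d \<psi> k)"
  unfolding beurling_smooth_def
proof (intro conjI allI impI)
  show "smooth (lattice_bump d \<psi> k)" by (rule lattice_bump_smooth(1)[OF der])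
  fix R m :: real assume m: "m > 0"
  obtain B where "\<forall>j x. \<bar>\<psi> j x\<bar> \<le> B * W m j" using b[OF m] by blast
  then have "\<forall>x\<in>ball 0 R. derivs_le m (lattice_bump d \<psi> k) x (B ^ CARD('n))"
    using lattice_bump_derivs_le[OF der, of B m] m by blast
  then show "\<exists>C. \<forall>x\<in>ball 0 R. derivs_le m (lattice_bump d \<psi> k) x C" by blast
qed

end

section \<open>Taylor polynomials of jets\<close>

definition dmono :: "'n::finite mindex \<Rightarrow> real ^ 'n \<Rightarrow> real" where
  "dmono \<gamma> z = (\<Prod>i\<in>UNIV. z $ i ^ \<gamma> i / fact (\<gamma> i))"

lemma mpow_div_mfact: "mpow z \<gamma> / mfact \<gamma> = dmono \<gamma> z"
  by (simp add: mpow_def mfact_def dmono_def prod_dividef)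

text \<open>The derivative of order \<open>\<alpha>\<close> of the Taylor polynomial of degree \<open>p\<close> at \<open>a\<close>. The index set is empty if
  \<open>|\<alpha>| > p\<close>, as it should be.\<close>

definition taylor :: "nat \<Rightarrow> real ^ 'n::finite \<Rightarrow> 'n jet \<Rightarrow> 'n mindex \<Rightarrow> real ^ 'n \<Rightarrow> real" where
  "taylor p a F \<alpha> x = (\<Sum>\<gamma> | msize \<alpha> + msize \<gamma> \<le> p. dmono \<gamma> (x - a) * F (madd \<alpha> \<gamma>) a)"

lemma finite_msize: "finite {\<gamma> :: 'n::finite mindex. k + msize \<gamma> \<le> p}"
  by (rule finite_subset[OF _ finite_msize_le[of p]]) auto

lemma msize_upd_Suc: "msize (\<alpha>(i := Suc (\<alpha> i))) = Suc (msize (\<alpha> :: 'n::finite mindex))"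
  unfolding msize_def by (subst (1 2) sum.remove[of UNIV i]) auto

lemma msize_madd: "msize (madd \<alpha> \<beta>) = msize \<alpha> + msize (\<beta> :: 'n::finite mindex)"
  by (simp add: msize_def madd_def sum.distrib)

lemma dmono_deriv:
  fixes z :: "real ^ 'n::finite"
  shows "((\<lambda>t. dmono \<gamma> (z + t *\<^sub>R axis i 1)) has_field_derivative
     (if \<gamma> i = 0 then 0 else dmono (\<gamma>(i := \<gamma> i - 1)) z)) (at 0)"
proof -
  let ?c = "\<Prod>j\<in>UNIV - {i}. z $ j ^ \<gamma> j / fact (\<gamma> j)"
  have eq: "dmono \<gamma> (z + t *\<^sub>R axis i 1) = (z $ i + t) ^ \<gamma> i / fact (\<gamma> i) * ?c" for t
    unfolding dmono_def by (subst prod.remove[of UNIV i]) (auto simp: axis_def intro!: prod.cong)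
  have eq2: "dmono (\<gamma>(i := \<gamma> i - 1)) z = z $ i ^ (\<gamma> i - 1) / fact (\<gamma> i - 1) * ?c"
    unfolding dmono_def by (subst prod.remove[of UNIV i]) (auto intro!: prod.cong)
  show ?thesis
  proof (cases "\<gamma> i")
    case 0
    then show ?thesis unfolding eq by simp
  next
    case (Suc k)
    have "((\<lambda>t. (z $ i + t) ^ Suc k) has_field_derivative real (Suc k) * z $ i ^ k) (at 0)"
      using DERIV_pow[of "Suc k" "z $ i" UNIV] DERIV_shift[of "\<lambda>y. y ^ Suc k" "real (Suc k) * z $ i ^ k" 0 "z $ i"]
      by (simp add: add.commute del: power_Suc of_nat_Suc)
    then have "((\<lambda>t. (z $ i + t) ^ Suc k / fact (Suc k)) has_field_derivative (real (Suc k) * z $ i ^ k) / fact (Suc k)) (at 0)"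
      by (rule DERIV_cdivide)
    also have "(real (Suc k) * z $ i ^ k) / fact (Suc k) = z $ i ^ k / fact k"
      by (simp add: divide_simps del: of_nat_Suc)
    finally have "((\<lambda>t. (z $ i + t) ^ Suc k / fact (Suc k) * ?c) has_field_derivative z $ i ^ k / fact k * ?c) (at 0)"
      by (rule DERIV_cmult_right)
    moreover have eq3: "dmono (\<gamma>(i := \<gamma> i - 1)) z = z $ i ^ k / fact k * ?c"
      unfolding eq2 by (simp add: Suc)
    ultimately show ?thesis unfolding eq eq3 by (simp add: Suc del: power_Suc fact_Suc)
  qed
qed

lemma taylor_deriv:
  fixes x :: "real ^ 'n::finite"
  shows "((\<lambda>t. taylor p a F \<alpha> (x + t *\<^sub>R axis i 1)) has_field_derivative
     taylor p a F (\<alpha>(i := Suc (\<alpha> i))) x) (at 0)"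
proof -
  let ?S = "{\<gamma> :: 'n mindex. msize \<alpha> + msize \<gamma> \<le> p}"
  let ?D = "\<lambda>\<gamma>. if \<gamma> i = 0 then 0 else dmono (\<gamma>(i := \<gamma> i - 1)) (x - a)"
  have sh: "(x + t *\<^sub>R axis i 1) - a = (x - a) + t *\<^sub>R axis i 1" for t by simp
  have D: "((\<lambda>t. taylor p a F \<alpha> (x + t *\<^sub>R axis i 1)) has_field_derivative
      (\<Sum>\<gamma>\<in>?S. ?D \<gamma> * F (madd \<alpha> \<gamma>) a)) (at 0)"
    unfolding taylor_def sh by (intro DERIV_sum DERIV_cmult_right dmono_deriv)
  have "(\<Sum>\<gamma>\<in>?S. ?D \<gamma> * F (madd \<alpha> \<gamma>) a)
      = (\<Sum>\<gamma>\<in>{\<gamma>\<in>?S. \<gamma> i \<noteq> 0}. dmono (\<gamma>(i := \<gamma> i - 1)) (x - a) * F (madd \<alpha> \<gamma>) a)"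
    by (intro sum.mono_neutral_cong_right finite_msize) auto
  also have "\<dots> = taylor p a F (\<alpha>(i := Suc (\<alpha> i))) x"
    unfolding taylor_def
  proof (rule sum.reindex_bij_witness[where j = "\<lambda>\<gamma>. \<gamma>(i := \<gamma> i - 1)" and i = "\<lambda>\<delta>. \<delta>(i := Suc (\<delta> i))"])
    fix \<gamma> assume \<gamma>: "\<gamma> \<in> {\<gamma>\<in>?S. \<gamma> i \<noteq> 0}"
    then have upd: "(\<gamma>(i := \<gamma> i - 1))(i := Suc ((\<gamma>(i := \<gamma> i - 1)) i)) = \<gamma>" by auto
    then show "(\<gamma>(i := \<gamma> i - 1))(i := Suc ((\<gamma>(i := \<gamma> i - 1)) i)) = \<gamma>" .
    have "msize \<gamma> = Suc (msize (\<gamma>(i := \<gamma> i - 1)))"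
      using msize_upd_Suc[of "\<gamma>(i := \<gamma> i - 1)" i] unfolding upd .
    then show "\<gamma>(i := \<gamma> i - 1) \<in> {\<gamma>. msize (\<alpha>(i := Suc (\<alpha> i))) + msize \<gamma> \<le> p}"
      using \<gamma> by (simp add: msize_upd_Suc)
    have "madd (\<alpha>(i := Suc (\<alpha> i))) (\<gamma>(i := \<gamma> i - 1)) = madd \<alpha> \<gamma>"
      using \<gamma> by (auto simp: madd_def fun_eq_iff)
    then show "dmono (\<gamma>(i := \<gamma> i - 1)) (x - a) * F (madd (\<alpha>(i := Suc (\<alpha> i))) (\<gamma>(i := \<gamma> i - 1))) a =
        dmono (\<gamma>(i := \<gamma> i - 1)) (x - a) * F (madd \<alpha> \<gamma>) a" by simp
  next
    fix \<delta> :: "'n mindex" assume "\<delta> \<in> {\<gamma>. msize (\<alpha>(i := Suc (\<alpha> i))) + msize \<gamma> \<le> p}"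
    then show "\<delta>(i := Suc (\<delta> i)) \<in> {\<gamma>\<in>?S. \<gamma> i \<noteq> 0}" by (simp add: msize_upd_Suc)
  qed simp
  finally show ?thesis using D by simp
qed

lemma taylor_continuous: "continuous_on UNIV (taylor p a F \<alpha>)"
proof -
  have "continuous_on UNIV (\<lambda>x. (x - a) $ i ^ k / fact k)" for i k
    by (intro continuous_on_divide continuous_on_power continuous_on_component continuous_on_diff
        continuous_on_id continuous_on_const ballI fact_nonzero)
  then have "continuous_on UNIV (\<lambda>x. dmono \<gamma> (x - a))" for \<gamma>
    unfolding dmono_def by (intro continuous_on_prod)
  then have "continuous_on UNIV (\<lambda>x. \<Sum>\<gamma> | msize \<alpha> + msize \<gamma> \<le> p. dmono \<gamma> (x - a) * F (madd \<alpha> \<gamma>) a)"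
    by (intro continuous_on_sum continuous_on_mult_right)
  then show ?thesis by (simp only: taylor_def[abs_def])
qed

lemma taylor_smooth:
  fixes a :: "real ^ 'n::finite"
  shows "smooth (taylor p a F (\<lambda>_. 0))"
    and "wderiv w (taylor p a F (\<lambda>_. 0)) = taylor p a F (count_list w)"
proof -
  note cont = taylor_continuous[of p a F]
  have upd: "count_list (i # w) = (count_list w)(i := Suc (count_list w i))" for i :: 'n and w
    by (rule ext) simp
  have der: "((\<lambda>t. taylor p a F (count_list w) (x + t *\<^sub>R axis i 1)) has_field_derivative
     taylor p a F (count_list (i # w)) x) (at 0)" for w i x
    unfolding upd by (rule taylor_deriv)
  have nil: "count_list [] = (\<lambda>_::'n. 0)" by (rule ext) simp
  have "smooth (taylor p a F (count_list []))"
    by (rule smooth_family(1)[where G = "\<lambda>w. taylor p a F (count_list w)"]) (rule cont, rule der)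
  then show "smooth (taylor p a F (\<lambda>_. 0))" by (simp only: nil)
  have "wderiv w (taylor p a F (count_list [])) = taylor p a F (count_list w)"
    by (rule smooth_family(2)[where G = "\<lambda>w. taylor p a F (count_list w)"]) (rule cont, rule der)
  then show "wderiv w (taylor p a F (\<lambda>_. 0)) = taylor p a F (count_list w)" by (simp only: nil)
qed

lemma taylor_at_base:
  fixes a :: "real ^ 'n::finite"
  assumes "msize \<alpha> \<le> p"
  shows "taylor p a F \<alpha> a = F \<alpha> a"
proof -
  have z: "dmono \<gamma> 0 = (if \<gamma> = (\<lambda>_. 0) then 1 else 0)" for \<gamma> :: "'n mindex"
  proof (cases "\<gamma> = (\<lambda>_. 0)")
    case False
    then obtain i where "\<gamma> i \<noteq> 0" by auto
    then have "(0 :: real ^ 'n) $ i ^ \<gamma> i / fact (\<gamma> i) = 0" by (simp add: power_0_left)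
    then have "dmono \<gamma> (0 :: real ^ 'n) = 0"
      unfolding dmono_def by (intro prod_zero bexI[of _ i]) simp_all
    then show ?thesis using False by simp
  qed (simp add: dmono_def)
  have "taylor p a F \<alpha> a = (\<Sum>\<gamma> | msize \<alpha> + msize \<gamma> \<le> p. if \<gamma> = (\<lambda>_. 0) then F (madd \<alpha> \<gamma>) a else 0)"
    unfolding taylor_def by (intro sum.cong) (auto simp: z)
  also have "\<dots> = F (madd \<alpha> (\<lambda>_. 0)) a"
    using assms by (subst sum.delta[OF finite_msize]) (simp add: msize_def)
  finally show ?thesis by (simp add: madd_def)
qed

subsection \<open>Change of base point\<close>

lemma binomial_div_fact:
  "(a + b :: real) ^ n / fact n = (\<Sum>k\<le>n. (a ^ k / fact k) * (b ^ (n - k) / fact (n - k)))"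
proof -
  have "(a + b) ^ n / fact n = (\<Sum>k\<le>n. (of_nat (n choose k) * a ^ k * b ^ (n - k)) / fact n)"
    by (simp add: binomial_ring sum_divide_distrib)
  also have "\<dots> = (\<Sum>k\<le>n. (a ^ k / fact k) * (b ^ (n - k) / fact (n - k)))"
    by (intro sum.cong refl) (simp add: binomial_fact field_simps)
  finally show ?thesis .
qed

lemma dmono_add:
  fixes z :: "real ^ 'n::finite"
  shows "dmono \<beta> (z + z') = (\<Sum>\<gamma> | \<forall>i. \<gamma> i \<le> \<beta> i. dmono \<gamma> z * dmono (\<lambda>i. \<beta> i - \<gamma> i) z')"
proof -
  have "dmono \<beta> (z + z') = (\<Prod>i\<in>UNIV. \<Sum>k\<in>{..\<beta> i}. (z $ i ^ k / fact k) * (z' $ i ^ (\<beta> i - k) / fact (\<beta> i - k)))"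
    unfolding dmono_def by (intro prod.cong refl) (simp add: binomial_div_fact)
  also have "\<dots> = (\<Sum>\<gamma>\<in>(\<Pi>\<^sub>E i\<in>UNIV. {..\<beta> i}). \<Prod>i\<in>UNIV. (z $ i ^ \<gamma> i / fact (\<gamma> i)) * (z' $ i ^ (\<beta> i - \<gamma> i) / fact (\<beta> i - \<gamma> i)))"
    by (rule prod_sum_PiE) auto
  also have "(\<Pi>\<^sub>E i\<in>UNIV. {..\<beta> i}) = {\<gamma>. \<forall>i. \<gamma> i \<le> \<beta> i}" by (auto simp: PiE_UNIV_domain)
  finally show ?thesis by (simp only: dmono_def prod.distrib)
qed

lemma finite_le_mindex: "finite {\<gamma> :: 'n::finite mindex. \<forall>i. \<gamma> i \<le> \<beta> i}"
proof -
  have "{\<gamma>. \<forall>i. \<gamma> i \<le> \<beta> i} = (\<Pi>\<^sub>E i\<in>UNIV. {..\<beta> i})" by (auto simp: PiE_UNIV_domain)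
  then show ?thesis by (simp add: finite_PiE)
qed

text \<open>Expand \<open>(x - b)\<^sup>\<beta> = ((x - a) + (a - b))\<^sup>\<beta>\<close> and collect the powers of \<open>x - a\<close>.\<close>

lemma taylor_rebase:
  fixes a b x :: "real ^ 'n::finite"
  shows "taylor p b F \<alpha> x =
     (\<Sum>\<gamma> | msize \<alpha> + msize \<gamma> \<le> p. dmono \<gamma> (x - a) * taylor p b F (madd \<alpha> \<gamma>) a)"
proof -
  let ?S = "{\<beta> :: 'n mindex. msize \<alpha> + msize \<beta> \<le> p}"
  let ?T = "\<lambda>\<gamma>. {\<delta> :: 'n mindex. msize (madd \<alpha> \<gamma>) + msize \<delta> \<le> p}"
  have "taylor p b F \<alpha> x = (\<Sum>\<beta>\<in>?S. dmono \<beta> ((x - a) + (a - b)) * F (madd \<alpha> \<beta>) b)"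
    by (simp add: taylor_def)
  also have "\<dots> = (\<Sum>\<beta>\<in>?S. \<Sum>\<gamma> | \<forall>i. \<gamma> i \<le> \<beta> i. dmono \<gamma> (x - a) * dmono (\<lambda>i. \<beta> i - \<gamma> i) (a - b) * F (madd \<alpha> \<beta>) b)"
    by (simp only: dmono_add sum_distrib_right)
  also have "\<dots> = (\<Sum>(\<beta>, \<gamma>)\<in>(SIGMA \<beta>:?S. {\<gamma>. \<forall>i. \<gamma> i \<le> \<beta> i}).
      dmono \<gamma> (x - a) * dmono (\<lambda>i. \<beta> i - \<gamma> i) (a - b) * F (madd \<alpha> \<beta>) b)"
    by (intro sum.Sigma finite_msize ballI finite_le_mindex)
  also have "\<dots> = (\<Sum>(\<gamma>, \<delta>)\<in>(SIGMA \<gamma>:?S. ?T \<gamma>).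
      dmono \<gamma> (x - a) * (dmono \<delta> (a - b) * F (madd (madd \<alpha> \<gamma>) \<delta>) b))"
  proof (rule sum.reindex_bij_witness[where j = "\<lambda>(\<beta>, \<gamma>). (\<gamma>, \<lambda>i. \<beta> i - \<gamma> i)" and i = "\<lambda>(\<gamma>, \<delta>). (madd \<gamma> \<delta>, \<gamma>)"])
    fix u assume "u \<in> (SIGMA \<beta>:?S. {\<gamma>. \<forall>i. \<gamma> i \<le> \<beta> i})"
    then obtain \<beta> \<gamma> where u: "u = (\<beta>, \<gamma>)" "msize \<alpha> + msize \<beta> \<le> p" "\<And>i. \<gamma> i \<le> \<beta> i" by auto
    have sp: "madd \<gamma> (\<lambda>i. \<beta> i - \<gamma> i) = \<beta>" using u(3) by (auto simp: madd_def)
    have ms: "msize \<beta> = msize \<gamma> + msize (\<lambda>i. \<beta> i - \<gamma> i)"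
      using msize_madd[of \<gamma> "\<lambda>i. \<beta> i - \<gamma> i"] unfolding sp .
    have ma: "madd (madd \<alpha> \<gamma>) (\<lambda>i. \<beta> i - \<gamma> i) = madd \<alpha> \<beta>" using u(3) by (auto simp: madd_def)
    show "(case case u of (\<beta>, \<gamma>) \<Rightarrow> (\<gamma>, \<lambda>i. \<beta> i - \<gamma> i) of (\<gamma>, \<delta>) \<Rightarrow> (madd \<gamma> \<delta>, \<gamma>)) = u"
      using sp by (simp add: u)
    show "(case u of (\<beta>, \<gamma>) \<Rightarrow> (\<gamma>, \<lambda>i. \<beta> i - \<gamma> i)) \<in> (SIGMA \<gamma>:?S. ?T \<gamma>)"
      using u(2) ms by (simp add: u(1) msize_madd)
    show "(case case u of (\<beta>, \<gamma>) \<Rightarrow> (\<gamma>, \<lambda>i. \<beta> i - \<gamma> i) of (\<gamma>, \<delta>) \<Rightarrow>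
         dmono \<gamma> (x - a) * (dmono \<delta> (a - b) * F (madd (madd \<alpha> \<gamma>) \<delta>) b)) =
        (case u of (\<beta>, \<gamma>) \<Rightarrow> dmono \<gamma> (x - a) * dmono (\<lambda>i. \<beta> i - \<gamma> i) (a - b) * F (madd \<alpha> \<beta>) b)"
      using ma by (simp add: u(1))
  next
    fix v assume "v \<in> (SIGMA \<gamma>:?S. ?T \<gamma>)"
    then obtain \<gamma> \<delta> where v: "v = (\<gamma>, \<delta>)" "msize \<alpha> + msize \<gamma> + msize \<delta> \<le> p" by (auto simp: msize_madd)
    show "(case case v of (\<gamma>, \<delta>) \<Rightarrow> (madd \<gamma> \<delta>, \<gamma>) of (\<beta>, \<gamma>) \<Rightarrow> (\<gamma>, \<lambda>i. \<beta> i - \<gamma> i)) = v"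
      by (simp add: v madd_def)
    show "(case v of (\<gamma>, \<delta>) \<Rightarrow> (madd \<gamma> \<delta>, \<gamma>)) \<in> (SIGMA \<beta>:?S. {\<gamma>. \<forall>i. \<gamma> i \<le> \<beta> i})"
      using v(2) by (simp add: v(1) msize_madd) (simp add: madd_def)
  qed
  also have "\<dots> = (\<Sum>\<gamma>\<in>?S. \<Sum>\<delta>\<in>?T \<gamma>. dmono \<gamma> (x - a) * (dmono \<delta> (a - b) * F (madd (madd \<alpha> \<gamma>) \<delta>) b))"
    by (intro sum.Sigma[symmetric] finite_msize ballI)
  finally show ?thesis by (simp only: taylor_def sum_distrib_left)
qed

lemma remainder_eq_taylor:
  fixes a :: "real ^ 'n::finite"
  assumes "msize \<alpha> \<le> p"
  shows "remainder p b F \<alpha> a = F \<alpha> a - taylor p b F \<alpha> a"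
proof -
  have "{\<beta> :: 'n mindex. msize \<beta> \<le> p - msize \<alpha>} = {\<beta>. msize \<alpha> + msize \<beta> \<le> p}" using assms by auto
  then show ?thesis unfolding remainder_def taylor_def mpow_div_mfact by simp
qed

text \<open>Whitney's identity: the remainders of the jet are the Taylor coefficients at \<open>a\<close> of the
  difference of the two polynomials.\<close>

lemma taylor_diff_base:
  fixes a b x :: "real ^ 'n::finite"
  shows "taylor p a F \<alpha> x - taylor p b F \<alpha> x =
     (\<Sum>\<gamma> | msize \<alpha> + msize \<gamma> \<le> p. dmono \<gamma> (x - a) * remainder p b F (madd \<alpha> \<gamma>) a)"
  unfolding taylor_rebase[of p b F \<alpha> x a] taylor_def[of p a]
  by (simp add: sum_subtractf[symmetric] remainder_eq_taylor msize_madd right_diff_distrib)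

subsection \<open>Size of the monomials\<close>

lemma abs_dmono_le:
  fixes z :: "real ^ 'n::finite"
  assumes "\<And>i. \<bar>z $ i\<bar> \<le> \<rho>"
  shows "\<bar>dmono \<gamma> z\<bar> \<le> \<rho> ^ msize \<gamma> / mfact \<gamma>"
proof -
  have "\<bar>dmono \<gamma> z\<bar> = (\<Prod>i\<in>UNIV. \<bar>z $ i\<bar> ^ \<gamma> i / fact (\<gamma> i))"
    by (simp add: dmono_def abs_prod power_abs)
  also have "\<dots> \<le> (\<Prod>i\<in>UNIV. \<rho> ^ \<gamma> i / fact (\<gamma> i))"
    by (intro prod_mono conjI divide_right_mono power_mono assms) auto
  also have "\<dots> = \<rho> ^ msize \<gamma> / mfact \<gamma>" by (simp add: prod_dividef msize_def mfact_def power_sum)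
  finally show ?thesis .
qed

lemma mfact_pos: "mfact \<gamma> > 0"
  unfolding mfact_def by (intro prod_pos) auto

lemma power_le_fact_exp:
  assumes "z \<ge> (0::real)"
  shows "z ^ k \<le> fact k * exp z"
proof -
  have "(\<Sum>n\<in>{k}. z ^ n /\<^sub>R fact n) \<le> exp z"
    unfolding exp_def by (rule sum_le_suminf[OF summable_exp_generic]) (use assms in auto)
  then show ?thesis by (simp add: field_simps)
qed

lemma power_le_mfact_exp:
  assumes "z \<ge> (0::real)"
  shows "z ^ msize \<gamma> \<le> mfact (\<gamma> :: 'n::finite mindex) * exp (real CARD('n) * z)"
proof -
  have "z ^ msize \<gamma> = (\<Prod>i\<in>UNIV. z ^ \<gamma> i)" by (simp add: msize_def power_sum)
  also have "\<dots> \<le> (\<Prod>i\<in>(UNIV::'n set). fact (\<gamma> i) * exp z)"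
    using assms by (intro prod_mono conjI power_le_fact_exp) auto
  also have "\<dots> = mfact \<gamma> * exp (real CARD('n) * z)"
    by (simp add: prod.distrib mfact_def exp_of_nat_mult)
  finally show ?thesis .
qed

lemma sum_half_msize:
  fixes S :: "'n::finite mindex set"
  assumes "finite S"
  shows "(\<Sum>\<gamma>\<in>S. (1 / 2) ^ msize \<gamma>) \<le> (2::real) ^ CARD('n)"
proof -
  define P where "P = Max (insert 0 (msize ` S))"
  have fin: "finite (\<Pi>\<^sub>E i\<in>(UNIV :: 'n set). {..P})" by (rule finite_PiE) auto
  have sub: "S \<subseteq> (\<Pi>\<^sub>E i\<in>UNIV. {..P})"
  proof
    fix \<gamma> assume \<gamma>: "\<gamma> \<in> S"
    have "\<gamma> i \<le> P" for i
    proof -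
      have "\<gamma> i \<le> msize \<gamma>" unfolding msize_def by (rule member_le_sum) auto
      also have "\<dots> \<le> P" unfolding P_def using \<gamma> assms by (intro Max_ge) auto
      finally show ?thesis .
    qed
    then show "\<gamma> \<in> (\<Pi>\<^sub>E i\<in>UNIV. {..P})" by (simp add: PiE_UNIV_domain)
  qed
  have "(\<Sum>\<gamma>\<in>S. (1 / 2 :: real) ^ msize \<gamma>) \<le> (\<Sum>\<gamma>\<in>(\<Pi>\<^sub>E i\<in>(UNIV :: 'n set). {..P}). (1 / 2 :: real) ^ msize \<gamma>)"
    using sum_mono2[OF fin sub, of "\<lambda>\<gamma>. (1 / 2 :: real) ^ msize \<gamma>"] by simp
  also have "\<dots> = (\<Sum>\<gamma>\<in>(\<Pi>\<^sub>E i\<in>(UNIV :: 'n set). {..P}). \<Prod>i\<in>UNIV. (1 / 2 :: real) ^ \<gamma> i)"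
    by (simp add: msize_def power_sum)
  also have "\<dots> = (\<Prod>i\<in>(UNIV::'n set). \<Sum>k\<in>{..P}. (1 / 2 :: real) ^ k)"
    by (rule prod_sum_PiE[symmetric]) auto
  also have "\<dots> \<le> (\<Prod>i\<in>(UNIV::'n set). 2)"
  proof (intro prod_mono conjI sum_nonneg)
    have "(\<Sum>k\<in>{..P}. (1 / 2 :: real) ^ k) \<le> (\<Sum>k. (1 / 2) ^ k)"
      by (rule sum_le_suminf) (auto intro: summable_geometric)
    then show "(\<Sum>k\<in>{..P}. (1 / 2 :: real) ^ k) \<le> 2" by (simp add: suminf_geometric)
  qed auto
  finally show ?thesis by simp
qed

context growth_weight
begin

text \<open>Between the degrees \<open>m' c' t'\<close> and \<open>m c t\<close> of two consecutive levels every frequency \<open>s\<close> can be replaced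
  by one in \<open>[t', t]\<close>: frequencies below \<open>t'\<close> are moved to \<open>t'\<close> and frequencies above \<open>t\<close> to \<open>t\<close>, in both
  cases by \<open>touch_ln\<close>. On \<open>[t', t]\<close> the weight dominates the linear function \<open>\<rho> s\<close>.\<close>

lemma peak_transfer:
  assumes t': "touch c' t'" "c' > 0" "t' \<ge> 1" and t: "touch c t" "c > 0" "t' \<le> t"
    and m: "0 < m'" "m' \<le> m"
    and \<rho>: "\<rho> \<le> m * c" "\<rho> \<le> m' * c'"
    and j: "m' * c' * t' \<le> real j + 1" "real j \<le> m * c * t" and s: "s \<ge> 1"
  shows "\<exists>s' \<mu>. t' \<le> s' \<and> m' \<le> \<mu> \<and> s ^ j * exp (- (m * \<kappa> s)) \<le> s' ^ Suc j * exp (- (\<mu> * \<kappa> s')) \<and> \<rho> * s' \<le> \<mu> * \<kappa> s'"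
proof -
  have K: "y ^ k = exp (real k * ln y)" if "y > 0" for y :: real and k using that by (simp add: exp_of_nat_mult)
  consider "s \<le> t'" | "t' \<le> s" "s \<le> t" | "t \<le> s" by linarith
  then show ?thesis
  proof cases
    case 1
    have "m' * (\<kappa> t' + c' * t' * ln (s / t')) \<le> m' * \<kappa> s"
      using touch_ln[OF t'(1), of s] s m by (intro mult_left_mono) auto
    moreover have "m' * \<kappa> s \<le> m * \<kappa> s" using m s nonneg[of s] by (intro mult_right_mono) auto
    moreover have "(real j + 1) * ln (s / t') \<le> (m' * c' * t') * ln (s / t')"
      using j 1 s t' by (intro mult_right_mono_neg) auto
    moreover have "ln (s / t') = ln s - ln t'" using s t' by (simp add: ln_div)
    moreover have "0 \<le> ln s" using s by simp
    ultimately have "real j * ln s - m * \<kappa> s \<le> real (Suc j) * ln t' - m' * \<kappa> t'"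
      by (simp add: algebra_simps)
    then have "s ^ j * exp (- (m * \<kappa> s)) \<le> t' ^ Suc j * exp (- (m' * \<kappa> t'))"
      using s t' by (simp only: K flip: exp_add) simp
    moreover have "\<rho> * t' \<le> m' * \<kappa> t'"
    proof -
      have "\<rho> * t' \<le> m' * c' * t'" using \<rho> t' by (intro mult_right_mono) auto
      also have "\<dots> \<le> m' * \<kappa> t'" using touch_le[OF t'(1,2)] m by simp
      finally show ?thesis .
    qed
    ultimately show ?thesis by blast
  next
    case 2
    have "c * s \<le> \<kappa> s"
    proof -
      have "(c * t) * s \<le> \<kappa> t * s" using touch_le[OF t(1,2)] s by (intro mult_right_mono) auto
      also have "\<dots> \<le> t * \<kappa> s" using ratio_antimono[of s t] 2 s by (simp add: mult.commute)
      finally have "t * (c * s) \<le> t * \<kappa> s" by (simp add: mult_ac)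
      then show ?thesis using t t' by simp
    qed
    then have "m * c * s \<le> m * \<kappa> s" using m by simp
    moreover have "\<rho> * s \<le> m * c * s" using \<rho> s by (intro mult_right_mono) auto
    ultimately have "\<rho> * s \<le> m * \<kappa> s" by linarith
    moreover have "s ^ j * exp (- (m * \<kappa> s)) \<le> s ^ Suc j * exp (- (m * \<kappa> s))"
      using s by (intro mult_right_mono power_increasing) auto
    ultimately show ?thesis using 2 m by (rule_tac exI[of _ s], rule_tac exI[of _ m]) auto
  next
    case 3
    have t1: "t \<ge> 1" using t t' by simp
    have "m * (\<kappa> t + c * t * ln (s / t)) \<le> m * \<kappa> s"
      using touch_ln[OF t(1), of s] s m by (intro mult_left_mono) auto
    moreover have "real j * ln (s / t) \<le> (m * c * t) * ln (s / t)"
      using j 3 s t1 by (intro mult_right_mono) auto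
    moreover have "ln (s / t) = ln s - ln t" using s t1 by (simp add: ln_div)
    moreover have "0 \<le> ln t" using t1 by simp
    ultimately have "real j * ln s - m * \<kappa> s \<le> real (Suc j) * ln t - m * \<kappa> t"
      by (simp add: algebra_simps)
    then have "s ^ j * exp (- (m * \<kappa> s)) \<le> t ^ Suc j * exp (- (m * \<kappa> t))"
      using s t1 by (simp only: K flip: exp_add) simp
    moreover have "\<rho> * t \<le> m * \<kappa> t"
    proof -
      have "\<rho> * t \<le> m * c * t" using \<rho> t1 by (intro mult_right_mono) auto
      also have "\<dots> \<le> m * \<kappa> t" using touch_le[OF t(1,2)] m by simp
      finally show ?thesis .
    qed
    ultimately show ?thesis using t m by (rule_tac exI[of _ t], rule_tac exI[of _ m]) auto
  qed
qed

text \<open>Two consecutive levels, the coarser one with primes, and a radius \<open>\<rho>\<close> so small that on the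
  frequencies of these levels a quarter of the weight dominates \<open>(n + 1) \<rho> s\<close>.\<close>

definition scales :: "nat \<Rightarrow> real \<Rightarrow> real \<Rightarrow> real \<Rightarrow> real \<Rightarrow> real \<Rightarrow> real \<Rightarrow> real \<Rightarrow> bool" where
  "scales n \<rho> m' c' t' m c t \<longleftrightarrow>
     touch c' t' \<and> c' > 0 \<and> t' \<ge> 1 \<and> touch c t \<and> c > 0 \<and> t' \<le> t \<and> 0 < m' \<and> m' \<le> m \<and> 0 < \<rho> \<and>
     4 * (real n + 1) * \<rho> \<le> m * c \<and> 4 * (real n + 1) * \<rho> \<le> m' * c' \<and> (\<forall>s\<ge>t'. s \<le> exp (\<kappa> s))"

text \<open>The gain. After \<open>peak_transfer\<close> the left-hand side is essentially
  \<open>s\<^sup>j\<^sup>-\<^sup>i (\<rho> s)\<^sup>i / Q exp(- \<mu> \<kappa>(s))\<close> with \<open>s \<ge> t'\<close>. Half of the weight is spent on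
  \<open>(2 \<rho> s)\<^sup>i / Q\<close>, which is at most \<open>exp(2 (n + 1) \<rho> s)\<close>, and a little more on turning the remaining power of
  \<open>s\<close> into \<open>W M (j - i)\<close>; at least a quarter of \<open>m' \<kappa>(t')\<close> is left over.\<close>

lemma taylor_term:
  assumes sc: "scales n \<rho> m' c' t' m c t" and M: "0 < M" "M + 1 \<le> m' / 4"
    and j: "m' * c' * t' \<le> real j + 1" "real j \<le> m * c * t" and i: "i \<le> j"
    and Q: "Q > 0" "\<And>z. z \<ge> 0 \<Longrightarrow> z ^ i \<le> Q * exp ((real n + 1) * z)"
  shows "W m j * (\<rho> ^ i / Q) \<le> (1 / 2) ^ i * exp (- (m' / 4 * \<kappa> t')) * W M (j - i)"
proof -
  note sc' = sc[unfolded scales_def]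
  have \<rho>: "\<rho> > 0" using sc' by simp
  define X where "X = (1 / 2) ^ i * exp (- (m' / 4 * \<kappa> t')) * W M (j - i)"
  have "W m j \<le> X / (\<rho> ^ i / Q)"
  proof (rule W_least)
    fix s :: real assume s: "s \<ge> 1"
    obtain s' \<mu> where s': "t' \<le> s'" "m' \<le> \<mu>"
      and le: "s ^ j * exp (- (m * \<kappa> s)) \<le> s' ^ Suc j * exp (- (\<mu> * \<kappa> s'))"
      and \<rho>s: "4 * (real n + 1) * \<rho> * s' \<le> \<mu> * \<kappa> s'"
      using peak_transfer[of c' t' c t m' m "4 * (real n + 1) * \<rho>" j s] sc' j s by blast
    have s1: "s' \<ge> 1" using s' sc' by simp
    have \<kappa>: "0 \<le> \<kappa> t'" "\<kappa> t' \<le> \<kappa> s'" using nonneg[of t'] mono[of t' s'] sc' s' by auto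
    have "(2 * (\<rho> * s')) ^ i \<le> Q * exp ((real n + 1) * (2 * (\<rho> * s')))"
      using \<rho> s1 by (intro Q) simp
    also have "\<dots> \<le> Q * exp (\<mu> * \<kappa> s' / 2)" using \<rho>s Q(1) by (simp add: algebra_simps)
    finally have 1: "\<rho> ^ i * s' ^ i \<le> Q * (1 / 2) ^ i * exp (\<mu> * \<kappa> s' / 2)"
      by (simp add: power_mult_distrib field_simps)
    have 2: "s' \<le> exp (\<kappa> s')" using sc' s' by blast
    have 3: "s' ^ (j - i) \<le> W M (j - i) * exp (M * \<kappa> s')"
      using W_ge[OF M(1) s1, of "j - i"] by (simp add: exp_minus field_simps)
    have "\<rho> ^ i * (s ^ j * exp (- (m * \<kappa> s))) \<le> \<rho> ^ i * (s' ^ Suc j * exp (- (\<mu> * \<kappa> s')))"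
      using le \<rho> by (intro mult_left_mono) auto
    also have "s' ^ Suc j = s' ^ i * s' ^ (j - i) * s'" using i by (simp flip: power_add)
    also have "\<rho> ^ i * (s' ^ i * s' ^ (j - i) * s' * exp (- (\<mu> * \<kappa> s')))
        = (\<rho> ^ i * s' ^ i) * s' ^ (j - i) * s' * exp (- (\<mu> * \<kappa> s'))" by simp
    also have "\<dots> \<le> (Q * (1 / 2) ^ i * exp (\<mu> * \<kappa> s' / 2)) * (W M (j - i) * exp (M * \<kappa> s')) * exp (\<kappa> s') * exp (- (\<mu> * \<kappa> s'))"
      by (intro mult_mono[OF mult_mono[OF mult_mono[OF 1 3] 2] order_refl])
        (use \<rho> s1 Q(1) less_imp_le[OF W_pos[OF M(1)], of "j - i"] in auto)
    also have "\<dots> = Q * (1 / 2) ^ i * W M (j - i) * exp ((M + 1 - \<mu> / 2) * \<kappa> s')"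
      by (simp add: algebra_simps flip: exp_add)
    also have "\<dots> \<le> Q * (1 / 2) ^ i * W M (j - i) * exp (- (m' / 4 * \<kappa> t'))"
    proof (intro mult_left_mono)
      have "(M + 1 - \<mu> / 2) * \<kappa> s' \<le> (- (m' / 4)) * \<kappa> s'"
        using M s' \<kappa> by (intro mult_right_mono) auto
      also have "\<dots> \<le> - (m' / 4 * \<kappa> t')" using \<kappa> sc' by simp
      finally show "exp ((M + 1 - \<mu> / 2) * \<kappa> s') \<le> exp (- (m' / 4 * \<kappa> t'))" by simp
    qed (use Q W_pos[OF M(1), of "j - i"] in auto)
    finally have "\<rho> ^ i * (s ^ j * exp (- (m * \<kappa> s))) \<le> Q * X" by (simp add: X_def mult_ac)
    then show "s ^ j * exp (- (m * \<kappa> s)) \<le> X / (\<rho> ^ i / Q)" using \<rho> Q by (simp add: field_simps)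
  qed
  then show ?thesis using \<rho> Q by (simp add: X_def field_simps)
qed

text \<open>By \<open>taylor_diff_base\<close> and the bounds on the remainders, each term has the form treated in
  \<open>taylor_term\<close> with \<open>j = p + 1\<close>.\<close>

lemma taylor_move_base:
  fixes a b x :: "real ^ 'n::finite"
  assumes sc: "scales CARD('n) \<rho> m' c' t' m c t" and M: "0 < M" "M + 1 \<le> m' / 4"
    and p: "m' * c' * t' \<le> real p + 2" "real p + 1 \<le> m * c * t"
    and F: "\<And>\<gamma>. msize \<gamma> \<le> p \<Longrightarrow>
        \<bar>remainder p b F \<gamma> a\<bar> \<le> C * W m (p + 1) * (\<rho> ^ (p + 1 - msize \<gamma>) / fact (p + 1 - msize \<gamma>))"
    and C: "C \<ge> 0" and x: "\<And>i. \<bar>x $ i - a $ i\<bar> \<le> \<rho>"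
  shows "\<bar>taylor p a F \<alpha> x - taylor p b F \<alpha> x\<bar>
     \<le> C * 2 ^ CARD('n) * exp (- (m' / 4 * \<kappa> t')) * W M (msize \<alpha>)"
proof -
  define E where "E = exp (- (m' / 4 * \<kappa> t')) * W M (msize \<alpha>)"
  have E: "E \<ge> 0" using W_pos[OF M(1), of "msize \<alpha>"] by (simp add: E_def)
  have \<rho>: "\<rho> > 0" using sc by (simp add: scales_def)
  let ?S = "{\<gamma> :: 'n mindex. msize \<alpha> + msize \<gamma> \<le> p}"
  have "\<bar>dmono \<gamma> (x - a) * remainder p b F (madd \<alpha> \<gamma>) a\<bar> \<le> C * E * (1 / 2) ^ msize \<gamma>" if \<gamma>: "\<gamma> \<in> ?S" for \<gamma>
  proof -
    define i where "i = p + 1 - msize \<alpha>"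
    define l where "l = p + 1 - msize (madd \<alpha> \<gamma>)"
    have il: "i = msize \<gamma> + l" "i \<le> p + 1" "p + 1 - i = msize \<alpha>" "msize \<gamma> \<le> i"
      using \<gamma> by (auto simp: i_def l_def msize_madd)
    define Q where "Q = mfact \<gamma> * fact l"
    have Q: "Q > 0" by (simp add: Q_def mfact_pos)
    have Qz: "z ^ i \<le> Q * exp ((real CARD('n) + 1) * z)" if "z \<ge> 0" for z :: real
    proof -
      have "z ^ i \<le> (mfact \<gamma> * exp (real CARD('n) * z)) * (fact l * exp z)"
        unfolding il(1) power_add using that mfact_pos[of \<gamma>]
        by (intro mult_mono power_le_mfact_exp power_le_fact_exp) auto
      moreover have "exp ((real CARD('n) + 1) * z) = exp (real CARD('n) * z) * exp z"
        by (simp add: distrib_right exp_add)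
      ultimately show ?thesis by (simp add: Q_def mult_ac)
    qed
    have "\<bar>dmono \<gamma> (x - a) * remainder p b F (madd \<alpha> \<gamma>) a\<bar>
        \<le> (\<rho> ^ msize \<gamma> / mfact \<gamma>) * (C * W m (p + 1) * (\<rho> ^ l / fact l))"
      unfolding abs_mult
    proof (intro mult_mono)
      show "\<bar>dmono \<gamma> (x - a)\<bar> \<le> \<rho> ^ msize \<gamma> / mfact \<gamma>" by (rule abs_dmono_le) (simp add: x)
      show "\<bar>remainder p b F (madd \<alpha> \<gamma>) a\<bar> \<le> C * W m (p + 1) * (\<rho> ^ l / fact l)"
        unfolding l_def using \<gamma> by (intro F) (simp add: msize_madd)
    qed (use \<rho> mfact_pos[of \<gamma>] in auto)
    also have "\<dots> = C * (W m (p + 1) * (\<rho> ^ i / Q))" by (simp add: il(1) Q_def power_add)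
    also have "\<dots> \<le> C * ((1 / 2) ^ i * exp (- (m' / 4 * \<kappa> t')) * W M (p + 1 - i))"
      using p by (intro mult_left_mono C taylor_term[OF sc M _ _ il(2) Q Qz]) auto
    also have "\<dots> = C * E * (1 / 2) ^ i" by (simp only: E_def il(3)) (simp add: mult_ac)
    also have "\<dots> \<le> C * E * (1 / 2) ^ msize \<gamma>"
      using C E il(4) by (intro mult_left_mono power_decreasing) auto
    finally show ?thesis .
  qed
  then have "\<bar>taylor p a F \<alpha> x - taylor p b F \<alpha> x\<bar> \<le> (\<Sum>\<gamma>\<in>?S. C * E * (1 / 2) ^ msize \<gamma>)"
    unfolding taylor_diff_base by (intro order_trans[OF sum_abs] sum_mono) auto
  also have "\<dots> = C * E * (\<Sum>\<gamma>\<in>?S. (1 / 2) ^ msize \<gamma>)" by (simp add: sum_distrib_left)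
  also have "\<dots> \<le> C * E * 2 ^ CARD('n)"
    using C E by (intro mult_left_mono sum_half_msize finite_msize) auto
  finally show ?thesis by (simp add: E_def mult_ac)
qed

text \<open>The homogeneous terms with degrees between \<open>p'\<close> and \<open>p\<close> are again of the form treated in
  \<open>taylor_term\<close>.\<close>

lemma taylor_change_degree:
  fixes b x :: "real ^ 'n::finite"
  assumes sc: "scales CARD('n) \<rho> m' c' t' m c t" and M: "0 < M" "M + 1 \<le> m' / 4"
    and p: "m' * c' * t' \<le> real p' + 2" "real p \<le> m * c * t" "p' \<le> p"
    and F: "\<And>\<gamma>. \<bar>F \<gamma> b\<bar> \<le> C * W m (msize \<gamma>)"
    and C: "C \<ge> 0" and x: "\<And>i. \<bar>x $ i - b $ i\<bar> \<le> \<rho>"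
  shows "\<bar>taylor p b F \<alpha> x - taylor p' b F \<alpha> x\<bar>
     \<le> C * 2 ^ CARD('n) * exp (- (m' / 4 * \<kappa> t')) * W M (msize \<alpha>)"
proof -
  define E where "E = exp (- (m' / 4 * \<kappa> t')) * W M (msize \<alpha>)"
  have E: "E \<ge> 0" using W_pos[OF M(1), of "msize \<alpha>"] by (simp add: E_def)
  have \<rho>: "\<rho> > 0" using sc by (simp add: scales_def)
  let ?S = "{\<gamma> :: 'n mindex. msize \<alpha> + msize \<gamma> \<le> p} - {\<gamma>. msize \<alpha> + msize \<gamma> \<le> p'}"
  have eq: "taylor p b F \<alpha> x - taylor p' b F \<alpha> x = (\<Sum>\<gamma>\<in>?S. dmono \<gamma> (x - b) * F (madd \<alpha> \<gamma>) b)"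
    unfolding taylor_def using p(3) by (subst sum_diff) (auto simp: finite_msize)
  have "\<bar>dmono \<gamma> (x - b) * F (madd \<alpha> \<gamma>) b\<bar> \<le> C * E * (1 / 2) ^ msize \<gamma>" if \<gamma>: "\<gamma> \<in> ?S" for \<gamma>
  proof -
    have Qz: "z ^ msize \<gamma> \<le> mfact \<gamma> * exp ((real CARD('n) + 1) * z)" if "z \<ge> 0" for z :: real
    proof -
      have "z ^ msize \<gamma> \<le> mfact \<gamma> * exp (real CARD('n) * z)" by (rule power_le_mfact_exp[OF that])
      also have "\<dots> \<le> mfact \<gamma> * exp ((real CARD('n) + 1) * z)"
        using that mfact_pos[of \<gamma>] by (intro mult_left_mono) (auto simp: distrib_right)
      finally show ?thesis .
    qed
    have "\<bar>dmono \<gamma> (x - b) * F (madd \<alpha> \<gamma>) b\<bar> \<le> (\<rho> ^ msize \<gamma> / mfact \<gamma>) * (C * W m (msize (madd \<alpha> \<gamma>)))"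
      unfolding abs_mult
    proof (intro mult_mono F)
      show "\<bar>dmono \<gamma> (x - b)\<bar> \<le> \<rho> ^ msize \<gamma> / mfact \<gamma>" by (rule abs_dmono_le) (simp add: x)
    qed (use \<rho> mfact_pos[of \<gamma>] in auto)
    also have "\<dots> = C * (W m (msize \<alpha> + msize \<gamma>) * (\<rho> ^ msize \<gamma> / mfact \<gamma>))" by (simp add: msize_madd)
    also have "\<dots> \<le> C * ((1 / 2) ^ msize \<gamma> * exp (- (m' / 4 * \<kappa> t')) * W M (msize \<alpha> + msize \<gamma> - msize \<gamma>))"
      using p \<gamma> by (intro mult_left_mono C taylor_term[OF sc M _ _ _ mfact_pos Qz]) auto
    also have "\<dots> = C * E * (1 / 2) ^ msize \<gamma>" by (simp add: E_def)
    finally show ?thesis .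
  qed
  then have "\<bar>taylor p b F \<alpha> x - taylor p' b F \<alpha> x\<bar> \<le> (\<Sum>\<gamma>\<in>?S. C * E * (1 / 2) ^ msize \<gamma>)"
    unfolding eq by (intro order_trans[OF sum_abs] sum_mono) auto
  also have "\<dots> = C * E * (\<Sum>\<gamma>\<in>?S. (1 / 2) ^ msize \<gamma>)" by (simp add: sum_distrib_left)
  also have "\<dots> \<le> C * E * 2 ^ CARD('n)"
    using C E by (intro mult_left_mono sum_half_msize finite_Diff finite_msize) auto
  finally show ?thesis by (simp add: E_def mult_ac)
qed

lemma taylor_beurling_smooth:
  fixes a :: "real ^ 'n::finite"
  shows "beurling_smooth (taylor p a F (\<lambda>_. 0))"
  unfolding beurling_smooth_def
proof (intro conjI allI impI)
  show "smooth (taylor p a F (\<lambda>_. 0))" by (rule taylor_smooth)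
  fix R m :: real assume m: "m > 0"
  define A where "A = {\<alpha> :: 'n mindex. msize \<alpha> \<le> p}"
  note cont = taylor_continuous[of p a F]
  have "\<exists>B. \<forall>x\<in>cball 0 R. \<bar>taylor p a F \<alpha> x\<bar> \<le> B" for \<alpha>
  proof -
    have "compact (taylor p a F \<alpha> ` cball 0 R)"
      by (intro compact_continuous_image continuous_on_subset[OF cont]) auto
    then have "bounded (taylor p a F \<alpha> ` cball 0 R)" by (rule compact_imp_bounded)
    then show ?thesis by (auto simp: bounded_iff)
  qed
  then obtain B where B: "\<And>\<alpha> x. x \<in> cball 0 R \<Longrightarrow> \<bar>taylor p a F \<alpha> x\<bar> \<le> B \<alpha>" by metis
  define C where "C = (\<Sum>\<alpha>\<in>A. \<bar>B \<alpha>\<bar> / W m (msize \<alpha>))"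
  have "derivs_le m (taylor p a F (\<lambda>_. 0)) x C" if x: "x \<in> ball 0 R" for x
  proof (rule derivs_leI)
    fix w :: "'n list"
    let ?\<alpha> = "count_list w"
    have nn: "0 \<le> \<bar>B \<alpha>\<bar> / W m (msize \<alpha>)" for \<alpha> using W_pos[OF m, of "msize \<alpha>"] by simp
    have C0: "C \<ge> 0" unfolding C_def by (intro sum_nonneg nn)
    show "\<bar>wderiv w (taylor p a F (\<lambda>_. 0)) x\<bar> \<le> C * W m (length w)"
    proof (cases "?\<alpha> \<in> A")
      case True
      have "\<bar>B ?\<alpha>\<bar> / W m (msize ?\<alpha>) \<le> C"
        unfolding C_def using True finite_msize_le[of p] nn
        by (intro member_le_sum[of _ A "\<lambda>\<alpha>. \<bar>B \<alpha>\<bar> / W m (msize \<alpha>)"]) (auto simp: A_def)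
      then have "\<bar>B ?\<alpha>\<bar> \<le> C * W m (length w)"
        using W_pos[OF m, of "length w"] by (simp add: length_eq_msize pos_divide_le_eq)
      then show ?thesis using B[of x ?\<alpha>] x by (simp add: taylor_smooth)
    next
      case False
      then have "taylor p a F ?\<alpha> x = 0" by (simp add: taylor_def A_def)
      then show ?thesis using C0 W_pos[OF m, of "length w"] by (simp add: taylor_smooth)
    qed
  qed
  then show "\<exists>C. \<forall>x\<in>ball 0 R. derivs_le m (taylor p a F (\<lambda>_. 0)) x C" by blast
qed

end

section \<open>The choice of scales and degrees\<close>

text \<open>Given arbitrary constants \<open>b k\<close> and a sequence \<open>X\<close> tending to infinity, one may pass to larger and
  larger \<open>k\<close> so slowly that the constants eventually stay below \<open>X\<close>.\<close>

lemma slow_sequence: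
  fixes b :: "nat \<Rightarrow> real" and X :: "nat \<Rightarrow> real"
  assumes X: "filterlim X at_top sequentially"
  shows "\<exists>v :: nat \<Rightarrow> nat. mono v \<and> (\<forall>J. v J \<ge> 1) \<and> filterlim v at_top sequentially \<and>
     eventually (\<lambda>J. b (v J) \<le> X J) sequentially"
proof -
  define S where "S J = {k. k \<le> J \<and> (\<forall>J'\<ge>J. \<forall>i\<le>k. b i \<le> X J')}" for J
  define v where "v J = Max (insert 1 (S J))" for J
  have fin: "finite (insert 1 (S J))" for J
    by (rule finite_subset[of _ "insert 1 {..J}"]) (auto simp: S_def)
  have Smono: "S J \<subseteq> S J'" if "J \<le> J'" for J J' using that by (auto simp: S_def)
  have ev: "\<exists>J0. \<forall>J\<ge>J0. k \<in> S J" for k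
  proof -
    have "eventually (\<lambda>J. \<forall>i\<in>{..k}. b i \<le> X J) sequentially"
      using X by (intro eventually_ball_finite) (auto simp: filterlim_at_top)
    then obtain J0 where "\<And>J i. J \<ge> J0 \<Longrightarrow> i \<le> k \<Longrightarrow> b i \<le> X J"
      unfolding eventually_sequentially by auto
    then have "\<forall>J\<ge>max J0 k. k \<in> S J" by (auto simp: S_def)
    then show ?thesis by blast
  qed
  have "mono v"
    unfolding v_def using Smono fin by (intro monoI Max_mono) auto
  moreover have "v J \<ge> 1" for J unfolding v_def using fin by (intro Max_ge) auto
  moreover have "filterlim v at_top sequentially"
    unfolding filterlim_at_top eventually_sequentially
  proof
    fix k
    obtain J0 where "\<forall>J\<ge>J0. k \<in> S J" using ev by blast
    then have "\<forall>J\<ge>J0. k \<le> v J" unfolding v_def using fin by (auto intro: Max_ge)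
    then show "\<exists>N. \<forall>n\<ge>N. k \<le> v n" by blast
  qed
  moreover have "eventually (\<lambda>J. b (v J) \<le> X J) sequentially"
  proof -
    obtain J0 where J0: "\<forall>J\<ge>J0. 1 \<in> S J" using ev by blast
    have "b (v J) \<le> X J" if "J \<ge> J0" for J
    proof -
      have eq: "insert 1 (S J) = S J" using J0 that by auto
      have "v J \<in> insert 1 (S J)" unfolding v_def by (rule Max_in[OF fin]) simp
      then have "v J \<in> S J" unfolding eq .
      then show ?thesis by (simp add: S_def)
    qed
    then show ?thesis unfolding eventually_sequentially by blast
  qed
  ultimately show ?thesis by blast
qed

context growth_weight
begin

text \<open>For large \<open>t\<close> all lower-order terms are dominated by \<open>\<kappa>(t)\<close>. The bound \<open>c t \<ge> 1\<close> holds because \<open>c t\<close> is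
  a subgradient of \<open>\<kappa> \<circ> exp\<close> at \<open>ln t\<close>, and \<open>\<kappa>(t)\<close> is at least \<open>2 ln t\<close>.\<close>

lemma touch_threshold:
  "\<exists>c0>0. \<forall>c. 0 < c \<and> c \<le> c0 \<longrightarrow> (\<exists>t. touch c t) \<and>
     (\<forall>t. touch c t \<longrightarrow> t \<ge> 1 \<and> \<kappa> t \<ge> 1 \<and> c * t \<ge> 1 \<and> (\<forall>s\<ge>t. s \<le> exp (\<kappa> s)))"
proof -
  obtain S where S: "S \<ge> 1" "\<And>s. s \<ge> S \<Longrightarrow> 2 * ln s \<le> \<kappa> s" using above_ln by blast
  \<comment> \<open>Beyond \<open>X\<close> one has \<open>\<kappa>(t) - \<kappa>(1) \<ge> 2 ln t - \<kappa>(1) \<ge> ln t\<close>.\<close>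
  define X where "X = max S (exp (\<kappa> 1 + 1))"
  have X1: "X \<ge> 1" "X \<ge> S" "X > 0" using S by (auto simp: X_def)
  obtain c0 where c0: "c0 > 0" "\<And>c. 0 < c \<Longrightarrow> c \<le> c0 \<Longrightarrow> (\<exists>t. touch c t) \<and> (\<forall>t. touch c t \<longrightarrow> t > X)"
    using touch_exists[OF X1(3)] by blast
  have "t \<ge> 1 \<and> \<kappa> t \<ge> 1 \<and> c * t \<ge> 1 \<and> (\<forall>s\<ge>t. s \<le> exp (\<kappa> s))"
    if c: "0 < c" "c \<le> c0" and tc: "touch c t" for c t
  proof -
    have tX: "t > X" using c0(2)[OF c] tc by blast
    have t1: "t \<ge> 1" using tX X1 by simp
    have "ln (exp (\<kappa> 1 + 1)) \<le> ln t" using tX t1 by (subst ln_le_cancel_iff) (auto simp: X_def)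
    then have lt: "\<kappa> 1 + 1 \<le> ln t" by simp
    have k1: "\<kappa> 1 \<ge> 0" by (rule nonneg) simp
    have kt: "2 * ln t \<le> \<kappa> t" using S(2) tX X1 by simp
    have "\<kappa> t + c * t * ln (1 / t) \<le> \<kappa> 1" using touch_ln[OF tc, of 1] by simp
    then have "\<kappa> t - \<kappa> 1 \<le> (c * t) * ln t" using t1 by (simp add: ln_div)
    then have "1 * ln t \<le> (c * t) * ln t" using kt lt by simp
    then have "1 \<le> c * t" using lt k1 by (subst (asm) mult_le_cancel_right) linarith
    moreover have "s \<le> exp (\<kappa> s)" if "s \<ge> t" for s
    proof -
      have "0 \<le> ln s" "2 * ln s \<le> \<kappa> s" using that t1 S(2)[of s] tX X1 by auto
      then have "exp (ln s) \<le> exp (\<kappa> s)" by simp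
      then show ?thesis using that t1 by simp
    qed
    ultimately show ?thesis using t1 kt lt k1 by auto
  qed
  then show ?thesis using c0 by blast
qed

text \<open>All parameters of the construction. Level \<open>J\<close> has the scale \<open>d / 2\<^sup>J\<close>, the weight parameter
  \<open>m = B v\<^sub>J\<close>, the slope \<open>c\<^sub>J\<close> with \<open>m c\<^sub>J = L d / 2\<^sup>J\<close>, the frequency \<open>t\<^sub>J\<close> at which a line of this
  slope touches, and the degree \<open>p\<^sub>J\<close>, which is the integer part of \<open>m c\<^sub>J t\<^sub>J\<close> minus \<open>1\<close>. The constant \<open>B\<close> is so
  large that the bumps of level \<open>J + 1\<close> with parameter \<open>v\<^sub>J\<close> cost little in comparison with the gain at
  level \<open>J\<close>.\<close>

lemma levels:
  fixes n :: nat and b :: "nat \<Rightarrow> real" and B :: real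
  assumes n: "n \<ge> 1" and B_def: "B = 12 * node_sum * (64 * real n * (real n + 1)) + 48 * real n + 8"
  obtains d c0 :: real and v p :: "nat \<Rightarrow> nat" and c t :: "nat \<Rightarrow> real" where
    "d > 0" "c0 > 0"
    "mono v" "\<And>J. v J \<ge> 1" "filterlim v at_top sequentially"
    "eventually (\<lambda>J. b (v (Suc J)) \<le> exp (\<kappa> (t J))) sequentially"
    "\<And>J. scales n (16 * real n * (d / 2 ^ Suc J)) (B * real (v J)) (c J) (t J) (B * real (v (Suc J))) (c (Suc J)) (t (Suc J))"
    "\<And>J. 2 ^ J \<le> c0 * t J" "\<And>J. \<kappa> (t J) \<ge> 1"
    "\<And>J. real (p J) + 1 \<le> B * real (v J) * c J * t J" "\<And>J. B * real (v J) * c J * t J \<le> real (p J) + 2"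
    "mono p" "filterlim p at_top sequentially"
    "\<And>J. 6 * node_sum * real (v J) * c J \<le> d / 2 ^ Suc J"
proof -
  define L where "L = 64 * real n * (real n + 1)"
  have L: "L > 0" using n by (simp add: L_def)
  have ZL: "0 \<le> 12 * node_sum * L" using node_sum_ge L by simp
  have B: "B \<ge> 48 * real n + 8" "B \<ge> 12 * node_sum * L" "B > 0" "B \<ge> 8" using ZL unfolding B_def L_def by linarith+
  obtain c0 where c0: "c0 > 0" "\<And>c. 0 < c \<Longrightarrow> c \<le> c0 \<Longrightarrow> \<exists>t. touch c t"
    "\<And>c t. 0 < c \<Longrightarrow> c \<le> c0 \<Longrightarrow> touch c t \<Longrightarrow> t \<ge> 1 \<and> \<kappa> t \<ge> 1 \<and> c * t \<ge> 1 \<and> (\<forall>s\<ge>t. s \<le> exp (\<kappa> s))"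
    using touch_threshold by blast
  define d where "d = B * c0 / L"
  have d: "d > 0" using B c0 L by (simp add: d_def)
  \<comment> \<open>\<open>X (Suc J)\<close> is a lower bound for \<open>exp (\<kappa> (t J))\<close> that does not depend on the sequence \<open>v\<close>, which is still to be chosen.\<close>
  define X where "X J = exp (\<kappa> (2 ^ (J - 1) / c0))" for J :: nat
  have X: "filterlim X at_top sequentially"
  proof -
    have "eventually (\<lambda>J. x \<le> X J) sequentially" for x
    proof -
      obtain Y where Y: "Y > 0" "\<kappa> Y > ln (\<bar>x\<bar> + 1)" using unbounded by blast
      obtain k where k: "Y * c0 < 2 ^ k" using real_arch_pow[of 2 "Y * c0"] by auto
      have "x \<le> X J" if "J \<ge> Suc k" for J
      proof -
        have "(2::real) ^ k \<le> 2 ^ (J - 1)" using that by (intro power_increasing) auto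
        then have "Y * c0 \<le> 2 ^ (J - 1)" using k by linarith
        then have "Y \<le> 2 ^ (J - 1) / c0" using c0(1) by (simp add: field_simps)
        then have "\<kappa> Y \<le> \<kappa> (2 ^ (J - 1) / c0)" by (intro mono Y)
        then have "exp (ln (\<bar>x\<bar> + 1)) \<le> exp (\<kappa> (2 ^ (J - 1) / c0))"
          using Y(2) by (subst exp_le_cancel_iff) linarith
        moreover have "exp (ln (\<bar>x\<bar> + 1)) = \<bar>x\<bar> + 1" by (rule exp_ln) simp
        ultimately show ?thesis unfolding X_def by linarith
      qed
      then show ?thesis unfolding eventually_sequentially by blast
    qed
    then show ?thesis unfolding filterlim_at_top by blast
  qed
  obtain v :: "nat \<Rightarrow> nat" where v: "Fun.mono v" "\<And>J. v J \<ge> 1" "filterlim v at_top sequentially"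
    "eventually (\<lambda>J. b (v J) \<le> X J) sequentially"
    using slow_sequence[OF X, of b] by blast
  define c where "c J = L * (d / 2 ^ J) / (B * real (v J))" for J
  have vpos: "real (v J) \<ge> 1" for J using v(2)[of J] by simp
  have cpos: "c J > 0" for J unfolding c_def using L d B vpos[of J] by simp
  have cd: "B * real (v J) * c J = L * (d / 2 ^ J)" for J
    unfolding c_def using B vpos[of J] by simp
  have cv: "real (v J) * c J = c0 / 2 ^ J" for J
    using cd[of J] B L by (simp add: d_def field_simps)
  have c_le: "c J \<le> c0 / 2 ^ J" for J
    using mult_right_mono[OF vpos[of J] less_imp_le[OF cpos[of J]]] cv[of J] by simp
  have c0J: "c0 / 2 ^ J \<le> c0" for J using c0(1) by (simp add: field_simps)
  have cc0: "c J \<le> c0" for J using c_le[of J] c0J[of J] by linarith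
  define t where "t J = (SOME s. touch (c J) s)" for J
  have tc: "touch (c J) (t J)" for J
    unfolding t_def by (rule someI_ex) (rule c0(2)[OF cpos cc0])
  note tt = c0(3)[OF cpos cc0 tc]
  have cdec: "c (Suc J) < c J" for J
  proof -
    have vle: "real (v J) \<le> real (v (Suc J))" using v(1) by (simp add: monoD)
    have "real (v J) * c (Suc J) \<le> real (v (Suc J)) * c (Suc J)"
      using vle cpos[of "Suc J"] by (intro mult_right_mono) auto
    also have "\<dots> < real (v J) * c J" unfolding cv using c0(1) by (simp add: field_simps)
    finally show ?thesis using vpos[of J] by simp
  qed
  have vm: "real (v J) \<le> real (v (Suc J))" for J using v(1) by (simp add: monoD)
  define K where "K J = B * real (v J) * c J * t J" for J
  have Kmono: "K J \<le> K (Suc J)" for J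
  proof -
    have ct: "c J * t J \<le> c (Suc J) * t (Suc J)" by (rule touch_mono(2)[OF tc tc cdec cpos])
    have Bm: "B * real (v J) \<le> B * real (v (Suc J))" using B vm[of J] by simp
    have "(B * real (v J)) * (c J * t J) \<le> (B * real (v (Suc J))) * (c (Suc J) * t (Suc J))"
      by (rule mult_mono[OF Bm ct]) (use B tt[of J] in auto)
    then show ?thesis by (simp add: K_def mult_ac)
  qed
  have Kv: "B * real (v J) \<le> K J" for J
  proof -
    have "(B * real (v J)) * 1 \<le> (B * real (v J)) * (c J * t J)"
      using tt[of J] B by (intro mult_left_mono) auto
    then show ?thesis by (simp add: K_def mult_ac)
  qed
  have Bv: "8 * 1 \<le> B * real (v J)" for J using B vpos[of J] by (intro mult_mono) auto
  define p where "p J = nat \<lfloor>K J\<rfloor> - 1" for J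
  have K8: "K J \<ge> 8" for J using Kv[of J] Bv[of J] by linarith
  have p: "real (p J) + 1 \<le> K J" "K J \<le> real (p J) + 2" for J
  proof -
    have "\<lfloor>K J\<rfloor> \<ge> 8" using K8[of J] by linarith
    then have "int (p J) + 1 = \<lfloor>K J\<rfloor>" unfolding p_def by arith
    then have "real_of_int (int (p J) + 1) = of_int \<lfloor>K J\<rfloor>" by (rule arg_cong)
    then have "real (p J) + 1 = of_int \<lfloor>K J\<rfloor>" by simp
    then show "real (p J) + 1 \<le> K J" "K J \<le> real (p J) + 2" by linarith+
  qed
  show ?thesis
  proof (rule that)
    show "d > 0" "c0 > 0" by (fact d c0)+
    show "Fun.mono v" "\<And>J. v J \<ge> 1" "filterlim v at_top sequentially" by (fact v)+
    show t2: "2 ^ J \<le> c0 * t J" for J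
    proof -
      have "1 \<le> c J * t J" using tt[of J] by blast
      also have "\<dots> \<le> c0 / 2 ^ J * t J" using c_le[of J] tt[of J] by (intro mult_right_mono) auto
      finally show ?thesis by (simp add: field_simps)
    qed
    show "\<kappa> (t J) \<ge> 1" for J using tt[of J] by blast
    show "eventually (\<lambda>J. b (v (Suc J)) \<le> exp (\<kappa> (t J))) sequentially"
    proof -
      have "eventually (\<lambda>J. b (v (Suc J)) \<le> X (Suc J)) sequentially"
        using v(4) by (rule eventually_sequentially_Suc[THEN iffD2])
      moreover have "X (Suc J) \<le> exp (\<kappa> (t J))" for J
        using t2[of J] c0(1) by (auto simp: X_def field_simps intro!: mono)
      ultimately show ?thesis by (auto elim!: eventually_mono intro: order_trans)
    qed
    show "real (p J) + 1 \<le> B * real (v J) * c J * t J" "B * real (v J) * c J * t J \<le> real (p J) + 2" for J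
      using p[of J] by (simp_all add: K_def)
    show "Fun.mono p"
    proof (rule mono_iff_le_Suc[THEN iffD2], intro allI)
      fix J show "p J \<le> p (Suc J)"
        unfolding p_def using Kmono[of J] by (intro diff_le_mono nat_mono floor_mono)
    qed
    show "filterlim p at_top sequentially"
    proof (rule filterlim_at_top_mono[OF v(3)], rule always_eventually, rule allI)
      fix J
      have "8 * real (v J) \<le> B * real (v J)" using B by (intro mult_right_mono) auto
      then have "real (v J) \<le> real (p J)" using Kv[of J] p(2)[of J] vpos[of J] by linarith
      then show "v J \<le> p J" by simp
    qed
    show "6 * node_sum * real (v J) * c J \<le> d / 2 ^ Suc J" for J
    proof -
      have "6 * node_sum * real (v J) * c J = 6 * node_sum * (real (v J) * c J)" by simp
      also have "\<dots> = 6 * node_sum * (c0 / 2 ^ J)" by (simp only: cv)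
      also have "\<dots> = (12 * node_sum * L) * (c0 / L) / 2 ^ Suc J" using L by simp
      also have "\<dots> \<le> B * (c0 / L) / 2 ^ Suc J"
        using B c0 L by (intro divide_right_mono mult_right_mono) auto
      finally show ?thesis by (simp add: d_def)
    qed
    show "scales n (16 * real n * (d / 2 ^ Suc J)) (B * real (v J)) (c J) (t J)
        (B * real (v (Suc J))) (c (Suc J)) (t (Suc J))" for J
    proof -
      have e: "4 * (real n + 1) * (16 * real n * X) = L * X" for X
        by (simp add: L_def algebra_simps)
      have h: "L * (d / 2 ^ Suc J) \<le> L * (d / 2 ^ J)"
        using L d by (intro mult_left_mono divide_left_mono) auto
      have "t J \<le> t (Suc J)" by (rule touch_mono(1)[OF tc tc cdec cpos])
      moreover have "B * real (v J) \<le> B * real (v (Suc J))" using B vm[of J] by simp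
      ultimately show ?thesis
        unfolding scales_def e cd using tc cpos tt[of J] h n d Bv[of J] by auto
    qed
  qed
qed

end

section \<open>The extension operator\<close>

definition bump :: "real \<Rightarrow> (nat \<Rightarrow> real \<Rightarrow> real) \<Rightarrow> bool" where
  "bump d \<psi> \<longleftrightarrow> deriv_chain \<psi> \<and> (\<forall>j x. \<bar>x\<bar> > d \<longrightarrow> \<psi> j x = 0) \<and>
     (\<forall>x K. finite K \<longrightarrow> (\<forall>k::int. \<bar>x - d * of_int k\<bar> \<le> d \<longrightarrow> k \<in> K) \<longrightarrow> (\<Sum>k\<in>K. \<psi> 0 (x - d * of_int k)) = 1)"

definition lattice_point :: "real \<Rightarrow> ('n::finite \<Rightarrow> int) \<Rightarrow> real ^ 'n" where
  "lattice_point d k = (\<chi> i. d * of_int (k i))"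

lemma dist_le_coords:
  fixes x y :: "real ^ 'n::finite"
  assumes "\<And>i. \<bar>x $ i - y $ i\<bar> \<le> \<rho>"
  shows "dist x y \<le> real CARD('n) * \<rho>"
proof -
  have "dist x y \<le> (\<Sum>i\<in>UNIV. \<bar>(x - y) $ i\<bar>)" unfolding dist_norm by (rule norm_le_l1_cart)
  also have "\<dots> \<le> (\<Sum>i\<in>(UNIV :: 'n set). \<rho>)" by (intro sum_mono) (simp add: assms)
  finally show ?thesis by simp
qed

lemma coords_le_dist:
  fixes x y :: "real ^ 'n::finite"
  shows "\<bar>x $ i - y $ i\<bar> \<le> dist x y"
  using component_le_norm_cart[of "x - y" i] by (simp add: dist_norm)

lemma near_dist:
  fixes x :: "real ^ 'n::finite"
  assumes "k \<in> near d \<rho> x"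
  shows "dist x (lattice_point d k) \<le> real CARD('n) * \<rho>"
  using assms by (intro dist_le_coords) (simp add: near_def lattice_point_def)

context growth_weight
begin

lemma bump_any:
  assumes d: "d > 0"
  shows "\<exists>\<psi>. bump d \<psi> \<and> (\<forall>m>0. \<exists>B. \<forall>j x. \<bar>\<psi> j x\<bar> \<le> B * W m j)"
proof -
  have le: "real 1 * node_sum \<le> d * max 1 (node_sum / d)" using d by (simp add: max_def field_simps)
  have t: "(1::real) \<le> max 1 (node_sum / d)" by simp
  obtain \<psi> where \<psi>: "\<And>k x. (\<psi> k has_field_derivative \<psi> (Suc k) x) (at x)"
    "\<And>k x. \<bar>x\<bar> > d \<Longrightarrow> \<psi> k x = 0"
    "\<And>x K. finite K \<Longrightarrow> (\<And>k::int. \<bar>x - d * of_int k\<bar> \<le> d \<Longrightarrow> k \<in> K) \<Longrightarrow> (\<Sum>k\<in>K. \<psi> 0 (x - d * of_int k)) = 1"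
    "\<And>k x. \<bar>\<psi> k x\<bar> \<le> 2 * (\<Prod>i<k. node (max 1 (node_sum / d)) 1 i)"
    using bump_exists[OF d t _ le] by auto
  have "\<exists>B. \<forall>j x. \<bar>\<psi> j x\<bar> \<le> B * W m j" if m: "m > 0" for m
  proof -
    obtain C where C: "\<And>k. (\<Prod>i<k. node (max 1 (node_sum / d)) 1 i) \<le> C * W m k"
      using prod_node_any[OF t _ m, of 1] by auto
    have "\<bar>\<psi> j x\<bar> \<le> (2 * C) * W m j" for j x using \<psi>(4)[of j x] C[of j] by simp
    then show ?thesis by blast
  qed
  moreover have "bump d \<psi>" unfolding bump_def deriv_chain_def using \<psi>(1-3) by blast
  ultimately show ?thesis by blast
qed

lemma bump_quantitative:
  assumes tc: "touch c t" "c > 0" and t: "t \<ge> 1" "\<kappa> t \<ge> 1" and M: "M \<ge> 1" and d: "d > 0"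
    and le: "6 * node_sum * M * c \<le> d"
  shows "\<exists>\<psi>. bump d \<psi> \<and> (\<forall>m>0. \<exists>B. \<forall>j x. \<bar>\<psi> j x\<bar> \<le> B * W m j) \<and>
     (\<forall>j x. \<bar>\<psi> j x\<bar> \<le> 2 * exp (6 * M * \<kappa> t) * W M j)"
proof -
  obtain \<tau> N where \<tau>: "\<tau> \<ge> 1" "N \<ge> 1" "real N * node_sum \<le> d * \<tau>" "2 * M * \<kappa> \<tau> \<le> real N" "real N \<le> 6 * M * \<kappa> t"
    using cutoff_parameters[OF assms] by blast
  obtain \<psi> where \<psi>: "\<And>k x. (\<psi> k has_field_derivative \<psi> (Suc k) x) (at x)"
    "\<And>k x. \<bar>x\<bar> > d \<Longrightarrow> \<psi> k x = 0"
    "\<And>x K. finite K \<Longrightarrow> (\<And>k::int. \<bar>x - d * of_int k\<bar> \<le> d \<Longrightarrow> k \<in> K) \<Longrightarrow> (\<Sum>k\<in>K. \<psi> 0 (x - d * of_int k)) = 1"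
    "\<And>k x. \<bar>\<psi> k x\<bar> \<le> 2 * (\<Prod>i<k. node \<tau> N i)"
    using bump_exists[OF d \<tau>(1-3)] by blast
  have "\<exists>B. \<forall>j x. \<bar>\<psi> j x\<bar> \<le> B * W m j" if m: "m > 0" for m
  proof -
    obtain C where C: "\<And>k. (\<Prod>i<k. node \<tau> N i) \<le> C * W m k"
      using prod_node_any[OF \<tau>(1,2) m] by auto
    have "\<bar>\<psi> j x\<bar> \<le> (2 * C) * W m j" for j x using \<psi>(4)[of j x] C[of j] by simp
    then show ?thesis by blast
  qed
  moreover have "\<bar>\<psi> j x\<bar> \<le> 2 * exp (6 * M * \<kappa> t) * W M j" for j x
  proof -
    have M0: "M > 0" using M by simp
    have "(2::real) ^ N \<le> exp 1 ^ N" using exp_ge_add_one_self[of 1] by (intro power_mono) auto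
    also have "\<dots> = exp (real N)" by (simp add: exp_of_nat_mult[symmetric])
    also have "\<dots> \<le> exp (6 * M * \<kappa> t)" using \<tau> by simp
    finally have e: "2 ^ N \<le> exp (6 * M * \<kappa> t)" .
    have "(\<Prod>i<j. node \<tau> N i) \<le> 2 ^ N * W M j" by (rule prod_node_large[OF \<tau>(1,2) M0 \<tau>(4)])
    also have "\<dots> \<le> exp (6 * M * \<kappa> t) * W M j" using e W_pos[OF M0, of j] by (intro mult_right_mono) auto
    finally show ?thesis using \<psi>(4)[of j x] by simp
  qed
  moreover have "bump d \<psi>" unfolding bump_def deriv_chain_def using \<psi>(1-3) by blast
  ultimately show ?thesis by blast
qed

end

text \<open>Here \<open>b k\<close> is a bound for the jet on the part of \<open>A\<close> in the ball of radius \<open>k\<close>, for the weight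
  parameter \<open>B k\<close>: the same index controls the ball and the class. The bumps \<open>\<psi> (Suc J)\<close> are built from the
  frequency \<open>t J\<close> of the preceding level, at which the gain for the differences between the levels \<open>J\<close> and
  \<open>Suc J\<close> is realised.\<close>

locale whitney_data = growth_weight +
  fixes A :: "(real ^ 'n::finite) set" and F :: "'n jet" and n :: nat
    and b :: "nat \<Rightarrow> real" and B d0 c0 :: real and v p :: "nat \<Rightarrow> nat" and c t :: "nat \<Rightarrow> real"
    and \<psi> :: "nat \<Rightarrow> nat \<Rightarrow> real \<Rightarrow> real"
  assumes n: "CARD('n) = n"
    and A: "closed A" "A \<noteq> {}"
    and b_nonneg: "\<And>k. b k \<ge> 0"
    and F_bound: "\<And>k x \<alpha>. k \<ge> 1 \<Longrightarrow> x \<in> A \<Longrightarrow> norm x \<le> real k \<Longrightarrow> \<bar>F \<alpha> x\<bar> \<le> b k * W (B * real k) (msize \<alpha>)"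
    and R_bound: "\<And>k x y q \<alpha>. k \<ge> 1 \<Longrightarrow> x \<in> A \<Longrightarrow> norm x \<le> real k \<Longrightarrow> y \<in> A \<Longrightarrow> norm y \<le> real k \<Longrightarrow> msize \<alpha> \<le> q \<Longrightarrow>
       \<bar>remainder q x F \<alpha> y\<bar> \<le> b k * W (B * real k) (q + 1) * (norm (x - y) ^ (q + 1 - msize \<alpha>) / fact (q + 1 - msize \<alpha>))"
    and B: "B \<ge> 48 * real n + 8" and d0: "d0 > 0" and c0: "c0 > 0"
    and v: "Fun.mono v" "\<And>J. v J \<ge> 1" "filterlim v at_top sequentially"
    and b_small: "eventually (\<lambda>J. b (v (Suc J)) \<le> exp (\<kappa> (t J))) sequentially"
    and scales: "\<And>J. scales n (16 * real n * (d0 / 2 ^ Suc J)) (B * real (v J)) (c J) (t J)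
        (B * real (v (Suc J))) (c (Suc J)) (t (Suc J))"
    and t_large: "\<And>J. 2 ^ J \<le> c0 * t J" and \<kappa>t: "\<And>J. \<kappa> (t J) \<ge> 1"
    and p: "\<And>J. real (p J) + 1 \<le> B * real (v J) * c J * t J" "\<And>J. B * real (v J) * c J * t J \<le> real (p J) + 2"
      "Fun.mono p" "filterlim p at_top sequentially"
    and bump: "\<And>J. bump (d0 / 2 ^ J) (\<psi> J)"
    and \<psi>_any: "\<And>J m. m > 0 \<Longrightarrow> \<exists>C. \<forall>j x. \<bar>\<psi> J j x\<bar> \<le> C * W m j"
    and \<psi>_bound: "\<And>J j x. \<bar>\<psi> (Suc J) j x\<bar> \<le> 2 * exp (6 * real (v J) * \<kappa> (t J)) * W (real (v J)) j"
begin

definition d :: "nat \<Rightarrow> real" where "d J = d0 / 2 ^ J"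

definition near' :: "nat \<Rightarrow> real ^ 'n \<Rightarrow> ('n \<Rightarrow> int) set" where "near' J x = near (d J) (d J) x"

definition base :: "nat \<Rightarrow> ('n \<Rightarrow> int) \<Rightarrow> real ^ 'n" where
  "base J k = closest_point A (lattice_point (d J) k)"

text \<open>The factor \<open>n + 1\<close> is large enough for every cell meeting the \<open>d J\<close>-neighbourhood of \<open>A\<close> to be
  active (\<open>near_active\<close>).\<close>

definition active :: "nat \<Rightarrow> ('n \<Rightarrow> int) set" where
  "active J = {k. dist (lattice_point (d J) k) (base J k) \<le> (real n + 1) * d J}"

definition \<phi> :: "nat \<Rightarrow> ('n \<Rightarrow> int) \<Rightarrow> real ^ 'n \<Rightarrow> real" where
  "\<phi> J k = lattice_bump (d J) (\<psi> J) k"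

definition local_taylor :: "nat \<Rightarrow> ('n \<Rightarrow> int) \<Rightarrow> real ^ 'n \<Rightarrow> real" where
  "local_taylor J k = taylor (p J) (base J k) F (\<lambda>_. 0)"

text \<open>The cells range over finite sets \<open>E\<close> and \<open>E'\<close>, which are taken constant near a given point when a
  derivative is computed.\<close>

definition increment_sum :: "nat \<Rightarrow> ('n \<Rightarrow> int) set \<Rightarrow> ('n \<Rightarrow> int) set \<Rightarrow> real ^ 'n \<Rightarrow> real" where
  "increment_sum J E E' x = (\<Sum>k\<in>E \<inter> active (Suc J). \<Sum>l\<in>E'. \<phi> (Suc J) k x * \<phi> J l x * (local_taylor (Suc J) k x - local_taylor J l x))"

text \<open>Only the finer cell \<open>k\<close> has to be close to \<open>A\<close>: if the supports of the two bumps meet, then the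
  coarser cell is close to \<open>A\<close> as well.\<close>

fun increment :: "nat \<Rightarrow> real ^ 'n \<Rightarrow> real" where
  "increment 0 x = (\<Sum>k\<in>near' 0 x \<inter> active 0. \<phi> 0 k x * local_taylor 0 k x)"
| "increment (Suc J) x = increment_sum J (near' (Suc J) x) (near' J x) x"

lemma n1: "real n \<ge> 1"
  using zero_less_card_finite[where 'a = 'n] unfolding n by simp

lemma d_pos: "d J > 0" and d_Suc: "d J = 2 * d (Suc J)"
  using d0 by (simp_all add: d_def)

lemma d_antimono: "i \<le> J \<Longrightarrow> d J \<le> d i"
  unfolding d_def using d0 by (intro divide_left_mono power_increasing) auto

lemma \<psi>_chain: "deriv_chain (\<psi> J)"
  and \<psi>_supp: "\<And>j x. \<bar>x\<bar> > d J \<Longrightarrow> \<psi> J j x = 0"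
  and \<psi>_sum: "\<And>x K. finite K \<Longrightarrow> (\<And>k::int. \<bar>x - d J * of_int k\<bar> \<le> d J \<Longrightarrow> k \<in> K) \<Longrightarrow>
      (\<Sum>k\<in>K. \<psi> J 0 (x - d J * of_int k)) = 1"
  using bump[of J] by (auto simp: bump_def d_def)

lemma \<phi>_beurling_smooth: "beurling_smooth (\<phi> J k)"
  unfolding \<phi>_def by (rule lattice_bump_beurling_smooth[OF \<psi>_chain \<psi>_any])

lemma local_taylor_beurling_smooth: "beurling_smooth (local_taylor J k)"
  unfolding local_taylor_def by (rule taylor_beurling_smooth)

lemma \<phi>_zero: "k \<notin> near' J x \<Longrightarrow> \<phi> J k x = 0"
  unfolding \<phi>_def near'_def by (rule lattice_bump_support[OF \<psi>_supp])

lemma \<phi>_nonzero: "\<phi> J k x \<noteq> 0 \<Longrightarrow> k \<in> near' J x"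
  using \<phi>_zero by blast

lemma near'_finite: "finite (near' J x)"
  unfolding near'_def by (rule near_finite[OF d_pos])

lemma \<phi>_sum: "near' J y \<subseteq> E \<Longrightarrow> finite E \<Longrightarrow> (\<Sum>k\<in>E. \<phi> J k y) = 1"
  unfolding \<phi>_def near'_def
  by (rule lattice_partition[where d = "d J" and \<psi> = "\<psi> J"]) (auto intro: d_pos \<psi>_sum \<psi>_supp)

lemma base_in: "base J k \<in> A"
  unfolding base_def by (rule closest_point_in_set[OF A])

lemma base_le: "a \<in> A \<Longrightarrow> dist (lattice_point (d J) k) (base J k) \<le> dist (lattice_point (d J) k) a"
  unfolding base_def by (rule closest_point_le[OF A(1)])

lemma increment_sum_extend:
  assumes "near' (Suc J) x \<subseteq> E" "near' J x \<subseteq> E'" "finite E" "finite E'"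
  shows "increment (Suc J) x = increment_sum J E E' x"
proof -
  have "increment_sum J E E' x = (\<Sum>k\<in>near' (Suc J) x \<inter> active (Suc J). \<Sum>l\<in>E'. \<phi> (Suc J) k x * \<phi> J l x * (local_taylor (Suc J) k x - local_taylor J l x))"
    unfolding increment_sum_def using assms by (intro sum.mono_neutral_right) (auto dest: \<phi>_nonzero intro!: sum.neutral)
  also have "\<dots> = (\<Sum>k\<in>near' (Suc J) x \<inter> active (Suc J). \<Sum>l\<in>near' J x. \<phi> (Suc J) k x * \<phi> J l x * (local_taylor (Suc J) k x - local_taylor J l x))"
    using assms by (intro sum.cong sum.mono_neutral_right) (auto dest: \<phi>_nonzero)
  finally show ?thesis by (simp add: increment_sum_def)
qed

lemma increment_sum_beurling_smooth: "beurling_smooth (increment_sum J E E')"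
  unfolding increment_sum_def[abs_def] by (intro beurling_smooth_sum beurling_smooth_mult beurling_smooth_diff \<phi>_beurling_smooth local_taylor_beurling_smooth)

lemma near_ball:
  assumes "norm x \<le> R"
  shows "near' J x \<subseteq> near (d J) (d J + R) 0"
  unfolding near'_def
proof (rule near_mono)
  show "\<bar>x $ i - 0 $ i\<bar> \<le> R" for i using component_le_norm_cart[of x i] assms by simp
qed simp

lemma increment_beurling_smooth: "beurling_smooth (increment J)"
proof (rule beurling_smooth_local)
  fix R
  show "\<exists>g. beurling_smooth g \<and> (\<forall>x\<in>ball 0 R. increment J x = g x)"
  proof (cases J)
    case 0
    let ?E = "near (d 0) (d 0 + R) 0"
    have "beurling_smooth (\<lambda>x. \<Sum>k\<in>?E \<inter> active 0. \<phi> 0 k x * local_taylor 0 k x)"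
      by (intro beurling_smooth_sum beurling_smooth_mult \<phi>_beurling_smooth local_taylor_beurling_smooth)
    moreover have "increment 0 x = (\<Sum>k\<in>?E \<inter> active 0. \<phi> 0 k x * local_taylor 0 k x)" if "x \<in> ball 0 R" for x
      using near_ball[of x R 0] that near_finite[OF d_pos]
      by (simp, intro sum.mono_neutral_left) (auto dest: \<phi>_nonzero)
    ultimately show ?thesis using 0 by blast
  next
    case (Suc I)
    have "increment J x = increment_sum I (near (d (Suc I)) (d (Suc I) + R) 0) (near (d I) (d I + R) 0) x" if "x \<in> ball 0 R" for x
      unfolding Suc using that by (intro increment_sum_extend near_ball near_finite d_pos) auto
    then show ?thesis using increment_sum_beurling_smooth by blast
  qed
qed

subsection \<open>Geometry\<close>

lemma active_near:
  assumes "k \<in> active J" "k \<in> near (d J) (2 * d J) x"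
  shows "dist x (base J k) \<le> (3 * real n + 1) * d J"
proof -
  have "dist x (base J k) \<le> dist x (lattice_point (d J) k) + dist (lattice_point (d J) k) (base J k)"
    by (rule dist_triangle)
  also have "\<dots> \<le> real n * (2 * d J) + (real n + 1) * d J"
    using near_dist[OF assms(2)] assms(1) by (simp add: active_def n)
  finally show ?thesis by (simp add: algebra_simps)
qed

lemma base_near:
  assumes "k \<in> near (d J) (2 * d J) x" "a \<in> A"
  shows "dist x (base J k) \<le> 4 * real n * d J + dist x a"
proof -
  have "dist x (base J k) \<le> dist x (lattice_point (d J) k) + dist (lattice_point (d J) k) (base J k)"
    by (rule dist_triangle)
  also have "\<dots> \<le> dist x (lattice_point (d J) k) + dist (lattice_point (d J) k) a"
    using base_le[OF assms(2)] by simp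
  also have "\<dots> \<le> dist x (lattice_point (d J) k) + (dist x (lattice_point (d J) k) + dist x a)"
    using dist_triangle2[of "lattice_point (d J) k" a x] by (simp add: dist_commute)
  also have "\<dots> \<le> 4 * real n * d J + dist x a" using near_dist[OF assms(1)] by (simp add: n)
  finally show ?thesis .
qed

lemma near_active:
  assumes "a \<in> A" "dist y a < d J" "k \<in> near' J y"
  shows "k \<in> active J"
proof -
  have "dist y (lattice_point (d J) k) \<le> real n * d J" using assms(3) near_dist[of k "d J" "d J" y] by (simp add: near'_def n)
  moreover have "dist (lattice_point (d J) k) (base J k) \<le> dist (lattice_point (d J) k) a" by (rule base_le[OF assms(1)])
  moreover have "dist (lattice_point (d J) k) a \<le> dist y (lattice_point (d J) k) + dist y a"
    using dist_triangle2[of "lattice_point (d J) k" a y] by (simp add: dist_commute)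
  ultimately show ?thesis using assms(2) by (simp add: active_def algebra_simps)
qed

lemma near'_ball:
  assumes "dist x y < d J"
  shows "near' J y \<subseteq> near (d J) (2 * d J) x"
  unfolding near'_def
proof (rule near_mono)
  show "\<bar>y $ i - x $ i\<bar> \<le> d J" for i using coords_le_dist[of y i x] assms by (simp add: dist_commute)
qed simp

subsection \<open>Estimates for the increments\<close>

lemma \<phi>_derivs_le:
  assumes "0 < m" "m \<le> real (v J)"
  shows "derivs_le m (\<phi> (Suc J) k) x ((2 * exp (6 * real (v J) * \<kappa> (t J))) ^ n)"
proof -
  have v0: "0 < real (v J)" using v(2)[of J] by simp
  have "derivs_le (real (v J)) (\<phi> (Suc J) k) x ((2 * exp (6 * real (v J) * \<kappa> (t J))) ^ n)"
    unfolding \<phi>_def by (rule lattice_bump_derivs_le[where 'n = 'n, OF \<psi>_chain \<psi>_bound v0, unfolded n])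
  from derivs_le_antimono[OF this assms order_refl] show ?thesis .
qed

lemma vm: "i \<le> j \<Longrightarrow> real (v i) \<le> real (v j)"
  using v(1) by (simp add: monoD)

lemma tm: "t J \<le> t (Suc J)" "t J \<ge> 1"
  using scales[of J] by (simp_all add: scales_def)

text \<open>The size of the differences of Taylor polynomials at level \<open>J\<close>.\<close>

definition taylor_gap :: "nat \<Rightarrow> real" where
  "taylor_gap J = b (v (Suc J)) * 2 ^ n * exp (- (B * real (v J) / 4 * \<kappa> (t J)))"

lemma taylor_move:
  assumes a: "a \<in> A" "a' \<in> A" "norm a \<le> real (v (Suc J))" "norm a' \<le> real (v (Suc J))"
    and x: "dist x a \<le> 16 * real n * d (Suc J)" and aa: "dist a a' \<le> 16 * real n * d (Suc J)"
    and M: "0 < M" "M \<le> real (v J)"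
  shows "\<bar>taylor (p (Suc J)) a F \<alpha> x - taylor (p (Suc J)) a' F \<alpha> x\<bar> \<le> taylor_gap J * W M (msize \<alpha>)"
proof -
  let ?p = "p (Suc J)"
  have M4: "M + 1 \<le> B * real (v J) / 4"
  proof -
    have "8 * real (v J) \<le> B * real (v J)" using B n1 by (intro mult_right_mono) auto
    moreover have "real (v J) \<ge> 1" using v(2)[of J] by simp
    ultimately show ?thesis using M by linarith
  qed
  have "p J \<le> p (Suc J)" using p(3) by (simp add: monoD)
  then have p1: "B * real (v J) * c J * t J \<le> real ?p + 2" using p(2)[of J] by simp
  have v1: "v (Suc J) \<ge> 1" by (rule v(2))
  have "\<bar>taylor ?p a F \<alpha> x - taylor ?p a' F \<alpha> x\<bar>
     \<le> b (v (Suc J)) * 2 ^ n * exp (- (B * real (v J) / 4 * \<kappa> (t J))) * W M (msize \<alpha>)"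
  proof (rule taylor_move_base[where 'n = 'n, unfolded n, OF scales M(1) M4 p1 p(1)])
    fix \<gamma> :: "'n mindex" assume \<gamma>: "msize \<gamma> \<le> ?p"
    have w: "0 \<le> b (v (Suc J)) * W (B * real (v (Suc J))) (?p + 1)"
      using b_nonneg W_pos[of "B * real (v (Suc J))" "?p + 1"] B n1 v1
      by (intro mult_nonneg_nonneg) (auto intro!: less_imp_le)
    have "\<bar>remainder ?p a' F \<gamma> a\<bar> \<le> b (v (Suc J)) * W (B * real (v (Suc J))) (?p + 1) *
        (norm (a' - a) ^ (?p + 1 - msize \<gamma>) / fact (?p + 1 - msize \<gamma>))"
      by (rule R_bound[OF v1 a(2,4,1,3) \<gamma>])
    also have "\<dots> \<le> b (v (Suc J)) * W (B * real (v (Suc J))) (?p + 1) *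
        ((16 * real n * (d0 / 2 ^ Suc J)) ^ (?p + 1 - msize \<gamma>) / fact (?p + 1 - msize \<gamma>))"
      using aa by (intro mult_left_mono[OF _ w] divide_right_mono power_mono)
        (auto simp: dist_norm norm_minus_commute d_def)
    finally show "\<bar>remainder ?p a' F \<gamma> a\<bar> \<le> b (v (Suc J)) * W (B * real (v (Suc J))) (?p + 1) *
        ((16 * real n * (d0 / 2 ^ Suc J)) ^ (?p + 1 - msize \<gamma>) / fact (?p + 1 - msize \<gamma>))" .
  next
    show "\<bar>x $ i - a $ i\<bar> \<le> 16 * real n * (d0 / 2 ^ Suc J)" for i
      using coords_le_dist[of x i a] x by (simp add: d_def)
  qed (rule b_nonneg)
  then show ?thesis by (simp add: taylor_gap_def)
qed

lemma taylor_degree: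
  assumes a: "a \<in> A" "norm a \<le> real (v (Suc J))"
    and x: "dist x a \<le> 16 * real n * d (Suc J)" and M: "0 < M" "M \<le> real (v J)"
  shows "\<bar>taylor (p (Suc J)) a F \<alpha> x - taylor (p J) a F \<alpha> x\<bar> \<le> taylor_gap J * W M (msize \<alpha>)"
proof -
  have M4: "M + 1 \<le> B * real (v J) / 4"
  proof -
    have "8 * real (v J) \<le> B * real (v J)" using B n1 by (intro mult_right_mono) auto
    moreover have "real (v J) \<ge> 1" using v(2)[of J] by simp
    ultimately show ?thesis using M by linarith
  qed
  have pp: "p J \<le> p (Suc J)" using p(3) by (simp add: monoD)
  have p1: "real (p (Suc J)) \<le> B * real (v (Suc J)) * c (Suc J) * t (Suc J)" using p(1)[of "Suc J"] by simp
  have "\<bar>taylor (p (Suc J)) a F \<alpha> x - taylor (p J) a F \<alpha> x\<bar>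
     \<le> b (v (Suc J)) * 2 ^ n * exp (- (B * real (v J) / 4 * \<kappa> (t J))) * W M (msize \<alpha>)"
  proof (rule taylor_change_degree[where 'n = 'n, unfolded n, OF scales M(1) M4 p(2) p1 pp])
    show "\<bar>F \<gamma> a\<bar> \<le> b (v (Suc J)) * W (B * real (v (Suc J))) (msize \<gamma>)" for \<gamma>
      by (rule F_bound[OF v(2) a])
    show "\<bar>x $ i - a $ i\<bar> \<le> 16 * real n * (d0 / 2 ^ Suc J)" for i
      using coords_le_dist[of x i a] x by (simp add: d_def)
  qed (rule b_nonneg)
  then show ?thesis by (simp add: taylor_gap_def)
qed

lemma taylor_gap_nonneg: "0 \<le> taylor_gap J"
  unfolding taylor_gap_def using b_nonneg by simp

text \<open>Here the gain meets the cost: the exponential on the left is the cost of a product of two bumps,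
  and the choice of \<open>B\<close> leaves a surplus \<open>exp(- \<kappa>(t J))\<close>, which is at most \<open>1 / t J\<close>.\<close>

lemma taylor_gap_small:
  assumes "b (v (Suc J)) \<le> exp (\<kappa> (t J))"
  shows "exp (12 * real n * real (v J) * \<kappa> (t J)) * taylor_gap J \<le> 2 ^ n * (c0 / 2 ^ J)"
proof -
  define K where "K = \<kappa> (t J)"
  have K: "K \<ge> 1" using \<kappa>t by (simp add: K_def)
  have v1: "real (v J) \<ge> 1" using v(2)[of J] by simp
  have "exp (12 * real n * real (v J) * K) * taylor_gap J
      \<le> exp (12 * real n * real (v J) * K) * (exp K * 2 ^ n * exp (- (B * real (v J) / 4 * K)))"
    unfolding taylor_gap_def using assms by (intro mult_left_mono mult_right_mono) (auto simp: K_def)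
  also have "\<dots> = 2 ^ n * exp ((12 * real n * real (v J) + 1 - B * real (v J) / 4) * K)"
    by (simp add: algebra_simps flip: exp_add)
  also have "\<dots> \<le> 2 ^ n * exp (- K)"
  proof -
    have "(48 * real n + 8) * real (v J) \<le> B * real (v J)" using B by (intro mult_right_mono) auto
    then have "12 * real n * real (v J) + 1 - B * real (v J) / 4 \<le> - 1" using v1 by (simp add: algebra_simps)
    then have "(12 * real n * real (v J) + 1 - B * real (v J) / 4) * K \<le> (- 1) * K"
      using K by (intro mult_right_mono) auto
    then show ?thesis by simp
  qed
  also have "exp (- K) \<le> 1 / t J"
  proof -
    have "t J \<le> exp K" unfolding K_def using scales[of J] by (simp add: scales_def)
    then show ?thesis using tm(2)[of J] by (simp add: exp_minus field_simps)
  qed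
  also have "1 / t J \<le> c0 / 2 ^ J" using t_large[of J] tm(2)[of J] by (simp add: field_simps)
  finally show ?thesis by (simp add: K_def)
qed

definition decay_const :: real where "decay_const = 25 ^ n * 4 ^ n * 2 * 2 ^ n * c0"

text \<open>At most \<open>25\<^sup>n\<close> pairs of cells contribute at \<open>x\<close>. For each of them the base points and \<open>x\<close> are
  within distance \<open>16 n d\<close> of each other, where \<open>d\<close> is the finer scale, so the change of the Taylor polynomial is controlled by first
  moving the base point and then lowering the degree.\<close>

lemma increment_derivs_le:
  assumes bs: "b (v (Suc (Suc J))) \<le> exp (\<kappa> (t (Suc J)))"
    and R: "norm x + 16 * real n * d0 \<le> real (v (Suc (Suc J)))"
  shows "derivs_le (real (v J) / 4) (increment (Suc (Suc J))) x (decay_const / 2 ^ Suc J)"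
proof -
  let ?E = "near (d (Suc (Suc J))) (2 * d (Suc (Suc J))) x" and ?E' = "near (d (Suc J)) (2 * d (Suc J)) x"
  let ?M = "real (v J)"
  have M: "?M > 0" using v(2)[of J] by simp
  define P where "P J = (2 * exp (6 * real (v J) * \<kappa> (t J))) ^ n" for J
  have P0: "P J \<ge> 0" for J by (simp add: P_def)
  define e where "e = d (Suc (Suc J))"
  have e: "e > 0" "d (Suc J) = 2 * e" using d_pos[of "Suc (Suc J)"] d_Suc[of "Suc J"] by (simp_all add: e_def)
  have ed0: "e \<le> d0" using d_antimono[of 0 "Suc (Suc J)"] by (simp add: e_def d_def)
  have ne: "e \<le> real n * e" using n1 e by simp
  have term_derivs_le: "derivs_le (?M / 4) (\<lambda>x. \<phi> (Suc (Suc J)) k x * \<phi> (Suc J) l x * (local_taylor (Suc (Suc J)) k x - local_taylor (Suc J) l x)) x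
      (P (Suc J) * P J * (2 * taylor_gap (Suc J)))"
    if k: "k \<in> ?E \<inter> active (Suc (Suc J))" and l: "l \<in> ?E'" for k l
  proof -
    let ?a = "base (Suc (Suc J)) k" and ?a' = "base (Suc J) l"
    \<comment> \<open>The finer cell is active, hence its base point is close to \<open>x\<close>; this bounds the distance from \<open>x\<close> to \<open>A\<close> and thereby the distance to the base point of the coarser cell.\<close>
    have xa: "dist x ?a \<le> (3 * real n + 1) * e" unfolding e_def using k by (intro active_near) auto
    have xa': "dist x ?a' \<le> 4 * real n * (2 * e) + (3 * real n + 1) * e"
      using base_near[OF l base_in[of "Suc (Suc J)" k]] xa e(2) by simp
    have aa: "dist ?a ?a' \<le> dist x ?a + dist x ?a'" by (rule dist_triangle3)
    have nn: "0 \<le> real n * e" using e n1 by simp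
    have 1: "dist x ?a \<le> 16 * real n * e" using xa ne nn by (simp add: algebra_simps)
    have 2: "dist x ?a' \<le> 16 * real n * e" using xa' ne nn by (simp add: algebra_simps)
    have 3: "dist ?a ?a' \<le> 16 * real n * e" using aa xa xa' ne nn by (simp add: algebra_simps)
    have "16 * real n * e \<le> 16 * real n * d0" using ed0 n1 by simp
    then have rad: "norm ?a \<le> real (v (Suc (Suc J)))" "norm ?a' \<le> real (v (Suc (Suc J)))"
      using R 1 2 norm_triangle_sub[of ?a x] norm_triangle_sub[of ?a' x]
      by (auto simp: dist_norm norm_minus_commute)
    have pt: "derivs_le ?M (\<lambda>x. local_taylor (Suc (Suc J)) k x - local_taylor (Suc J) l x) x (2 * taylor_gap (Suc J))"
    proof (rule derivs_leI)
      fix w :: "'n list"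
      let ?\<alpha> = "count_list w"
      have "\<bar>taylor (p (Suc (Suc J))) ?a F ?\<alpha> x - taylor (p (Suc (Suc J))) ?a' F ?\<alpha> x\<bar> \<le> taylor_gap (Suc J) * W ?M (msize ?\<alpha>)"
        using 1 3 M by (intro taylor_move base_in rad vm) (auto simp: e_def)
      moreover have "\<bar>taylor (p (Suc (Suc J))) ?a' F ?\<alpha> x - taylor (p (Suc J)) ?a' F ?\<alpha> x\<bar> \<le> taylor_gap (Suc J) * W ?M (msize ?\<alpha>)"
        using 2 M by (intro taylor_degree base_in rad vm) (auto simp: e_def)
      ultimately have "\<bar>taylor (p (Suc (Suc J))) ?a F ?\<alpha> x - taylor (p (Suc J)) ?a' F ?\<alpha> x\<bar> \<le> 2 * taylor_gap (Suc J) * W ?M (length w)"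
        unfolding length_eq_msize[of w] by linarith
      then show "\<bar>wderiv w (\<lambda>x. local_taylor (Suc (Suc J)) k x - local_taylor (Suc J) l x) x\<bar> \<le> 2 * taylor_gap (Suc J) * W ?M (length w)"
        by (simp add: smooth_diff(2)[OF local_taylor_beurling_smooth[THEN beurling_smooth_smooth] local_taylor_beurling_smooth[THEN beurling_smooth_smooth]])
          (simp add: local_taylor_def taylor_smooth)
    qed
    have f1: "derivs_le (?M / 2) (\<lambda>x. \<phi> (Suc (Suc J)) k x * \<phi> (Suc J) l x) x (P (Suc J) * P J)"
      unfolding P_def by (intro derivs_le_mult \<phi>_beurling_smooth[THEN beurling_smooth_smooth] \<phi>_derivs_le M order_refl vm) auto
    have f2: "derivs_le (?M / 2) (\<lambda>x. local_taylor (Suc (Suc J)) k x - local_taylor (Suc J) l x) x (2 * taylor_gap (Suc J))"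
      using M by (intro derivs_le_antimono[OF pt]) auto
    have "derivs_le (?M / 2 / 2) (\<lambda>x. (\<phi> (Suc (Suc J)) k x * \<phi> (Suc J) l x) * (local_taylor (Suc (Suc J)) k x - local_taylor (Suc J) l x)) x
        ((P (Suc J) * P J) * (2 * taylor_gap (Suc J)))"
      using M by (intro derivs_le_mult[OF _ f1 _ f2] beurling_smooth_smooth beurling_smooth_diff beurling_smooth_mult \<phi>_beurling_smooth local_taylor_beurling_smooth) auto
    then show ?thesis by simp
  qed
  let ?C = "P (Suc J) * P J * (2 * taylor_gap (Suc J))"
  have C0: "?C \<ge> 0" using P0 taylor_gap_nonneg by simp
  have "derivs_le (?M / 4) (increment_sum (Suc J) ?E ?E') x (\<Sum>k\<in>?E \<inter> active (Suc (Suc J)). \<Sum>l\<in>?E'. ?C)"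
    unfolding increment_sum_def[abs_def]
    by (intro derivs_le_sum beurling_smooth_smooth beurling_smooth_sum beurling_smooth_mult beurling_smooth_diff \<phi>_beurling_smooth local_taylor_beurling_smooth term_derivs_le)
  then have "derivs_le (?M / 4) (increment (Suc (Suc J))) x (\<Sum>k\<in>?E \<inter> active (Suc (Suc J)). \<Sum>l\<in>?E'. ?C)"
  proof (rule derivs_le_local[rotated 3])
    show "open (ball x e)" "x \<in> ball x e" using e by auto
    fix y assume y: "y \<in> ball x e"
    show "increment (Suc (Suc J)) y = increment_sum (Suc J) ?E ?E' y"
      using y e by (intro increment_sum_extend near'_ball near_finite d_pos) (auto simp: e_def)
  qed
  moreover have "(\<Sum>k\<in>?E \<inter> active (Suc (Suc J)). \<Sum>l\<in>?E'. ?C) \<le> decay_const / 2 ^ Suc J"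
  proof -
    have card: "real (card ?E) \<le> 5 ^ n" "real (card ?E') \<le> 5 ^ n"
      using of_nat_mono[OF near_card[OF d_pos, of "Suc (Suc J)" x], where 'a = real]
        of_nat_mono[OF near_card[OF d_pos, of "Suc J" x], where 'a = real] by (simp_all add: n)
    have "real (card (?E \<inter> active (Suc (Suc J)))) \<le> real (card ?E)"
      using near_finite[OF d_pos] by (intro of_nat_mono card_mono) auto
    then have cardX: "real (card (?E \<inter> active (Suc (Suc J)))) \<le> 5 ^ n" using card(1) by linarith
    have "(\<Sum>k\<in>?E \<inter> active (Suc (Suc J)). \<Sum>l\<in>?E'. ?C)
        = real (card (?E \<inter> active (Suc (Suc J)))) * (real (card ?E') * ?C)" by simp
    also have "\<dots> \<le> 5 ^ n * (5 ^ n * ?C)"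
      by (rule mult_mono[OF cardX mult_right_mono[OF card(2) C0]]) (use C0 in auto)
    finally have sum_le: "(\<Sum>k\<in>?E \<inter> active (Suc (Suc J)). \<Sum>l\<in>?E'. ?C) \<le> 5 ^ n * (5 ^ n * ?C)" .
    have PP: "P (Suc J) * P J \<le> 4 ^ n * exp (12 * real n * real (v (Suc J)) * \<kappa> (t (Suc J)))"
    proof -
      have "real (v J) * \<kappa> (t J) \<le> real (v (Suc J)) * \<kappa> (t (Suc J))"
        using vm[of J "Suc J"] mono[of "t J" "t (Suc J)"] tm[of J] \<kappa>t[of J] by (intro mult_mono) auto
      then have "P J \<le> P (Suc J)" unfolding P_def by (intro power_mono mult_left_mono) auto
      then have "P (Suc J) * P J \<le> P (Suc J) * P (Suc J)" using P0 by (intro mult_left_mono) auto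
      also have "\<dots> = (4 * exp (12 * real (v (Suc J)) * \<kappa> (t (Suc J)))) ^ n"
      proof -
        have "2 * exp (6 * y) * (2 * exp (6 * y)) = 4 * exp (12 * y)" for y :: real
          by (simp flip: exp_add)
        from this[of "real (v (Suc J)) * \<kappa> (t (Suc J))"] show ?thesis
          unfolding P_def power_mult_distrib[symmetric] by (simp only: mult.assoc)
      qed
      also have "\<dots> = 4 ^ n * exp (12 * real n * real (v (Suc J)) * \<kappa> (t (Suc J)))"
        by (simp add: power_mult_distrib exp_of_nat_mult[symmetric] mult_ac)
      finally show ?thesis .
    qed
    note sum_le
    also have "5 ^ n * (5 ^ n * ?C)
        \<le> 5 ^ n * (5 ^ n * (4 ^ n * exp (12 * real n * real (v (Suc J)) * \<kappa> (t (Suc J))) * (2 * taylor_gap (Suc J))))"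
      using taylor_gap_nonneg by (intro mult_left_mono mult_right_mono PP) auto
    also have "\<dots> = 25 ^ n * 4 ^ n * 2 * (exp (12 * real n * real (v (Suc J)) * \<kappa> (t (Suc J))) * taylor_gap (Suc J))"
      by (simp add: power_mult_distrib[symmetric])
    also have "\<dots> \<le> 25 ^ n * 4 ^ n * 2 * (2 ^ n * (c0 / 2 ^ Suc J))"
      by (intro mult_left_mono taylor_gap_small bs) auto
    also have "\<dots> = decay_const / 2 ^ Suc J" by (simp add: decay_const_def)
    finally show ?thesis .
  qed
  ultimately show ?thesis using M by (intro derivs_le_antimono[of _ _ _ _ "?M / 4"]) auto
qed

end

context whitney_data
begin

subsection \<open>The extension\<close>

definition extension :: "real ^ 'n \<Rightarrow> real" where "extension x = (\<Sum>j. increment j x)"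

lemma increment_smooth: "smooth (increment j)"
  using increment_beurling_smooth beurling_smooth_smooth by blast

text \<open>The parameters of \<open>increment_derivs_le\<close> tend to infinity with the level, so from some level on
  they cover any given ball and any given \<open>m\<close>.\<close>

lemma increment_decay:
  assumes m: "m > 0"
  shows "\<exists>J. \<forall>j\<ge>J. \<forall>x\<in>cball 0 R. derivs_le m (increment j) x (2 * decay_const * (1 / 2) ^ j)"
proof -
  have "eventually (\<lambda>J. b (v (Suc (Suc J))) \<le> exp (\<kappa> (t (Suc J)))) sequentially"
    using b_small by (rule eventually_sequentially_Suc[THEN iffD2])
  moreover have "eventually (\<lambda>J. nat \<lceil>max (R + 16 * real n * d0) (4 * m)\<rceil> \<le> v J) sequentially"
    using v(3) unfolding filterlim_at_top by (rule spec)
  ultimately have "eventually (\<lambda>J. \<forall>x\<in>cball 0 R. derivs_le m (increment (Suc (Suc J))) x (2 * decay_const * (1 / 2) ^ Suc (Suc J))) sequentially"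
  proof eventually_elim
    case (elim J)
    have vJ: "R + 16 * real n * d0 \<le> real (v J)" "4 * m \<le> real (v J)" using elim(2) by linarith+
    show ?case
    proof
      fix x :: "real ^ 'n" assume x: "x \<in> cball 0 R"
      have "norm x + 16 * real n * d0 \<le> real (v (Suc (Suc J)))"
        using vJ(1) x vm[of J "Suc (Suc J)"] by simp
      from increment_derivs_le[OF elim(1) this]
      have "derivs_le (real (v J) / 4) (increment (Suc (Suc J))) x (decay_const / 2 ^ Suc J)" .
      then show "derivs_le m (increment (Suc (Suc J))) x (2 * decay_const * (1 / 2) ^ Suc (Suc J))"
        by (rule derivs_le_antimono) (use m vJ in \<open>auto simp: power_one_over\<close>)
    qed
  qed
  then obtain J0 where J0: "\<forall>J\<ge>J0. \<forall>x\<in>cball 0 R. derivs_le m (increment (Suc (Suc J))) x (2 * decay_const * (1 / 2) ^ Suc (Suc J))"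
    unfolding eventually_sequentially by (elim exE)
  have "derivs_le m (increment j) x (2 * decay_const * (1 / 2) ^ j)" if j: "j \<ge> Suc (Suc J0)" and x: "x \<in> cball 0 R" for j x
  proof -
    obtain J where "j = Suc (Suc J)" "J \<ge> J0" using j by (metis Suc_le_D Suc_le_mono)
    then show ?thesis using J0 x by blast
  qed
  then show ?thesis by blast
qed

lemma increment_summable_bound:
  "\<exists>B J. summable B \<and> (\<forall>j\<ge>J. \<forall>x\<in>cball 0 R. \<bar>wderiv w (increment j) x\<bar> \<le> B j)"
proof -
  obtain J where J: "\<forall>j\<ge>J. \<forall>x\<in>cball 0 R. derivs_le 1 (increment j) x (2 * decay_const * (1 / 2) ^ j)" using increment_decay[of 1 R] by auto
  have "summable (\<lambda>j. 2 * decay_const * (1 / 2) ^ j * W 1 (length w))"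
    by (intro summable_mult2 summable_mult summable_geometric) simp
  moreover have "\<forall>j\<ge>J. \<forall>x\<in>cball 0 R. \<bar>wderiv w (increment j) x\<bar> \<le> 2 * decay_const * (1 / 2) ^ j * W 1 (length w)"
    using J derivs_leD by blast
  ultimately show ?thesis by blast
qed

lemma extension_smooth: "smooth extension"
  and extension_wderiv: "wderiv w extension = (\<lambda>x. \<Sum>j. wderiv w (increment j) x)"
  and extension_summable: "summable (\<lambda>j. wderiv w (increment j) x)"
proof -
  have e: "extension = (\<lambda>x. \<Sum>j. increment j x)" by (rule ext) (simp add: extension_def)
  show "smooth extension" "wderiv w extension = (\<lambda>x. \<Sum>j. wderiv w (increment j) x)" "summable (\<lambda>j. wderiv w (increment j) x)"
    unfolding e by (rule smooth_series[of increment, OF increment_smooth increment_summable_bound])+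
qed

lemma extension_beurling_smooth: "beurling_smooth extension"
  unfolding beurling_smooth_def
proof (intro conjI allI impI extension_smooth)
  fix R m :: real assume m: "m > 0"
  obtain J where J: "\<forall>j\<ge>J. \<forall>x\<in>cball 0 R. derivs_le m (increment j) x (2 * decay_const * (1 / 2) ^ j)" using increment_decay[OF m, of R] by auto
  have "\<forall>j. \<exists>C. \<forall>x\<in>ball 0 R. derivs_le m (increment j) x C" using beurling_smoothD[OF increment_beurling_smooth m] by blast
  then obtain C where C: "\<And>j x. x \<in> ball 0 R \<Longrightarrow> derivs_le m (increment j) x (C j)" by metis
  have "derivs_le m extension x ((\<Sum>j<J. C j) + 4 * decay_const)" if x: "x \<in> ball 0 R" for x
  proof (rule derivs_leI)
    fix w :: "'n list"
    let ?f = "\<lambda>j. wderiv w (increment j) x"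
    let ?g = "\<lambda>j. (2 * decay_const * W m (length w)) * (1 / 2) ^ j"
    have Q0: "decay_const \<ge> 0" using c0 by (simp add: decay_const_def)
    have g: "summable ?g" "suminf ?g = 4 * decay_const * W m (length w)"
      by (auto intro!: summable_mult summable_geometric simp: suminf_mult suminf_geometric)
    have tail: "\<bar>?f (j + J)\<bar> \<le> ?g j" for j
    proof -
      have "\<bar>?f (j + J)\<bar> \<le> 2 * decay_const * (1 / 2) ^ (j + J) * W m (length w)"
        using J x by (intro derivs_leD) auto
      also have "\<dots> \<le> 2 * decay_const * (1 / 2) ^ j * W m (length w)"
        using Q0 W_pos[OF m, of "length w"] by (intro mult_right_mono mult_left_mono power_decreasing) auto
      finally show ?thesis by (simp add: mult_ac)
    qed
    have "wderiv w extension x = (\<Sum>j. ?f (j + J)) + (\<Sum>j<J. ?f j)"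
      unfolding extension_wderiv by (rule suminf_split_initial_segment[OF extension_summable])
    moreover have "\<bar>\<Sum>j. ?f (j + J)\<bar> \<le> 4 * decay_const * W m (length w)"
      using norm_suminf_le[OF _ g(1), of "\<lambda>j. ?f (j + J)"] tail g(2) by simp
    moreover have "\<bar>\<Sum>j<J. ?f j\<bar> \<le> (\<Sum>j<J. C j * W m (length w))"
      by (intro order_trans[OF sum_abs] sum_mono derivs_leD C x)
    ultimately show "\<bar>wderiv w extension x\<bar> \<le> ((\<Sum>j<J. C j) + 4 * decay_const) * W m (length w)"
      by (simp add: distrib_right sum_distrib_right)
  qed
  then show "\<exists>C. \<forall>x\<in>ball 0 R. derivs_le m extension x C" by blast
qed

definition glue :: "nat \<Rightarrow> real ^ 'n \<Rightarrow> real" where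
  "glue J y = (\<Sum>k\<in>near' J y. \<phi> J k y * local_taylor J k y)"

lemma glue_extend:
  assumes "near' J y \<subseteq> E" "finite E"
  shows "glue J y = (\<Sum>k\<in>E. \<phi> J k y * local_taylor J k y)"
  unfolding glue_def using assms by (intro sum.mono_neutral_left) (auto dest: \<phi>_nonzero)

text \<open>Close to \<open>A\<close> all cells are active and both families of bumps sum to \<open>1\<close>.\<close>

lemma increment_near:
  assumes a: "a \<in> A" and y: "dist y a < d j"
  shows "increment j y = glue j y - (case j of 0 \<Rightarrow> 0 | Suc i \<Rightarrow> glue i y)"
proof -
  have act: "near' j y \<inter> active j = near' j y" using near_active[OF a y] by auto
  show ?thesis
  proof (cases j)
    case 0
    then show ?thesis using act by (simp add: glue_def)
  next
    case (Suc i)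
    have s: "(\<Sum>k\<in>near' J y. \<phi> J k y) = 1" for J by (rule \<phi>_sum[OF subset_refl near'_finite])
    have "increment j y = (\<Sum>k\<in>near' (Suc i) y. \<Sum>l\<in>near' i y. \<phi> (Suc i) k y * \<phi> i l y * (local_taylor (Suc i) k y - local_taylor i l y))"
      using act by (simp add: Suc increment_sum_def)
    also have "\<dots> = (\<Sum>k\<in>near' (Suc i) y. (\<phi> (Suc i) k y * local_taylor (Suc i) k y) * (\<Sum>l\<in>near' i y. \<phi> i l y)
        - \<phi> (Suc i) k y * (\<Sum>l\<in>near' i y. \<phi> i l y * local_taylor i l y))"
      by (simp add: sum_distrib_left sum_subtractf[symmetric] algebra_simps)
    also have "\<dots> = glue (Suc i) y - glue i y"
      by (simp add: s sum_subtractf sum_distrib_right[symmetric] glue_def)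
    finally show ?thesis by (simp add: Suc)
  qed
qed

lemma partial_sum_near:
  assumes a: "a \<in> A" and y: "dist y a < d J"
  shows "(\<Sum>j\<le>J. increment j y) = glue J y"
  using y
proof (induction J)
  case 0
  then show ?case using increment_near[OF a 0] by simp
next
  case (Suc J)
  have "dist y a < d J" using Suc.prems d_antimono[of J "Suc J"] by simp
  then show ?case using Suc.IH increment_near[OF a Suc.prems] by simp
qed

text \<open>Near \<open>a\<close> the partial sum is \<open>\<Sum>\<^sub>k \<phi>\<^sub>k T\<^sub>k\<close>, and subtracting the Taylor polynomial at \<open>a\<close> itself gives
  \<open>\<Sum>\<^sub>k \<phi>\<^sub>k (T\<^sub>k - T\<^sub>a)\<close>, which is as small as an increment.\<close>

lemma glue_estimate:
  assumes a: "a \<in> A" and bs: "b (v (Suc J)) \<le> exp (\<kappa> (t J))"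
    and R: "norm a + 16 * real n * d0 \<le> real (v (Suc J))"
  shows "\<bar>(\<Sum>j\<le>Suc J. wderiv w (increment j) a) - taylor (p (Suc J)) a F (count_list w) a\<bar>
     \<le> decay_const * (1 / 2) ^ J * W (1 / 2) (length w)"
proof -
  let ?E = "near (d (Suc J)) (2 * d (Suc J)) a"
  let ?p = "p (Suc J)"
  define Ta where "Ta = taylor ?p a F (\<lambda>_. 0)"
  define P where "P = (2 * exp (6 * real (v J) * \<kappa> (t J))) ^ n"
  define e where "e = d (Suc J)"
  have e: "e > 0" "e \<le> d0" using d_pos[of "Suc J"] d_antimono[of 0 "Suc J"] d_def[of 0] by (simp_all add: e_def)
  have v1: "real (v J) \<ge> 1" using v(2)[of J] by simp
  have Ta: "beurling_smooth Ta" unfolding Ta_def by (rule taylor_beurling_smooth)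
  have fE: "finite ?E" by (rule near_finite[OF d_pos])
  define g where "g = (\<lambda>y. \<Sum>k\<in>?E. \<phi> (Suc J) k y * (local_taylor (Suc J) k y - Ta y))"
  have g_eq: "(\<Sum>j\<le>Suc J. increment j y) - Ta y = g y" if y: "y \<in> ball a e" for y
  proof -
    have ya: "dist y a < d (Suc J)" "dist a y < d (Suc J)" using y by (auto simp: e_def dist_commute)
    have sub: "near' (Suc J) y \<subseteq> ?E" by (rule near'_ball[OF ya(2)])
    have "g y = (\<Sum>k\<in>?E. \<phi> (Suc J) k y * local_taylor (Suc J) k y) - (\<Sum>k\<in>?E. \<phi> (Suc J) k y) * Ta y"
      by (simp add: g_def right_diff_distrib sum_subtractf sum_distrib_right)
    also have "\<dots> = glue (Suc J) y - Ta y" unfolding \<phi>_sum[OF sub fE] glue_extend[OF sub fE] by simp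
    finally show ?thesis unfolding partial_sum_near[OF a ya(1)] by simp
  qed
  have term_derivs_le: "derivs_le (1 / 2) (\<lambda>y. \<phi> (Suc J) k y * (local_taylor (Suc J) k y - Ta y)) a (P * taylor_gap J)" if k: "k \<in> ?E" for k
  proof -
    let ?a = "base (Suc J) k"
    have ne: "0 \<le> real n * e" using e by simp
    have aa: "dist a ?a \<le> 16 * real n * e"
      using base_near[OF k a] ne by (simp add: e_def)
    have "16 * real n * e \<le> 16 * real n * d0" using e by (intro mult_left_mono) auto
    moreover have "0 \<le> 16 * real n * d0" using d0 by simp
    moreover have "norm ?a \<le> norm a + dist a ?a"
      using norm_triangle_sub[of ?a a] by (simp add: dist_norm norm_minus_commute)
    ultimately have rad: "norm ?a \<le> real (v (Suc J))" "norm a \<le> real (v (Suc J))"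
      using R aa by linarith+
    have "derivs_le 1 (\<lambda>y. local_taylor (Suc J) k y - Ta y) a (taylor_gap J)"
    proof (rule derivs_leI)
      fix w :: "'n list"
      have "\<bar>taylor ?p ?a F (count_list w) a - taylor ?p a F (count_list w) a\<bar> \<le> taylor_gap J * W 1 (msize (count_list w))"
        using aa v1 by (intro taylor_move base_in a rad) (auto simp: e_def dist_commute)
      then show "\<bar>wderiv w (\<lambda>y. local_taylor (Suc J) k y - Ta y) a\<bar> \<le> taylor_gap J * W 1 (length w)"
        by (simp add: smooth_diff(2)[OF local_taylor_beurling_smooth[THEN beurling_smooth_smooth] Ta[THEN beurling_smooth_smooth]])
          (simp add: local_taylor_def Ta_def taylor_smooth length_eq_msize)
    qed
    moreover have "derivs_le 1 (\<phi> (Suc J) k) a P" unfolding P_def using v1 by (intro \<phi>_derivs_le) auto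
    ultimately show ?thesis
      using derivs_le_mult[of "\<phi> (Suc J) k" 1 a P "\<lambda>y. local_taylor (Suc J) k y - Ta y" "taylor_gap J"]
        \<phi>_beurling_smooth[THEN beurling_smooth_smooth] beurling_smooth_diff[OF local_taylor_beurling_smooth Ta, THEN beurling_smooth_smooth] by simp
  qed
  have P0: "P \<ge> 0" by (simp add: P_def)
  have "derivs_le (1 / 2) g a (\<Sum>k\<in>?E. P * taylor_gap J)"
    unfolding g_def by (intro derivs_le_sum beurling_smooth_smooth beurling_smooth_mult beurling_smooth_diff \<phi>_beurling_smooth local_taylor_beurling_smooth Ta term_derivs_le)
  then have u: "derivs_le (1 / 2) (\<lambda>y. (\<Sum>j\<le>Suc J. increment j y) - Ta y) a (\<Sum>k\<in>?E. P * taylor_gap J)"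
    by (rule derivs_le_local[rotated 3, where U = "ball a e"]) (use e g_eq in auto)
  have le: "(\<Sum>k\<in>?E. P * taylor_gap J) \<le> decay_const * (1 / 2) ^ J"
  proof -
    have card: "real (card ?E) \<le> 5 ^ n"
      using of_nat_mono[OF near_card[OF d_pos, of "Suc J" a], where 'a = real] by (simp add: n)
    have "P = 2 ^ n * exp (6 * real n * real (v J) * \<kappa> (t J))"
      unfolding P_def by (simp add: power_mult_distrib exp_of_nat_mult[symmetric] mult_ac)
    also have "\<dots> \<le> 2 ^ n * exp (12 * real n * real (v J) * \<kappa> (t J))"
      using \<kappa>t[of J] v1 by (auto intro!: mult_right_mono)
    finally have "P * taylor_gap J \<le> (2 ^ n * exp (12 * real n * real (v J) * \<kappa> (t J))) * taylor_gap J"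
      using taylor_gap_nonneg by (intro mult_right_mono)
    also have "\<dots> = 2 ^ n * (exp (12 * real n * real (v J) * \<kappa> (t J)) * taylor_gap J)" by simp
    also have "\<dots> \<le> 2 ^ n * (2 ^ n * (c0 / 2 ^ J))" by (intro mult_left_mono taylor_gap_small bs) auto
    finally have PD: "P * taylor_gap J \<le> 2 ^ n * (2 ^ n * (c0 / 2 ^ J))" .
    have "(\<Sum>k\<in>?E. P * taylor_gap J) = real (card ?E) * (P * taylor_gap J)" by simp
    also have "\<dots> \<le> 5 ^ n * (2 ^ n * (2 ^ n * (c0 / 2 ^ J)))"
      by (rule mult_mono[OF card PD]) (use P0 taylor_gap_nonneg[of J] in auto)
    also have "\<dots> = 5 ^ n * 2 ^ n * 2 ^ n * (c0 / 2 ^ J)" by simp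
    also have "\<dots> \<le> 25 ^ n * 4 ^ n * (2 * 2 ^ n) * (c0 / 2 ^ J)"
      using c0 by (intro mult_right_mono mult_mono power_mono) auto
    also have "\<dots> = decay_const * (1 / 2) ^ J" by (simp add: decay_const_def power_one_over)
    finally show ?thesis .
  qed
  have "derivs_le (1 / 2) (\<lambda>y. (\<Sum>j\<le>Suc J. increment j y) - Ta y) a (decay_const * (1 / 2) ^ J)"
    by (rule derivs_le_antimono[OF u _ _ le]) auto
  then have "\<bar>wderiv w (\<lambda>y. (\<Sum>j\<le>Suc J. increment j y) - Ta y) a\<bar> \<le> decay_const * (1 / 2) ^ J * W (1 / 2) (length w)"
    by (rule derivs_leD)
  then show ?thesis
    by (simp only: smooth_diff(2)[OF smooth_sum(1)[OF increment_smooth] Ta[THEN beurling_smooth_smooth]] smooth_sum(2)[OF increment_smooth])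
      (simp only: Ta_def taylor_smooth)
qed

lemma extension_jet:
  assumes a: "a \<in> A"
  shows "wderiv w extension a = F (count_list w) a"
proof -
  let ?L = "F (count_list w) a"
  have "eventually (\<lambda>J. nat \<lceil>norm a + 16 * real n * d0\<rceil> \<le> v J) sequentially"
    using v(3) unfolding filterlim_at_top by (rule spec)
  moreover have "eventually (\<lambda>J. length w \<le> p J) sequentially"
    using p(4) unfolding filterlim_at_top by (rule spec)
  moreover note b_small
  ultimately have "eventually (\<lambda>J. norm ((\<Sum>j\<le>Suc J. wderiv w (increment j) a) - ?L)
      \<le> decay_const * (1 / 2) ^ J * W (1 / 2) (length w)) sequentially"
  proof eventually_elim
    case (elim J)
    have "norm a + 16 * real n * d0 \<le> real (v J)" using elim(1) by linarith
    then have R: "norm a + 16 * real n * d0 \<le> real (v (Suc J))" using vm[of J "Suc J"] by simp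
    have "p J \<le> p (Suc J)" using p(3) by (simp add: monoD)
    then have "msize (count_list w) \<le> p (Suc J)" using elim(2) by (simp flip: length_eq_msize)
    then have "taylor (p (Suc J)) a F (count_list w) a = ?L" by (rule taylor_at_base)
    then show ?case using glue_estimate[OF a elim(3) R, of w] by (simp only: real_norm_def)
  qed
  moreover have "(\<lambda>J. decay_const * (1 / 2) ^ J * W (1 / 2) (length w)) \<longlonglongrightarrow> decay_const * 0 * W (1 / 2) (length w)"
    by (intro tendsto_intros LIMSEQ_power_zero) simp
  then have "(\<lambda>J. decay_const * (1 / 2) ^ J * W (1 / 2) (length w)) \<longlonglongrightarrow> 0" by simp
  ultimately have "(\<lambda>J. (\<Sum>j\<le>Suc J. wderiv w (increment j) a) - ?L) \<longlonglongrightarrow> 0"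
    by (rule Lim_null_comparison)
  then have "(\<lambda>J. \<Sum>j\<le>Suc J. wderiv w (increment j) a) \<longlonglongrightarrow> ?L" by (rule LIM_zero_cancel)
  moreover have "(\<lambda>J. \<Sum>j\<le>Suc J. wderiv w (increment j) a) \<longlonglongrightarrow> (\<Sum>j. wderiv w (increment j) a)"
    using summable_LIMSEQ'[OF extension_summable[of w a]] by (rule LIMSEQ_Suc)
  ultimately show ?thesis unfolding extension_wderiv by (rule LIMSEQ_unique[symmetric])
qed

end

context growth_weight
begin

text \<open>For a weight of power growth less than \<open>1\<close> there is no loss: jets of Beurling type extend to functions
  of the same class.\<close>

theorem whitney_extension:
  fixes A :: "(real ^ 'n::finite) set" and F :: "'n jet"
  assumes A: "closed A" "A \<noteq> {}"
    and F: "\<And>m R. m > 0 \<Longrightarrow> \<exists>C\<ge>0. \<forall>x\<in>A \<inter> cball 0 R. \<forall>\<alpha>. \<bar>F \<alpha> x\<bar> \<le> C * W m (msize \<alpha>)"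
    and R: "\<And>m R. m > 0 \<Longrightarrow> \<exists>C\<ge>0. \<forall>x\<in>A \<inter> cball 0 R. \<forall>y\<in>A \<inter> cball 0 R. \<forall>q \<alpha>. msize \<alpha> \<le> q \<longrightarrow>
       \<bar>remainder q x F \<alpha> y\<bar> \<le> C * W m (q + 1) * (norm (x - y) ^ (q + 1 - msize \<alpha>) / fact (q + 1 - msize \<alpha>))"
  shows "\<exists>f. beurling_smooth f \<and> (\<forall>x\<in>A. \<forall>w. wderiv w f x = F (count_list w) x)"
proof -
  define n where "n = CARD('n)"
  have n1: "n \<ge> 1" using zero_less_card_finite[where 'a = 'n] by (simp add: n_def)
  define B where "B = 12 * node_sum * (64 * real n * (real n + 1)) + 48 * real n + 8"
  have B: "B \<ge> 48 * real n + 8" "B > 0"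
  proof -
    have "0 \<le> 12 * node_sum * (64 * real n * (real n + 1))" using node_sum_ge by simp
    then show "B \<ge> 48 * real n + 8" "B > 0" unfolding B_def by linarith+
  qed
  let ?F = "\<lambda>C k. \<forall>x\<in>A \<inter> cball 0 (real k). \<forall>\<alpha>. \<bar>F \<alpha> x\<bar> \<le> C * W (B * real k) (msize \<alpha>)"
  let ?R = "\<lambda>C k. \<forall>x\<in>A \<inter> cball 0 (real k). \<forall>y\<in>A \<inter> cball 0 (real k). \<forall>q \<alpha>. msize \<alpha> \<le> q \<longrightarrow>
       \<bar>remainder q x F \<alpha> y\<bar> \<le> C * W (B * real k) (q + 1) * (norm (x - y) ^ (q + 1 - msize \<alpha>) / fact (q + 1 - msize \<alpha>))"
  have "\<forall>k. \<exists>C\<ge>0. k \<ge> 1 \<longrightarrow> ?F C k \<and> ?R C k"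
  proof
    fix k :: nat
    show "\<exists>C\<ge>0. k \<ge> 1 \<longrightarrow> ?F C k \<and> ?R C k"
    proof (cases "k \<ge> 1")
      case True
      then have Bk: "B * real k > 0" using B by simp
      obtain C1 C2 where C: "C1 \<ge> 0" "?F C1 k" "C2 \<ge> 0" "?R C2 k"
        using F[OF Bk, of "real k"] R[OF Bk, of "real k"] by blast
      have "?F (C1 + C2) k"
      proof (intro ballI allI)
        fix x \<alpha> assume "x \<in> A \<inter> cball 0 (real k)"
        then have "\<bar>F \<alpha> x\<bar> \<le> C1 * W (B * real k) (msize \<alpha>)" using C(2) by blast
        also have "\<dots> \<le> (C1 + C2) * W (B * real k) (msize \<alpha>)"
          using C W_pos[OF Bk, of "msize \<alpha>"] by (intro mult_right_mono) auto
        finally show "\<bar>F \<alpha> x\<bar> \<le> (C1 + C2) * W (B * real k) (msize \<alpha>)" .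
      qed
      moreover have "?R (C1 + C2) k"
      proof (intro ballI allI impI)
        fix x y q and \<alpha> :: "'n mindex"
        assume "x \<in> A \<inter> cball 0 (real k)" "y \<in> A \<inter> cball 0 (real k)" "msize \<alpha> \<le> q"
        then have "\<bar>remainder q x F \<alpha> y\<bar> \<le> C2 * W (B * real k) (q + 1) * (norm (x - y) ^ (q + 1 - msize \<alpha>) / fact (q + 1 - msize \<alpha>))"
          using C(4) by blast
        also have "\<dots> \<le> (C1 + C2) * W (B * real k) (q + 1) * (norm (x - y) ^ (q + 1 - msize \<alpha>) / fact (q + 1 - msize \<alpha>))"
          using C W_pos[OF Bk, of "q + 1"] by (intro mult_right_mono) auto
        finally show "\<bar>remainder q x F \<alpha> y\<bar> \<le> (C1 + C2) * W (B * real k) (q + 1) * (norm (x - y) ^ (q + 1 - msize \<alpha>) / fact (q + 1 - msize \<alpha>))" .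
      qed
      ultimately show ?thesis using C by (intro exI[of _ "C1 + C2"]) simp
    qed auto
  qed
  from choice[OF this] obtain b where bb: "\<forall>k. 0 \<le> b k \<and> (k \<ge> 1 \<longrightarrow> ?F (b k) k \<and> ?R (b k) k)" by (elim exE)
  have b0: "b k \<ge> 0" for k using bb by blast
  have b: "?F (b k) k \<and> ?R (b k) k" if "k \<ge> 1" for k using bb that by blast
  obtain d c0 :: real and v p :: "nat \<Rightarrow> nat" and c t :: "nat \<Rightarrow> real" where L:
    "d > 0" "c0 > 0"
    "Fun.mono v" "\<And>J. v J \<ge> 1" "filterlim v at_top sequentially"
    "eventually (\<lambda>J. b (v (Suc J)) \<le> exp (\<kappa> (t J))) sequentially"
    "\<And>J. scales n (16 * real n * (d / 2 ^ Suc J)) (B * real (v J)) (c J) (t J) (B * real (v (Suc J))) (c (Suc J)) (t (Suc J))"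
    "\<And>J. 2 ^ J \<le> c0 * t J" "\<And>J. \<kappa> (t J) \<ge> 1"
    "\<And>J. real (p J) + 1 \<le> B * real (v J) * c J * t J" "\<And>J. B * real (v J) * c J * t J \<le> real (p J) + 2"
    "Fun.mono p" "filterlim p at_top sequentially"
    "\<And>J. 6 * node_sum * real (v J) * c J \<le> d / 2 ^ Suc J"
    by (rule levels[OF n1 B_def, where b = b]) (rule that)
  have "\<forall>J. \<exists>\<psi>. bump (d / 2 ^ J) \<psi> \<and> (\<forall>m>0. \<exists>C. \<forall>j x. \<bar>\<psi> j x\<bar> \<le> C * W m j) \<and>
     (\<forall>I. J = Suc I \<longrightarrow> (\<forall>j x. \<bar>\<psi> j x\<bar> \<le> 2 * exp (6 * real (v I) * \<kappa> (t I)) * W (real (v I)) j))"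
    (is "\<forall>J. \<exists>\<psi>. ?P J \<psi>")
  proof
    fix J
    show "\<exists>\<psi>. ?P J \<psi>"
    proof (cases J)
    case 0
    have "0 < d / 2 ^ J" using L(1) by simp
    from bump_any[OF this] show ?thesis using 0 by simp
  next
    case (Suc I)
    have s: "touch (c I) (t I)" "c I > 0" "t I \<ge> 1" using L(7)[of I] by (simp_all add: scales_def)
    have dJ: "0 < d / 2 ^ Suc I" using L(1) by simp
    have "1 \<le> real (v I)" using L(4)[of I] by simp
    from bump_quantitative[OF s L(9) this dJ L(14)] show ?thesis unfolding Suc by simp
    qed
  qed
  from choice[OF this] obtain \<psi> where \<psi>0: "\<forall>J. ?P J (\<psi> J)" by (elim exE)
  have \<psi>: "\<And>J. bump (d / 2 ^ J) (\<psi> J)"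
    "\<And>J m. m > 0 \<Longrightarrow> \<exists>C. \<forall>j x. \<bar>\<psi> J j x\<bar> \<le> C * W m j"
    "\<And>J j x. \<bar>\<psi> (Suc J) j x\<bar> \<le> 2 * exp (6 * real (v J) * \<kappa> (t J)) * W (real (v J)) j"
    using \<psi>0 by blast+
  interpret whitney_data \<kappa> r A F n b B d c0 v p c t \<psi>
  proof unfold_locales
    show "CARD('n) = n" by (simp add: n_def)
    show "\<bar>F \<alpha> x\<bar> \<le> b k * W (B * real k) (msize \<alpha>)" if "k \<ge> 1" "x \<in> A" "norm x \<le> real k" for k x \<alpha>
      using b[OF that(1)] that by simp
    show "\<bar>remainder q x F \<alpha> y\<bar> \<le> b k * W (B * real k) (q + 1) * (norm (x - y) ^ (q + 1 - msize \<alpha>) / fact (q + 1 - msize \<alpha>))"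
      if "k \<ge> 1" "x \<in> A" "norm x \<le> real k" "y \<in> A" "norm y \<le> real k" "msize \<alpha> \<le> q" for k x y q \<alpha>
      using conjunct2[OF b[OF that(1)]] that by simp
  qed (fact A b0 B L \<psi>)+
  show ?thesis using extension_beurling_smooth extension_jet by blast
qed

end

section \<open>The intermediate weight\<close>

definition tail_kernel :: "real \<Rightarrow> (real \<Rightarrow> real) \<Rightarrow> real \<Rightarrow> real \<Rightarrow> real" where
  "tail_kernel r \<omega> t u = indicator {1..} u * (\<omega> (t * u) / u powr (1 + r))"

text \<open>The weight \<open>\<integral>\<^sub>1\<^sup>\<infinity> \<omega>(t u) u\<^sup>-\<^sup>1\<^sup>-\<^sup>r du\<close> that mediates between \<open>\<omega>\<close> and \<open>\<sigma>\<close>.\<close>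

definition tail_weight :: "real \<Rightarrow> (real \<Rightarrow> real) \<Rightarrow> real \<Rightarrow> real" where
  "tail_weight r \<omega> t = (LINT u|lborel. tail_kernel r \<omega> t u)"

locale tail_integrable =
  fixes \<omega> :: "real \<Rightarrow> real" and r :: real
  assumes \<omega>: "weight_function \<omega>" and r: "0 < r" "r < 1"
    and finite: "\<And>t. t > 0 \<Longrightarrow> (\<integral>\<^sup>+u\<in>{1..}. ennreal (\<omega> (t * u) / u powr (1 + r)) \<partial>lborel) < \<infinity>"
begin

abbreviation "g \<equiv> tail_kernel r \<omega>"
abbreviation "\<kappa> \<equiv> tail_weight r \<omega>"

lemma \<omega>_nonneg: "t \<ge> 0 \<Longrightarrow> 0 \<le> \<omega> t"
  and \<omega>_mono: "0 \<le> s \<Longrightarrow> s \<le> t \<Longrightarrow> \<omega> s \<le> \<omega> t"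
  and \<omega>_cont: "continuous_on {0..} \<omega>"
  and \<omega>_convex: "convex_on UNIV (\<lambda>x. \<omega> (exp x))"
  and \<omega>_ln: "ln \<in> o[at_top](\<omega>)"
  using \<omega> by (auto simp: weight_function_def mono_on_def)

lemma g_nonneg: "t > 0 \<Longrightarrow> 0 \<le> g t u"
  by (auto simp: tail_kernel_def indicator_def intro!: \<omega>_nonneg divide_nonneg_nonneg)

lemma g_measurable:
  assumes "t > 0"
  shows "g t \<in> borel_measurable borel"
proof -
  have "continuous_on {1..} (\<lambda>u. \<omega> (t * u) / u powr (1 + r))"
    using assms
    by (intro continuous_on_divide continuous_on_compose2[OF \<omega>_cont] continuous_on_powr continuous_intros) auto
  then have "(\<lambda>u. indicator {1..} u *\<^sub>R (\<omega> (t * u) / u powr (1 + r))) \<in> borel_measurable borel"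
    by (intro borel_measurable_continuous_on_indicator) auto
  then show ?thesis by (simp add: tail_kernel_def[abs_def])
qed

lemma g_nn_integral:
  "(\<integral>\<^sup>+u. ennreal (g t u) \<partial>lborel) = (\<integral>\<^sup>+u\<in>{1..}. ennreal (\<omega> (t * u) / u powr (1 + r)) \<partial>lborel)"
  by (intro nn_integral_cong) (auto simp: tail_kernel_def indicator_def)

lemma g_integrable: "t > 0 \<Longrightarrow> integrable lborel (g t)"
  using finite[of t] g_measurable[of t] g_nonneg[of t]
  by (intro integrableI_nonneg) (auto simp: g_nn_integral)

lemma \<kappa>_eq: "t > 0 \<Longrightarrow> ennreal (\<kappa> t) = (\<integral>\<^sup>+u\<in>{1..}. ennreal (\<omega> (t * u) / u powr (1 + r)) \<partial>lborel)"
  unfolding tail_weight_def g_nn_integral[symmetric]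
  by (intro nn_integral_eq_integral[symmetric] g_integrable) (auto intro: g_nonneg)

lemma \<kappa>_nonneg: "t > 0 \<Longrightarrow> 0 \<le> \<kappa> t"
  unfolding tail_weight_def by (intro Bochner_Integration.integral_nonneg g_nonneg)

lemma \<kappa>_mono:
  assumes "0 < s" "s \<le> t"
  shows "\<kappa> s \<le> \<kappa> t"
  unfolding tail_weight_def
proof (intro integral_mono g_integrable)
  fix u show "g s u \<le> g t u"
    using assms by (auto simp: tail_kernel_def indicator_def intro!: divide_right_mono \<omega>_mono)
qed (use assms in auto)

text \<open>Substituting \<open>v = l u\<close> gives \<open>l\<^sup>r\<close> times the integral of the same kernel over the smaller domain
  \<open>v \<ge> l\<close>. This is where the exponent \<open>1 + r\<close> of the kernel enters.\<close>

lemma \<kappa>_scale: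
  assumes s: "0 < s" and l: "1 \<le> l"
  shows "\<kappa> (l * s) \<le> l powr r * \<kappa> s"
proof -
  define G where "G v = indicator {l..} v * g s v" for v
  have Gm: "G \<in> borel_measurable borel" unfolding G_def using g_measurable[OF s] by measurable
  have Gle: "0 \<le> G v" "G v \<le> g s v" for v
    using g_nonneg[OF s, of v] by (auto simp: G_def indicator_def)
  have Gi: "integrable lborel G"
    by (rule Bochner_Integration.integrable_bound[OF g_integrable[OF s]])
      (use Gm Gle in \<open>auto intro!: AE_I2 simp: abs_of_nonneg order_trans[OF Gle]\<close>)
  have "(LINT v|lborel. G v) = \<bar>l\<bar> *\<^sub>R (LINT u|lborel. G (0 + l * u))"
    using l by (intro lborel_integral_real_affine) auto
  also have "(\<lambda>u. G (0 + l * u)) = (\<lambda>u. (1 / l powr (1 + r)) * g (l * s) u)"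
  proof
    fix u
    have "l \<le> l * u \<longleftrightarrow> 1 \<le> u" using l by simp
    moreover have "1 \<le> l * u" if "1 \<le> u" using l that mult_mono[of 1 l 1 u] by simp
    ultimately show "G (0 + l * u) = (1 / l powr (1 + r)) * g (l * s) u"
      using l by (auto simp: G_def tail_kernel_def indicator_def powr_mult mult_ac)
  qed
  also have "(LINT u|lborel. (1 / l powr (1 + r)) * g (l * s) u) = (1 / l powr (1 + r)) * \<kappa> (l * s)"
    by (simp add: tail_weight_def)
  finally have "(LINT v|lborel. G v) = l * (1 / l powr (1 + r)) * \<kappa> (l * s)" using l by simp
  also have "l * (1 / l powr (1 + r)) = 1 / l powr r" using l by (simp add: powr_add)
  finally have "\<kappa> (l * s) = l powr r * (LINT v|lborel. G v)" using l by simp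
  also have "\<dots> \<le> l powr r * \<kappa> s"
    unfolding tail_weight_def by (intro mult_left_mono integral_mono Gi g_integrable s Gle) auto
  finally show ?thesis .
qed

text \<open>For fixed \<open>u\<close> the function \<open>x \<mapsto> \<omega>(exp(x) u) = \<omega>(exp(x + ln u))\<close> is convex.\<close>

lemma \<kappa>_convex: "convex_on UNIV (\<lambda>x. \<kappa> (exp x))"
proof (rule convex_onI)
  fix \<theta> x y :: real assume \<theta>: "0 < \<theta>" "\<theta> < 1"
  let ?z = "(1 - \<theta>) *\<^sub>R x + \<theta> *\<^sub>R y"
  have "\<kappa> (exp ?z) \<le> (LINT u|lborel. (1 - \<theta>) * g (exp x) u + \<theta> * g (exp y) u)"
    unfolding tail_weight_def
  proof (intro integral_mono g_integrable Bochner_Integration.integrable_add integrable_mult_right)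
    fix u
    show "g (exp ?z) u \<le> (1 - \<theta>) * g (exp x) u + \<theta> * g (exp y) u"
    proof (cases "u \<ge> 1")
      case True
      have e: "exp a * u = exp (a + ln u)" for a using True by (simp add: exp_add)
      have "\<omega> (exp ((1 - \<theta>) *\<^sub>R (x + ln u) + \<theta> *\<^sub>R (y + ln u))) \<le> (1 - \<theta>) * \<omega> (exp (x + ln u)) + \<theta> * \<omega> (exp (y + ln u))"
        using convex_onD[OF \<omega>_convex, of \<theta> "x + ln u" "y + ln u"] \<theta> by simp
      moreover have "(1 - \<theta>) *\<^sub>R (x + ln u) + \<theta> *\<^sub>R (y + ln u) = ?z + ln u" by (simp add: algebra_simps)
      ultimately have "\<omega> (exp ?z * u) \<le> (1 - \<theta>) * \<omega> (exp x * u) + \<theta> * \<omega> (exp y * u)" unfolding e by simp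
      then have "\<omega> (exp ?z * u) / u powr (1 + r) \<le> ((1 - \<theta>) * \<omega> (exp x * u) + \<theta> * \<omega> (exp y * u)) / u powr (1 + r)"
        by (intro divide_right_mono) auto
      then show ?thesis using True by (simp add: tail_kernel_def add_divide_distrib)
    qed (simp add: tail_kernel_def)
  qed auto
  also have "\<dots> = (1 - \<theta>) * \<kappa> (exp x) + \<theta> * \<kappa> (exp y)"
    unfolding tail_weight_def by (subst Bochner_Integration.integral_add) (auto intro!: integrable_mult_right g_integrable)
  finally show "\<kappa> (exp ?z) \<le> (1 - \<theta>) * \<kappa> (exp x) + \<theta> * \<kappa> (exp y)" .
qed simp

text \<open>On \<open>1 \<le> u \<le> 2\<close> the kernel is at least \<open>\<omega>(t) / 4\<close>.\<close>

lemma \<omega>_le_\<kappa>: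
  assumes t: "t > 0"
  shows "\<omega> t \<le> 4 * \<kappa> t"
proof -
  have i: "integrable lborel (\<lambda>u. indicator {1..2::real} u *\<^sub>R (\<omega> t / 4))"
    by (intro integrable_scaleR_left) (auto simp: integrable_indicator_iff)
  have "(LINT u|lborel. indicator {1..2::real} u *\<^sub>R (\<omega> t / 4)) \<le> \<kappa> t"
    unfolding tail_weight_def
  proof (rule integral_mono[OF i g_integrable[OF t]])
    fix u :: real
    show "indicator {1..2} u *\<^sub>R (\<omega> t / 4) \<le> g t u"
    proof (cases "u \<in> {1..2}")
      case True
      have "u powr (1 + r) \<le> 2 powr (1 + r)" using True r by (intro powr_mono2) auto
      also have "(2::real) powr (1 + r) \<le> 2 powr 2" using r by (intro powr_mono) auto
      also have "(2::real) powr 2 = 4" by simp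
      finally have 1: "u powr (1 + r) \<le> 4" .
      have "t * 1 \<le> t * u" using True t by (intro mult_left_mono) auto
      then have 2: "\<omega> t \<le> \<omega> (t * u)" using \<omega>_mono[of t "t * u"] t by simp
      have "\<omega> t / 4 \<le> \<omega> (t * u) / u powr (1 + r)"
        using 1 2 True \<omega>_nonneg[of t] t by (intro frac_le) auto
      then show ?thesis using True by (simp add: tail_kernel_def)
    qed (use g_nonneg[OF t, of u] in simp)
  qed
  then show ?thesis by simp
qed

lemma \<kappa>_above_ln: "\<exists>S\<ge>1. \<forall>s\<ge>S. D * ln s \<le> \<kappa> s"
proof -
  have "eventually (\<lambda>u. norm (ln u) \<le> 1 / (4 * (\<bar>D\<bar> + 1)) * norm (\<omega> u)) at_top"
    using \<omega>_ln by (intro landau_o.smallD) auto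
  then obtain N where N: "\<And>u. u \<ge> N \<Longrightarrow> norm (ln u) \<le> 1 / (4 * (\<bar>D\<bar> + 1)) * norm (\<omega> u)"
    by (auto simp: eventually_at_top_linorder)
  have "D * ln s \<le> \<kappa> s" if s: "s \<ge> max 1 N" for s
  proof -
    have ls: "ln s \<ge> 0" using s by simp
    have "ln s \<le> \<omega> s / (4 * (\<bar>D\<bar> + 1))" using N[of s] s ls \<omega>_nonneg[of s] by simp
    then have "4 * ((\<bar>D\<bar> + 1) * ln s) \<le> \<omega> s" by (simp add: field_simps)
    moreover have "D * ln s \<le> (\<bar>D\<bar> + 1) * ln s" using ls by (intro mult_right_mono) auto
    moreover have "\<omega> s \<le> 4 * \<kappa> s" using s by (intro \<omega>_le_\<kappa>) simp
    ultimately show ?thesis by linarith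
  qed
  then show ?thesis by (intro exI[of _ "max 1 N"]) simp
qed

sublocale growth_weight \<kappa> r
  by unfold_locales (fact r \<kappa>_nonneg \<kappa>_mono \<kappa>_scale \<kappa>_convex \<kappa>_above_ln)+

text \<open>Functions of class \<open>\<kappa>\<close> are of class \<open>\<omega>\<close>.\<close>

lemma W_le_young:
  assumes k: "k > 0"
  shows "W (4 * k) j \<le> exp (k * young_conj \<omega> (real j / k))"
proof (rule W_least)
  fix s :: real assume s: "s \<ge> 1"
  have "ln s * (real j / k) - \<omega> (exp (ln s)) \<le> young_conj \<omega> (real j / k)"
    unfolding young_conj_def using s by (intro cSUP_upper bdd_above_young_conj[OF \<omega>]) auto
  then have "k * (ln s * (real j / k) - \<omega> s) \<le> k * young_conj \<omega> (real j / k)"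
    using s k by (intro mult_left_mono) auto
  moreover have "k * (ln s * (real j / k) - \<omega> s) = real j * ln s - k * \<omega> s" using k by (simp add: algebra_simps)
  moreover have "k * \<omega> s \<le> 4 * k * \<kappa> s" using \<omega>_le_\<kappa>[of s] s k by simp
  ultimately have "real j * ln s - 4 * k * \<kappa> s \<le> k * young_conj \<omega> (real j / k)" by linarith
  then have "exp (real j * ln s - 4 * k * \<kappa> s) \<le> exp (k * young_conj \<omega> (real j / k))" by simp
  then show "s ^ j * exp (- (4 * k * \<kappa> s)) \<le> exp (k * young_conj \<omega> (real j / k))"
    using s by (simp add: exp_diff exp_minus exp_of_nat_mult divide_inverse)
qed

text \<open>Jets of class \<open>\<sigma>\<close> are of class \<open>\<kappa>\<close>.\<close>

lemma young_le_W:
  assumes C: "C > 0" and \<sigma>: "\<And>t. t > 0 \<Longrightarrow> \<kappa> t \<le> C * \<sigma> t + C" and k: "k > 0"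
  shows "exp (k * young_conj \<sigma> (real j / k)) \<le> exp k * W (k / C) j"
proof -
  have kC: "k / C > 0" using k C by simp
  have W0: "0 < exp k * W (k / C) j" using W_pos[OF kC] by simp
  have "young_conj \<sigma> (real j / k) \<le> ln (exp k * W (k / C) j) / k"
    unfolding young_conj_def
  proof (rule cSUP_least)
    fix s :: real assume s: "s \<in> {0..}"
    have "k / C * \<kappa> (exp s) \<le> k / C * (C * \<sigma> (exp s) + C)"
      using kC by (intro mult_left_mono \<sigma>) auto
    also have "\<dots> = k * \<sigma> (exp s) + k" using C by (simp add: field_simps)
    finally have "k * (s * (real j / k) - \<sigma> (exp s)) \<le> k + (real j * s - k / C * \<kappa> (exp s))"
      using k by (simp add: algebra_simps)
    also have "exp (k + (real j * s - k / C * \<kappa> (exp s))) = exp k * (exp s ^ j * exp (- (k / C * \<kappa> (exp s))))"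
      by (simp add: exp_add exp_diff exp_minus exp_of_nat_mult divide_inverse)
    then have "k + (real j * s - k / C * \<kappa> (exp s)) = ln (exp k * (exp s ^ j * exp (- (k / C * \<kappa> (exp s)))))"
      by (metis ln_exp)
    also have "\<dots> \<le> ln (exp k * W (k / C) j)"
      using W_ge[OF kC, of "exp s" j] s W0 by (subst ln_le_cancel_iff) auto
    finally show "s * (real j / k) - \<sigma> (exp s) \<le> ln (exp k * W (k / C) j) / k"
      using k by (simp add: pos_le_divide_eq mult.commute)
  qed auto
  then have "k * young_conj \<sigma> (real j / k) \<le> ln (exp k * W (k / C) j)"
    using k by (simp add: pos_le_divide_eq mult.commute)
  then have "exp (k * young_conj \<sigma> (real j / k)) \<le> exp (ln (exp k * W (k / C) j))" by simp
  then show ?thesis using W0 by simp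
qed

lemma beurling_smooth_imp_beurling:
  assumes f: "beurling_smooth f"
  shows "f \<in> beurling_class \<omega>"
  unfolding beurling_class_def
proof (intro CollectI conjI allI impI)
  show "C_infinity f" by (rule smooth_imp_C_infinity[OF beurling_smooth_smooth[OF f]])
  fix U :: "(real ^ 'a) set" and k :: nat
  assume U: "open U \<and> compact (closure U) \<and> k \<ge> 1"
  then have k: "real k > 0" by simp
  have "compact (closure U)" using U by simp
  then have "bounded U" using compact_imp_bounded bounded_subset closure_subset by metis
  then obtain R where R: "U \<subseteq> ball 0 R" using bounded_subset_ballD[of U 0] by metis
  obtain B where B: "\<forall>x\<in>ball 0 R. derivs_le (4 * real k) f x B" using beurling_smoothD[OF f, of "4 * real k" R] k by auto
  have "ultra_norm \<omega> U (1 / real k) f \<le> ennreal B"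
    unfolding ultra_norm_def
  proof (intro SUP_least ennreal_leI)
    fix x and \<alpha> :: "'a mindex" assume x: "x \<in> U"
    have ux: "derivs_le (4 * real k) f x B" using B R x by auto
    have B0: "B \<ge> 0" by (rule derivs_le_nonneg[OF ux]) (use k in simp)
    let ?E = "exp (real k * young_conj \<omega> (real (msize \<alpha>) / real k))"
    have "\<bar>mderiv \<alpha> f x\<bar> \<le> B * W (4 * real k) (msize \<alpha>)"
      using derivs_leD[OF ux, of "mword \<alpha>"] by (simp add: mderiv_eq_wderiv length_mword)
    also have "\<dots> \<le> B * ?E" using B0 W_le_young[OF k] by (intro mult_left_mono)
    finally have "\<bar>mderiv \<alpha> f x\<bar> * exp (- (real k * young_conj \<omega> (real (msize \<alpha>) / real k))) \<le> B"
      by (simp add: exp_minus field_simps)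
    then show "\<bar>mderiv \<alpha> f x\<bar> * exp (- (1 / (1 / real k)) * young_conj \<omega> (1 / real k * real (msize \<alpha>))) \<le> B"
      by simp
  qed
  then show "ultra_norm \<omega> U (1 / real k) f < \<infinity>"
    using le_less_trans[OF _ ennreal_less_top] by (simp add: infinity_ennreal_def)
qed

end

text \<open>The case \<open>x = y\<close>, which the definition of ultrajets leaves out, is trivial because the remainder
  vanishes there.\<close>

lemma ultrajet_bounds:
  fixes F :: "'n::finite jet"
  assumes F: "F \<in> beurling_ultrajets \<sigma> A" and K: "compact K" "K \<subseteq> A" and m: "(m::nat) \<ge> 1"
  shows "\<exists>B\<ge>0. (\<forall>x\<in>K. \<forall>\<alpha>. \<bar>F \<alpha> x\<bar> \<le> B * exp (real m * young_conj \<sigma> (real (msize \<alpha>) / real m))) \<and>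
     (\<forall>x\<in>K. \<forall>y\<in>K. \<forall>p \<alpha>. msize \<alpha> \<le> p \<longrightarrow> \<bar>remainder p x F \<alpha> y\<bar> \<le>
        B * exp (real m * young_conj \<sigma> (real (p + 1) / real m)) * (norm (x - y) ^ (p + 1 - msize \<alpha>) / fact (p + 1 - msize \<alpha>)))"
proof -
  let ?E = "\<lambda>j. exp (real m * young_conj \<sigma> (real j / real m))"
  let ?f = "\<lambda>x \<alpha>. \<bar>F \<alpha> x\<bar> * exp (- real m * young_conj \<sigma> (real (msize \<alpha>) / real m))"
  let ?g = "\<lambda>x y p \<alpha>. \<bar>remainder p x F \<alpha> y\<bar> * (fact (p + 1 - msize \<alpha>) / norm (x - y) ^ (p + 1 - msize \<alpha>)) *
                    exp (- real m * young_conj \<sigma> (real (p + 1) / real m))"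
  have s: "(SUP x\<in>K. SUP \<alpha>. ennreal (?f x \<alpha>)) < \<infinity>"
    "(SUP (x, y)\<in>{(x, y). x \<in> K \<and> y \<in> K \<and> x \<noteq> y}. SUP p. SUP \<alpha>\<in>{\<alpha>. msize \<alpha> \<le> p}. ennreal (?g x y p \<alpha>)) < \<infinity>"
    using F K m unfolding beurling_ultrajets_def by blast+
  define S1 where "S1 = (SUP x\<in>K. SUP \<alpha>. ennreal (?f x \<alpha>))"
  define S2 where "S2 = (SUP (x, y)\<in>{(x, y). x \<in> K \<and> y \<in> K \<and> x \<noteq> y}. SUP p. SUP \<alpha>\<in>{\<alpha>. msize \<alpha> \<le> p}. ennreal (?g x y p \<alpha>))"
  define B where "B = max (enn2real S1) (enn2real S2)"
  have S: "S1 < top" "S2 < top"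
    using s unfolding S1_def[symmetric] S2_def[symmetric] infinity_ennreal_def by this
  note fin = ennreal_enn2real[OF S(1)] ennreal_enn2real[OF S(2)]
  have f: "?f x \<alpha> \<le> B" if "x \<in> K" for x \<alpha>
  proof -
    have "ennreal (?f x \<alpha>) \<le> S1"
      unfolding S1_def by (rule SUP_upper2[OF that]) (rule SUP_upper, simp)
    then have "ennreal (?f x \<alpha>) \<le> ennreal (enn2real S1)" unfolding fin .
    then have "?f x \<alpha> \<le> enn2real S1" by (simp only: ennreal_le_iff[OF enn2real_nonneg])
    then show ?thesis by (simp add: B_def)
  qed
  have g: "?g x y p \<alpha> \<le> B" if "x \<in> K" "y \<in> K" "x \<noteq> y" "msize \<alpha> \<le> p" for x y p \<alpha>
  proof -
    have "ennreal (?g x y p \<alpha>) \<le> (SUP \<alpha>\<in>{\<alpha>. msize \<alpha> \<le> p}. ennreal (?g x y p \<alpha>))"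
      by (rule SUP_upper) (use that in simp)
    also have "\<dots> \<le> (SUP p. SUP \<alpha>\<in>{\<alpha>. msize \<alpha> \<le> p}. ennreal (?g x y p \<alpha>))"
      by (rule SUP_upper) simp
    also have "\<dots> \<le> S2"
      unfolding S2_def by (rule SUP_upper2[of "(x, y)"]) (use that in auto)
    finally have "ennreal (?g x y p \<alpha>) \<le> ennreal (enn2real S2)" unfolding fin .
    then have "?g x y p \<alpha> \<le> enn2real S2" by (simp only: ennreal_le_iff[OF enn2real_nonneg])
    then show ?thesis by (simp add: B_def)
  qed
  have B0: "B \<ge> 0" by (simp add: B_def le_max_iff_disj)
  show ?thesis
  proof (intro exI[of _ B] conjI ballI allI impI B0)
    fix x \<alpha> assume "x \<in> K"
    from f[OF this, of \<alpha>] show "\<bar>F \<alpha> x\<bar> \<le> B * ?E (msize \<alpha>)" by (simp add: exp_minus field_simps)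
  next
    fix x y p and \<alpha> :: "'n mindex" assume x: "x \<in> K" "y \<in> K" "msize \<alpha> \<le> p"
    let ?e = "p + 1 - msize \<alpha>"
    show "\<bar>remainder p x F \<alpha> y\<bar> \<le> B * ?E (p + 1) * (norm (x - y) ^ ?e / fact ?e)"
    proof (cases "x = y")
      case True
      have "remainder p x F \<alpha> y = 0"
        unfolding remainder_eq_taylor[OF x(3)] True taylor_at_base[OF x(3)] by simp
      then show ?thesis using B0 by simp
    next
      case False
      then have n: "norm (x - y) ^ ?e > 0" by simp
      have cancel: "u = u * (f / h) * exp (- z) * (exp z * (h / f))" if "h > 0" "f > 0" for u f h z :: real
        using that by (simp add: exp_minus)
      have "\<bar>remainder p x F \<alpha> y\<bar> = ?g x y p \<alpha> * (?E (p + 1) * (norm (x - y) ^ ?e / fact ?e))"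
        unfolding mult_minus_left by (rule cancel[OF n fact_gt_zero])
      also have "\<dots> \<le> B * (?E (p + 1) * (norm (x - y) ^ ?e / fact ?e))"
        using g[OF x(1,2) False x(3)] by (intro mult_right_mono) auto
      finally show ?thesis by (simp add: mult_ac)
    qed
  qed
qed

theorem theorem2:
  fixes \<omega> \<sigma> :: "real \<Rightarrow> real"
    and A :: "(real ^ 'n::finite) set"
  assumes "weight_function \<omega>" and "non_quasianalytic \<omega>" and "concave_on {0..} \<omega>"
    and "weight_function \<sigma>" and "\<sigma> \<in> o[at_top](\<lambda>t. t)"
    and "\<exists>r::real. 0 < r \<and> r < 1 \<and>
           (\<exists>C>0. \<forall>t>0. (\<integral>\<^sup>+u\<in>{1..}. ennreal (\<omega> (t * u) / u powr (1 + r)) \<partial>lborel)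
                          \<le> ennreal (C * \<sigma> t + C))"
    and "closed A" and "A \<noteq> {}"
  shows "jet_map A ` beurling_class \<omega> \<supseteq> beurling_ultrajets \<sigma> A"
proof
  fix F assume F: "F \<in> beurling_ultrajets \<sigma> A"
  obtain r C :: real where r: "0 < r" "r < 1" and C: "C > 0"
    and le: "\<And>t. t > 0 \<Longrightarrow> (\<integral>\<^sup>+u\<in>{1..}. ennreal (\<omega> (t * u) / u powr (1 + r)) \<partial>lborel) \<le> ennreal (C * \<sigma> t + C)"
    using assms(6) by blast
  interpret tail_integrable \<omega> r
  proof
    show "(\<integral>\<^sup>+u\<in>{1..}. ennreal (\<omega> (t * u) / u powr (1 + r)) \<partial>lborel) < \<infinity>" if "t > 0" for t
      using le_less_trans[OF le[OF that], of \<infinity>] by simp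
  qed (fact assms(1) r)+
  have \<sigma>: "tail_weight r \<omega> t \<le> C * \<sigma> t + C" if t: "t > 0" for t
  proof -
    have "0 \<le> \<sigma> t" using assms(4) t by (simp add: weight_function_def)
    then have "0 \<le> C * \<sigma> t + C" using C by simp
    then show ?thesis using le[OF t] by (simp add: \<kappa>_eq[OF t, symmetric] ennreal_le_iff)
  qed
  have ex: "\<exists>B\<ge>0. (\<forall>x\<in>A \<inter> cball 0 R. \<forall>\<alpha>. \<bar>F \<alpha> x\<bar> \<le> B * W m (msize \<alpha>)) \<and>
     (\<forall>x\<in>A \<inter> cball 0 R. \<forall>y\<in>A \<inter> cball 0 R. \<forall>q \<alpha>. msize \<alpha> \<le> q \<longrightarrow>
       \<bar>remainder q x F \<alpha> y\<bar> \<le> B * W m (q + 1) * (norm (x - y) ^ (q + 1 - msize \<alpha>) / fact (q + 1 - msize \<alpha>)))"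
    if m: "m > 0" for m R
  proof -
    \<comment> \<open>The parameter \<open>k\<close> for \<open>\<sigma>\<close> corresponds to \<open>k / C \<ge> m\<close> for \<open>\<kappa>\<close>.\<close>
    define k where "k = nat \<lceil>C * m\<rceil>"
    have Cm: "C * m > 0" using C m by simp
    have k: "k \<ge> 1" "C * m \<le> real k" using Cm by (auto simp: k_def) linarith+
    have k0: "real k > 0" using k by simp
    have km: "m \<le> real k / C" using k C by (simp add: field_simps)
    have E: "exp (real k * young_conj \<sigma> (real j / real k)) \<le> exp (real k) * W m j" for j
    proof -
      have "exp (real k * young_conj \<sigma> (real j / real k)) \<le> exp (real k) * W (real k / C) j"
        by (rule young_le_W[OF C \<sigma> k0])
      also have "\<dots> \<le> exp (real k) * W m j" using W_antimono[OF m km] by simp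
      finally show ?thesis .
    qed
    have K: "compact (A \<inter> cball 0 R)" "A \<inter> cball 0 R \<subseteq> A"
      using assms(7) by (auto intro: closed_Int_compact)
    obtain B where B: "B \<ge> 0"
      "\<forall>x\<in>A \<inter> cball 0 R. \<forall>\<alpha>. \<bar>F \<alpha> x\<bar> \<le> B * exp (real k * young_conj \<sigma> (real (msize \<alpha>) / real k))"
      "\<forall>x\<in>A \<inter> cball 0 R. \<forall>y\<in>A \<inter> cball 0 R. \<forall>q \<alpha>. msize \<alpha> \<le> q \<longrightarrow> \<bar>remainder q x F \<alpha> y\<bar> \<le>
        B * exp (real k * young_conj \<sigma> (real (q + 1) / real k)) * (norm (x - y) ^ (q + 1 - msize \<alpha>) / fact (q + 1 - msize \<alpha>))"
      using ultrajet_bounds[OF F K k(1)] by blast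
    have BE: "B * exp (real k * young_conj \<sigma> (real j / real k)) \<le> (B * exp (real k)) * W m j" for j
      using mult_left_mono[OF E B(1), of j] by (simp add: mult.assoc)
    show ?thesis
    proof (intro exI[of _ "B * exp (real k)"] conjI ballI allI impI)
      show "0 \<le> B * exp (real k)" using B(1) by simp
      show "\<bar>F \<alpha> x\<bar> \<le> (B * exp (real k)) * W m (msize \<alpha>)" if "x \<in> A \<inter> cball 0 R" for x \<alpha>
        using B(2) that BE[of "msize \<alpha>"] by (meson order_trans)
      fix x y q and \<alpha> :: "'n mindex"
      assume "x \<in> A \<inter> cball 0 R" "y \<in> A \<inter> cball 0 R" "msize \<alpha> \<le> q"
      then have "\<bar>remainder q x F \<alpha> y\<bar> \<le>
        B * exp (real k * young_conj \<sigma> (real (q + 1) / real k)) * (norm (x - y) ^ (q + 1 - msize \<alpha>) / fact (q + 1 - msize \<alpha>))"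
        using B(3) by blast
      also have "\<dots> \<le> (B * exp (real k)) * W m (q + 1) * (norm (x - y) ^ (q + 1 - msize \<alpha>) / fact (q + 1 - msize \<alpha>))"
        using BE[of "q + 1"] by (intro mult_right_mono) auto
      finally show "\<bar>remainder q x F \<alpha> y\<bar> \<le>
        (B * exp (real k)) * W m (q + 1) * (norm (x - y) ^ (q + 1 - msize \<alpha>) / fact (q + 1 - msize \<alpha>))" .
    qed
  qed
  have "\<exists>f. beurling_smooth f \<and> (\<forall>x\<in>A. \<forall>w. wderiv w f x = F (count_list w) x)"
  proof (rule whitney_extension[OF assms(7,8)])
    fix m R :: real assume "m > 0"
    from ex[OF this, of R] show "\<exists>C\<ge>0. \<forall>x\<in>A \<inter> cball 0 R. \<forall>\<alpha>. \<bar>F \<alpha> x\<bar> \<le> C * W m (msize \<alpha>)" by blast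
  next
    fix m R :: real assume "m > 0"
    from ex[OF this, of R] show "\<exists>C\<ge>0. \<forall>x\<in>A \<inter> cball 0 R. \<forall>y\<in>A \<inter> cball 0 R. \<forall>q \<alpha>. msize \<alpha> \<le> q \<longrightarrow>
       \<bar>remainder q x F \<alpha> y\<bar> \<le> C * W m (q + 1) * (norm (x - y) ^ (q + 1 - msize \<alpha>) / fact (q + 1 - msize \<alpha>))" by blast
  qed
  then obtain f where f: "beurling_smooth f" "\<And>x w. x \<in> A \<Longrightarrow> wderiv w f x = F (count_list w) x" by blast
  have ext: "F \<alpha> \<in> extensional A" for \<alpha>
    using F by (simp add: beurling_ultrajets_def whitney_jets_def)
  have "jet_map A f = F"
  proof (intro HOL.ext)
    fix \<alpha> :: "'n mindex" and x
    have "count_list (mword \<alpha>) = \<alpha>" by (rule HOL.ext) (rule count_list_mword)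
    then show "jet_map A f \<alpha> x = F \<alpha> x"
      using f(2)[of x "mword \<alpha>"] extensional_arb[OF ext[of \<alpha>], of x]
      by (simp add: jet_map_def mderiv_eq_wderiv restrict_def)
  qed
  then show "F \<in> jet_map A ` beurling_class \<omega>" using beurling_smooth_imp_beurling[OF f(1)] by blast
qed

end
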